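(* If $(G,\tau_G)$ is a weakly almost periodic group with closed normal subgroup $N$, and $\pi:G\to\mathcal B(\mathcal X)$ is a weakly almost periodic representation on a Banach space $\mathcal X$, then $$\mathcal X^\pi_{\tau_{G:N}}=\{\xi\in\mathcal X:\pi(n)\xi=\xi\text{ for each }n\in N\}$$ is a $\pi(G)$-reducing subspace. In particular, $\mathcal W(G/N)\circ q_N$ is a complemented translation-invariant subspace of $\mathcal W(G)$.
   Context: For a topological group $H$, $\mathcal W(H)$ is the C*-algebra of bounded continuous complex functions $u$ on $H$ for which the weak closure of $\{u\cdot s:s\in H\}$, $(u\cdot s)(t)=u(st)$, is weakly compact in the space of bounded continuous functions (uniform norm). $\sigma(X,\mathcal F)$ denotes the initial topology. $(G,\tau_G)$ is weakly almost periodic if $\tau_G$ is Hausdorff and $\tau_G=\sigma(G,\mathcal W(G))$. $q_N:G\to G/N$ is the quotient map and $\tau_{G:N}=\sigma(G,\mathcal W(G/N)\circ q_N)$. A (unital, weak operator continuous) representation $\pi:G\to\mathcal B(\mathcal X)$ is weakly almost periodic if the weak operator closure $\overline{\pi(G)}^{wo}$ is weak operator compact. For a group topology $\tau$, $\mathcal X^\pi_\tau=\{\xi\in\mathcal X:\pi(\cdot)\xi\text{ is }\tau\text{-continuous on }G\}$, with $\mathcal X$ carrying the weak topology. $\mathrm{Aff}^{wo}_\pi(G)$ is the weak operator closure of the convex hull of $\pi(G)$. A subspace $\mathcal Y$ of $\mathcal X$ is $\pi(G)$-reducing if there is an idempotent $M\in\mathrm{Aff}^{wo}_\pi(G)$ with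 $\pi(s)M=M\pi(s)$ for all $s\in G$ and $\mathcal Y=M\mathcal X$. *)

theory Defs
  imports
    "HOL-Analysis.Analysis"
    "HOL-Algebra.Coset"
    "HOL-Library.Function_Algebras"
begin

section \<open>Complex Banach spaces\<close>

class complex_vector = ab_group_add +
  fixes scaleC :: "complex \<Rightarrow> 'a \<Rightarrow> 'a"  (infixr \<open>*\<^sub>C\<close> 75)
  assumes scaleC_add_right: "a *\<^sub>C (x + y) = a *\<^sub>C x + a *\<^sub>C y"
    and scaleC_add_left: "(a + b) *\<^sub>C x = a *\<^sub>C x + b *\<^sub>C x"
    and scaleC_scaleC: "a *\<^sub>C b *\<^sub>C x = (a * b) *\<^sub>C x"
    and scaleC_one: "1 *\<^sub>C x = x"

global_interpretation complex_vector: vector_space "scaleC :: complex \<Rightarrow> 'a \<Rightarrow> 'a::complex_vector"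
  by unfold_locales (rule scaleC_add_right scaleC_add_left scaleC_scaleC scaleC_one)+

class complex_normed_vector = real_normed_vector + complex_vector +
  assumes scaleR_scaleC: "r *\<^sub>R x = of_real r *\<^sub>C x"
    and norm_scaleC: "norm (a *\<^sub>C x) = cmod a * norm x"

class complex_banach = complex_normed_vector + banach

instantiation complex :: complex_banach
begin
definition scaleC_complex :: "complex \<Rightarrow> complex \<Rightarrow> complex" where "scaleC_complex = (*)"
instance
  by standard (simp_all add: scaleC_complex_def algebra_simps norm_mult scaleR_conv_of_real)
end

instantiation "fun" :: (type, complex_vector) complex_vector
begin
definition scaleC_fun :: "complex \<Rightarrow> ('a \<Rightarrow> 'b) \<Rightarrow> 'a \<Rightarrow> 'b" where
  "scaleC_fun c f = (\<lambda>x. c *\<^sub>C f x)"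
instance
  by standard (simp_all add: scaleC_fun_def fun_eq_iff scaleC_add_right scaleC_add_left
      scaleC_scaleC scaleC_one)
end


section \<open>Initial topologies, duals and weak topologies\<close>

text \<open>\<open>initial_topology X F\<close> is \<open>\<sigma>(X, F)\<close>. The set \<open>X\<close> itself is put
  into the subbase so that the underlying set is \<open>X\<close> even if \<open>F\<close> is empty.\<close>

definition initial_topology :: "'a set \<Rightarrow> ('a \<Rightarrow> 'b::topological_space) set \<Rightarrow> 'a topology" where
  "initial_topology X F =
     topology_generated_by (insert X {{x \<in> X. f x \<in> U} | f U. f \<in> F \<and> open U})"

lemma topspace_initial_topology [simp]: "topspace (initial_topology X F) = X"
  by (auto simp: initial_topology_def topology_generated_by_topspace)

text \<open>Normed spaces are given here by a complex linear subspace \<open>V\<close> of a vector space and a norm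
  \<open>nrm\<close> on \<open>V\<close>; in this way the same notions apply to a Banach space (with
  \<open>V = UNIV\<close>) and to spaces of functions on a group. Only the values on \<open>V\<close> of the
  maps below matter.\<close>

definition bounded_clinear_on ::
  "'v::complex_vector set \<Rightarrow> ('v \<Rightarrow> real) \<Rightarrow> ('w::complex_vector \<Rightarrow> real) \<Rightarrow> ('v \<Rightarrow> 'w) \<Rightarrow> bool" where
  "bounded_clinear_on V nrm nrm' f \<longleftrightarrow>
     (\<forall>u\<in>V. \<forall>v\<in>V. f (u + v) = f u + f v) \<and>
     (\<forall>c. \<forall>v\<in>V. f (c *\<^sub>C v) = c *\<^sub>C f v) \<and>
     (\<exists>K. \<forall>v\<in>V. nrm' (f v) \<le> K * nrm v)"

definition dual_space :: "'v::complex_vector set \<Rightarrow> ('v \<Rightarrow> real) \<Rightarrow> ('v \<Rightarrow> complex) set" where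
  "dual_space V nrm = {\<phi>. bounded_clinear_on V nrm cmod \<phi>}"

definition weak_topology :: "'v::complex_vector set \<Rightarrow> ('v \<Rightarrow> real) \<Rightarrow> 'v topology" where
  "weak_topology V nrm = initial_topology V (dual_space V nrm)"

definition complemented_in :: "'v::complex_vector set \<Rightarrow> 'v set \<Rightarrow> ('v \<Rightarrow> real) \<Rightarrow> bool" where
  "complemented_in Y V nrm \<longleftrightarrow>
     (\<exists>P. bounded_clinear_on V nrm nrm P \<and> P ` V = Y \<and> Y \<subseteq> V \<and> (\<forall>v\<in>V. P (P v) = P v))"


section \<open>Topological groups and quotients\<close>

locale topological_group = group G for G :: "('g, 'm) monoid_scheme" (structure) +
  fixes T :: "'g topology"
  assumes topspace_eq: "topspace T = carrier G"
    and continuous_mult: "continuous_map (prod_topology T T) T (\<lambda>(x, y). x \<otimes> y)"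
    and continuous_inv: "continuous_map T T (\<lambda>x. inv x)"

definition quotient_group_topology ::
  "('g, 'm) monoid_scheme \<Rightarrow> 'g topology \<Rightarrow> 'g set \<Rightarrow> 'g set topology" where
  "quotient_group_topology G T N = topology (\<lambda>U. U \<subseteq> carrier (G Mod N) \<and>
     openin T {x \<in> carrier G. N #>\<^bsub>G\<^esub> x \<in> U})"

lemma openin_quotient_group_topology:
  "openin (quotient_group_topology G T N) U \<longleftrightarrow>
     U \<subseteq> carrier (G Mod N) \<and> openin T {x \<in> carrier G. N #>\<^bsub>G\<^esub> x \<in> U}"
proof -
  let ?P = "\<lambda>U. U \<subseteq> carrier (G Mod N) \<and> openin T {x \<in> carrier G. N #>\<^bsub>G\<^esub> x \<in> U}"
  have "istopology ?P"
    unfolding istopology_def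
  proof (intro conjI allI impI)
    fix S S' assume "?P S" "?P S'"
    moreover have "{x \<in> carrier G. N #>\<^bsub>G\<^esub> x \<in> S \<inter> S'} =
        {x \<in> carrier G. N #>\<^bsub>G\<^esub> x \<in> S} \<inter> {x \<in> carrier G. N #>\<^bsub>G\<^esub> x \<in> S'}" by auto
    ultimately show "S \<inter> S' \<subseteq> carrier (G Mod N)"
      "openin T {x \<in> carrier G. N #>\<^bsub>G\<^esub> x \<in> S \<inter> S'}" by auto
  next
    fix \<K> assume *: "\<forall>K\<in>\<K>. ?P K"
    have "{x \<in> carrier G. N #>\<^bsub>G\<^esub> x \<in> \<Union>\<K>} = (\<Union>K\<in>\<K>. {x \<in> carrier G. N #>\<^bsub>G\<^esub> x \<in> K})" by auto
    with * show "\<Union>\<K> \<subseteq> carrier (G Mod N)" "openin T {x \<in> carrier G. N #>\<^bsub>G\<^esub> x \<in> \<Union>\<K>}"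
      by auto
  qed
  then show ?thesis
    by (simp add: quotient_group_topology_def topology_inverse')
qed

lemma (in topological_group) quotient_map_quotient_group_topology:
  "quotient_map T (quotient_group_topology G T N) (\<lambda>x. N #> x)"
proof -
  have pre: "{x \<in> carrier G. N #> x \<in> carrier (G Mod N)} = topspace T"
    by (auto simp: carrier_FactGroup topspace_eq)
  have "openin (quotient_group_topology G T N) (carrier (G Mod N))"
    unfolding openin_quotient_group_topology pre by simp
  then have "topspace (quotient_group_topology G T N) = carrier (G Mod N)"
    by (metis openin_quotient_group_topology openin_subset openin_topspace subset_antisym)
  then show ?thesis
    by (auto simp: quotient_map_def openin_quotient_group_topology topspace_eq carrier_FactGroup)
qed


section \<open>Weakly almost periodic functions\<close>

text \<open>A function on a set \<open>A\<close> is represented by its extension by zero, so that functions on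
  \<open>A\<close> form a complex linear subspace of the space of all functions on the type.\<close>

definition zero_ext :: "'a set \<Rightarrow> ('a \<Rightarrow> 'b::zero) \<Rightarrow> 'a \<Rightarrow> 'b" where
  "zero_ext A f = (\<lambda>x. if x \<in> A then f x else 0)"

definition bounded_continuous :: "'a topology \<Rightarrow> ('a \<Rightarrow> complex) set" where
  "bounded_continuous T = {u. continuous_map T euclidean u \<and> bounded (u ` topspace T) \<and>
     (\<forall>x. x \<notin> topspace T \<longrightarrow> u x = 0)}"

definition sup_norm :: "'a topology \<Rightarrow> ('a \<Rightarrow> complex) \<Rightarrow> real" where
  "sup_norm T u = (SUP x\<in>topspace T. cmod (u x))"

text \<open>\<open>left_translate G u s\<close> is \<open>u \<cdot> s\<close>, i.e. \<open>t \<mapsto> u(st)\<close>, and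
  \<open>right_translate G u s\<close> is \<open>t \<mapsto> u(ts)\<close>.\<close>

definition left_translate ::
  "('g, 'm) monoid_scheme \<Rightarrow> ('g \<Rightarrow> complex) \<Rightarrow> 'g \<Rightarrow> 'g \<Rightarrow> complex" where
  "left_translate G u s = zero_ext (carrier G) (\<lambda>t. u (s \<otimes>\<^bsub>G\<^esub> t))"

definition right_translate ::
  "('g, 'm) monoid_scheme \<Rightarrow> ('g \<Rightarrow> complex) \<Rightarrow> 'g \<Rightarrow> 'g \<Rightarrow> complex" where
  "right_translate G u s = zero_ext (carrier G) (\<lambda>t. u (t \<otimes>\<^bsub>G\<^esub> s))"

definition wap_functions ::
  "('g, 'm) monoid_scheme \<Rightarrow> 'g topology \<Rightarrow> ('g \<Rightarrow> complex) set" where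
  "wap_functions G T = {u \<in> bounded_continuous T.
     let W = weak_topology (bounded_continuous T) (sup_norm T)
     in compactin W (W closure_of (left_translate G u ` carrier G))}"

locale weakly_almost_periodic_group = topological_group +
  assumes Hausdorff: "Hausdorff_space T"
    and topology_eq: "T = initial_topology (carrier G) (wap_functions G T)"

definition wap_functions_quotient ::
  "('g, 'm) monoid_scheme \<Rightarrow> 'g topology \<Rightarrow> 'g set \<Rightarrow> ('g \<Rightarrow> complex) set" where
  "wap_functions_quotient G T N =
     (\<lambda>v. zero_ext (carrier G) (\<lambda>x. v (N #>\<^bsub>G\<^esub> x))) `
       wap_functions (G Mod N) (quotient_group_topology G T N)"

text \<open>The topology \<open>\<tau>\<^bsub>G:N\<^esub>\<close>.\<close>

definition wap_quotient_topology ::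
  "('g, 'm) monoid_scheme \<Rightarrow> 'g topology \<Rightarrow> 'g set \<Rightarrow> 'g topology" where
  "wap_quotient_topology G T N = initial_topology (carrier G) (wap_functions_quotient G T N)"

definition translation_invariant ::
  "('g, 'm) monoid_scheme \<Rightarrow> ('g \<Rightarrow> complex) set \<Rightarrow> bool" where
  "translation_invariant G Y \<longleftrightarrow>
     (\<forall>u\<in>Y. \<forall>s\<in>carrier G. left_translate G u s \<in> Y \<and> right_translate G u s \<in> Y)"


section \<open>Weakly almost periodic representations\<close>

text \<open>Library bounded operators are real linear; \<open>\<B>(\<X>)\<close> consists of the complex linear ones.\<close>

definition bounded_operators :: "('x::complex_banach \<Rightarrow>\<^sub>L 'x) set" where
  "bounded_operators = {A. \<forall>c \<xi>. blinfun_apply A (c *\<^sub>C \<xi>) = c *\<^sub>C blinfun_apply A \<xi>}"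

definition weak_operator_topology :: "('x::complex_banach \<Rightarrow>\<^sub>L 'x) topology" where
  "weak_operator_topology = initial_topology bounded_operators
     {\<lambda>A. \<phi> (blinfun_apply A \<xi>) | \<phi> \<xi>. \<phi> \<in> dual_space UNIV norm}"

locale group_representation = topological_group +
  fixes \<pi> :: "'a \<Rightarrow> ('x::complex_banach \<Rightarrow>\<^sub>L 'x)"
  assumes rep_mult: "\<lbrakk>s \<in> carrier G; t \<in> carrier G\<rbrakk> \<Longrightarrow> \<pi> (s \<otimes> t) = \<pi> s o\<^sub>L \<pi> t"
    and rep_one: "\<pi> \<one> = id_blinfun"
    and rep_continuous: "continuous_map T weak_operator_topology \<pi>"

locale wap_representation = group_representation +
  assumes wap: "compactin weak_operator_topology
    (weak_operator_topology closure_of (\<pi> ` carrier G))"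

definition continuity_vectors ::
  "'g topology \<Rightarrow> ('g \<Rightarrow> ('x::complex_banach \<Rightarrow>\<^sub>L 'x)) \<Rightarrow> 'x set" where
  "continuity_vectors \<tau> \<pi> =
     {\<xi>. continuous_map \<tau> (weak_topology UNIV norm) (\<lambda>s. blinfun_apply (\<pi> s) \<xi>)}"

definition Aff_wo ::
  "('g, 'm) monoid_scheme \<Rightarrow> ('g \<Rightarrow> ('x::complex_banach \<Rightarrow>\<^sub>L 'x)) \<Rightarrow> ('x \<Rightarrow>\<^sub>L 'x) set" where
  "Aff_wo G \<pi> = weak_operator_topology closure_of (convex hull (\<pi> ` carrier G))"

definition reducing_subspace ::
  "('g, 'm) monoid_scheme \<Rightarrow> ('g \<Rightarrow> ('x::complex_banach \<Rightarrow>\<^sub>L 'x)) \<Rightarrow> 'x set \<Rightarrow> bool" where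
  "reducing_subspace G \<pi> Y \<longleftrightarrow> complex_vector.subspace Y \<and>
     (\<exists>M\<in>Aff_wo G \<pi>. M o\<^sub>L M = M \<and> (\<forall>s\<in>carrier G. \<pi> s o\<^sub>L M = M o\<^sub>L \<pi> s) \<and>
        Y = range (blinfun_apply M))"

end

theory Submission
  imports Defs "HOL-Probability.Discrete_Topology"
begin

text \<open>
  The proof averages over \<open>N\<close>. If a bounded group \<open>\<U>\<close> of operators on a Banach space moves a vector
  \<open>x\<close> along a relatively weakly compact orbit, then the closed convex hull of the orbit contains exactly
  one point fixed by \<open>\<U>\<close>, called \<open>mean x\<close> below. The map \<open>mean\<close> is linear and bounded, it is a pointwise
  limit of convex combinations of elements of \<open>\<U>\<close> (simultaneously at finitely many vectors,
  \<open>mean_simultaneous\<close>), it is the identity on fixed vectors, and it commutes with every operator that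
  normalises \<open>\<U>\<close> (\<open>mean_commute\<close>). For \<open>\<U> = \<pi>(N)\<close> it is the idempotent that reduces the space of
  \<open>N\<close>-fixed vectors. For the left translations by \<open>N\<close> on \<open>\<W>(G)\<close> it is a projection onto the functions
  in \<open>\<W>(G)\<close> that are constant on the cosets of \<open>N\<close>, and these are the elements of \<open>\<W>(G/N) \<circ> q\<^sub>N\<close>
  (\<open>wap_functions_quotient_eq\<close>).

  The description of the continuity vectors follows from the same identification: a coefficient
  \<open>s \<mapsto> \<phi>(\<pi>(s)\<xi>)\<close> is weakly almost periodic, and if \<open>\<xi>\<close> is fixed by \<open>N\<close> it is constant on cosets, so it is one
  of the functions that generate \<open>\<tau>\<^bsub>G:N\<^esub>\<close>. Conversely no function in \<open>\<W>(G/N) \<circ> q\<^sub>N\<close> separates an element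
  of \<open>N\<close> from the neutral element, so continuity for \<open>\<tau>\<^bsub>G:N\<^esub>\<close> forces \<open>\<pi>(n)\<xi> = \<xi>\<close>.

  Existence of fixed points is the Ryll-Nardzewski theorem for bounded groups of operators. For a countable
  group, a minimal weakly closed invariant subset of the orbit closure is norm totally bounded, by the
  Baire category theorem (\<open>minimal_set_near_compact\<close>), and on a norm compact convex set Kakutani's
  argument with Chebyshev centres applies (\<open>fixed_point_in_compact_convex\<close>). An arbitrary group is reached
  through an increasing sequence of countable subgroups along which the fixed points converge in norm
  (\<open>ergodic_limit_exists\<close>).

  Uniqueness of fixed points, and the fact that coefficients are weakly almost periodic, both rest on
  Grothendieck's theorem that the rows of a bounded kernel \<open>f(s, t)\<close> form a relatively weakly compact set
  of bounded functions as soon as its columns do (\<open>weakly_compact_transpose\<close>). It exchanges left and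
  right translates. If a functional failed to be continuous on the rows for pointwise convergence, its
  variation, a finitely additive measure, would yield sequences \<open>s\<^sub>i\<close>, \<open>t\<^sub>k\<close> whose values \<open>f(s\<^sub>i, t\<^sub>k)\<close> for
  \<open>i \<le> k\<close> are separated from those for \<open>k < i\<close> (\<open>gap_sequences\<close>), and weak compactness of the columns
  forbids this (\<open>no_gap\<close>).

  Functional analysis is done over the reals; a complex functional is recovered from its real part.
  Functions on a group are embedded in the Banach space of all bounded functions on the type, where
  translations act as composition operators.
\<close>

section \<open>Initial topologies\<close>

lemma continuous_map_from_initial_topology:
  assumes "f \<in> F" shows "continuous_map (initial_topology X F) euclidean f"
proof -
  have "openin (initial_topology X F) {x \<in> X. f x \<in> U}" if "open U" for U
    unfolding initial_topology_def using assms that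
    by (intro topology_generated_by_Basis) auto
  then show ?thesis by (simp add: continuous_map_def)
qed

lemma continuous_map_into_initial_topology:
  "continuous_map S (initial_topology X F) g \<longleftrightarrow>
     g \<in> topspace S \<rightarrow> X \<and> (\<forall>f\<in>F. continuous_map S euclidean (\<lambda>x. f (g x)))"
  (is "?lhs \<longleftrightarrow> ?rhs")
proof
  assume L: ?lhs
  then have "g \<in> topspace S \<rightarrow> X" by (simp add: continuous_map_def)
  moreover have "continuous_map S euclidean (\<lambda>x. f (g x))" if "f \<in> F" for f
    using continuous_map_compose[OF L continuous_map_from_initial_topology[OF that]]
    by (simp add: o_def)
  ultimately show ?rhs by blast
next
  assume R: ?rhs
  have "openin S (g -` A \<inter> topspace S)"
    if "A \<in> insert X {{x \<in> X. f x \<in> U} | f U. f \<in> F \<and> open U}" for A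
  proof -
    consider "A = X" | f U where "A = {x \<in> X. f x \<in> U}" "f \<in> F" "open U" using \<open>A \<in> _\<close> by blast
    then show ?thesis
    proof cases
      case 1
      then have "g -` A \<inter> topspace S = topspace S" using R by auto
      then show ?thesis by simp
    next
      case 2
      then have "g -` A \<inter> topspace S = {x \<in> topspace S. f (g x) \<in> U}" using R by auto
      moreover have "openin S {x \<in> topspace S. f (g x) \<in> U}"
        using R 2 by (auto simp: continuous_map_def)
      ultimately show ?thesis by simp
    qed
  qed
  moreover have "g ` topspace S \<subseteq> \<Union> (insert X {{x \<in> X. f x \<in> U} | f U. f \<in> F \<and> open U})"
    using R by auto
  ultimately show ?lhs
    unfolding initial_topology_def continuous_on_generated_topo_iff by blast
qed

lemma initial_topology_basic_nbhd:
  fixes F :: "('a \<Rightarrow> 'b::metric_space) set"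
  assumes "openin (initial_topology X F) U" "x \<in> U"
  obtains F0 e where "finite F0" "F0 \<subseteq> F" "e > 0"
    "{y \<in> X. \<forall>f\<in>F0. dist (f y) (f x) < e} \<subseteq> U"
proof -
  have "\<exists>F0 e. finite F0 \<and> F0 \<subseteq> F \<and> e > 0 \<and> {y \<in> X. \<forall>f\<in>F0. dist (f y) (f x) < e} \<subseteq> U"
    using assms unfolding initial_topology_def openin_topology_generated_by_iff
  proof (induction U)
    case Empty
    then show ?case by simp
  next
    case (Int a b)
    then have xa: "x \<in> a" and xb: "x \<in> b" by auto
    obtain A d where "finite A" "A \<subseteq> F" "d > 0" and A: "{y \<in> X. \<forall>f\<in>A. dist (f y) (f x) < d} \<subseteq> a"
      using Int.IH(1)[OF xa] by blast
    obtain B e where "finite B" "B \<subseteq> F" "e > 0" and B: "{y \<in> X. \<forall>f\<in>B. dist (f y) (f x) < e} \<subseteq> b"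
      using Int.IH(2)[OF xb] by blast
    have "{y \<in> X. \<forall>f\<in>A \<union> B. dist (f y) (f x) < min d e} \<subseteq> a \<inter> b" using A B by auto
    with \<open>finite A\<close> \<open>A \<subseteq> F\<close> \<open>d > 0\<close> \<open>finite B\<close> \<open>B \<subseteq> F\<close> \<open>e > 0\<close> show ?case
      by (intro exI[of _ "A \<union> B"] exI[of _ "min d e"] conjI) auto
  next
    case (UN K)
    then obtain k where "k \<in> K" "x \<in> k" by blast
    with UN.IH[OF this] show ?case by (meson Union_upper subset_trans)
  next
    case (Basis s)
    then consider "s = X" | f V where "s = {x \<in> X. f x \<in> V}" "f \<in> F" "open V" by blast
    then show ?case
    proof cases
      case 1
      then show ?thesis by (intro exI[of _ "{}"] exI[of _ 1]) auto
    next
      case 2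
      with Basis obtain e where "e > 0" "ball (f x) e \<subseteq> V" by (auto elim: openE)
      with 2 show ?thesis
        by (intro exI[of _ "{f}"] exI[of _ e]) (auto simp: dist_commute)
    qed
  qed
  with that show thesis by blast
qed

lemma Hausdorff_initial_topology:
  fixes F :: "('a \<Rightarrow> 'b::t2_space) set"
  assumes "\<And>x y. x \<in> X \<Longrightarrow> y \<in> X \<Longrightarrow> x \<noteq> y \<Longrightarrow> \<exists>f\<in>F. f x \<noteq> f y"
  shows "Hausdorff_space (initial_topology X F)"
  unfolding Hausdorff_space_def
proof (intro allI impI)
  fix x y assume "x \<in> topspace (initial_topology X F) \<and> y \<in> topspace (initial_topology X F) \<and> x \<noteq> y"
  then have xy: "x \<in> X" "y \<in> X" "x \<noteq> y" by auto
  then obtain f where f: "f \<in> F" "f x \<noteq> f y" using assms by blast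
  then obtain U V where UV: "open U" "open V" "f x \<in> U" "f y \<in> V" "U \<inter> V = {}"
    using hausdorff by metis
  have "openin (initial_topology X F) {x \<in> X. f x \<in> W}" if "open W" for W
    using continuous_map_from_initial_topology[OF f(1)] that by (auto simp: continuous_map_def)
  then show "\<exists>U V. openin (initial_topology X F) U \<and> openin (initial_topology X F) V \<and>
      x \<in> U \<and> y \<in> V \<and> disjnt U V"
    using UV xy by (intro exI[of _ "{x \<in> X. f x \<in> U}"] exI[of _ "{x \<in> X. f x \<in> V}"])
      (auto simp: disjnt_def)
qed


section \<open>The Hahn-Banach theorem and its consequences\<close>

definition sublinear :: "('a::real_vector \<Rightarrow> real) \<Rightarrow> bool" where
  "sublinear p \<longleftrightarrow> (\<forall>x y. p (x + y) \<le> p x + p y) \<and> (\<forall>t\<ge>0. \<forall>x. p (t *\<^sub>R x) = t * p x)"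

lemma sublinear_zero: "sublinear p \<Longrightarrow> p 0 = 0"
  unfolding sublinear_def by (metis mult_zero_left order_refl scale_zero_left)

lemma sublinear_minus:
  assumes "sublinear p" shows "- p (- x) \<le> p x"
proof -
  have "p (x + - x) \<le> p x + p (- x)" using assms unfolding sublinear_def by blast
  then show ?thesis using sublinear_zero[OF assms] by simp
qed

lemma sublinearI:
  assumes "\<And>x y. p (x + y) \<le> p x + p y" "p 0 = 0"
    and "\<And>t x. t > 0 \<Longrightarrow> p (t *\<^sub>R x) \<le> t * p x"
  shows "sublinear p"
proof -
  have "p (t *\<^sub>R x) = t * p x" if "t \<ge> 0" for t x
  proof (cases "t = 0")
    case False
    with that have t: "t > 0" by simp
    have "p (inverse t *\<^sub>R (t *\<^sub>R x)) \<le> inverse t * p (t *\<^sub>R x)"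
      using t by (intro assms(3)) simp
    then have "t * p x \<le> p (t *\<^sub>R x)"
      using t by (simp add: field_simps)
    with assms(3)[OF t, of x] show ?thesis by simp
  qed (simp add: assms)
  with assms(1) show ?thesis unfolding sublinear_def by blast
qed

text \<open>The largest amount by which \<open>q\<close> can be lowered, within the sublinear functionals, by prescribing the
  value \<open>- q z\<close> at \<open>- z\<close>. If \<open>q\<close> is minimal this changes nothing, and so a minimal \<open>q\<close> is odd.\<close>

definition lowered_at :: "'a::real_vector \<Rightarrow> ('a \<Rightarrow> real) \<Rightarrow> 'a \<Rightarrow> real" where
  "lowered_at z q = (\<lambda>y. INF t\<in>{0..}. q (y + t *\<^sub>R z) - t * q z)"

lemma lowered_at:
  assumes q: "sublinear q"
  shows "sublinear (lowered_at z q)" "lowered_at z q y \<le> q y" "lowered_at z q (- z) \<le> - q z"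
proof -
  have sub: "q (x + y) \<le> q x + q y" and hom: "t \<ge> 0 \<Longrightarrow> q (t *\<^sub>R x) = t * q x" for x y t
    using q unfolding sublinear_def by auto
  have q0: "q 0 = 0" by (rule sublinear_zero[OF q])
  have low: "- q (- y) \<le> q (y + t *\<^sub>R z) - t * q z" if "t \<ge> 0" for y t
    using sub[of "- y" "y + t *\<^sub>R z"] hom[OF that, of z] by simp
  have bdd: "bdd_below ((\<lambda>t. q (y + t *\<^sub>R z) - t * q z) ` {0..})" for y
    using low by (intro bdd_belowI2) auto
  have le: "lowered_at z q y \<le> q (y + t *\<^sub>R z) - t * q z" if "t \<ge> 0" for y t
    unfolding lowered_at_def using that by (intro cINF_lower[OF bdd]) auto
  have ge: "c \<le> lowered_at z q y" if "\<And>t. t \<ge> 0 \<Longrightarrow> c \<le> q (y + t *\<^sub>R z) - t * q z" for y c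
    unfolding lowered_at_def using that by (intro cINF_greatest) auto
  show "lowered_at z q y \<le> q y" using le[of 0 y] by simp
  show "lowered_at z q (- z) \<le> - q z" using le[of 1 "- z"] q0 by simp
  show "sublinear (lowered_at z q)"
  proof (rule sublinearI)
    show "lowered_at z q 0 = 0"
      using le[of 0 0] ge[of 0 0] q0 by (auto simp: hom)
  next
    fix x y
    have "lowered_at z q (x + y) - (q (y + t *\<^sub>R z) - t * q z) \<le> lowered_at z q x" if t: "t \<ge> 0" for t
    proof (rule ge)
      fix s :: real assume s: "s \<ge> 0"
      have "lowered_at z q (x + y) \<le> q ((x + y) + (s + t) *\<^sub>R z) - (s + t) * q z"
        using s t by (intro le) simp
      also have "q ((x + y) + (s + t) *\<^sub>R z) \<le> q (x + s *\<^sub>R z) + q (y + t *\<^sub>R z)"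
        using sub[of "x + s *\<^sub>R z" "y + t *\<^sub>R z"] by (simp add: algebra_simps)
      finally show "lowered_at z q (x + y) - (q (y + t *\<^sub>R z) - t * q z) \<le> q (x + s *\<^sub>R z) - s * q z"
        by (simp add: algebra_simps)
    qed
    then have "lowered_at z q (x + y) - lowered_at z q x \<le> q (y + t *\<^sub>R z) - t * q z" if "t \<ge> 0" for t
      using that by (simp add: algebra_simps)
    then have "lowered_at z q (x + y) - lowered_at z q x \<le> lowered_at z q y" by (rule ge)
    then show "lowered_at z q (x + y) \<le> lowered_at z q x + lowered_at z q y" by simp
  next
    fix t :: real and x assume t: "t > 0"
    have "lowered_at z q (t *\<^sub>R x) / t \<le> lowered_at z q x"
    proof (rule ge)
      fix s :: real assume s: "s \<ge> 0"
      have "lowered_at z q (t *\<^sub>R x) \<le> q (t *\<^sub>R x + (t * s) *\<^sub>R z) - (t * s) * q z"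
        using s t by (intro le) simp
      also have "t *\<^sub>R x + (t * s) *\<^sub>R z = t *\<^sub>R (x + s *\<^sub>R z)" by (simp add: algebra_simps)
      also have "q \<dots> = t * q (x + s *\<^sub>R z)" using t by (simp add: hom)
      finally show "lowered_at z q (t *\<^sub>R x) / t \<le> q (x + s *\<^sub>R z) - s * q z"
        using t by (simp add: field_simps)
    qed
    then show "lowered_at z q (t *\<^sub>R x) \<le> t * lowered_at z q x"
      using t by (simp add: field_simps)
  qed
qed

text \<open>A minimal element among the sublinear functionals below \<open>p\<close> is linear: it coincides with each of its
  lowerings, so it is odd, and an odd sublinear functional is linear.\<close>

lemma hahn_banach_dominated:
  assumes p: "sublinear p"
  obtains f where "linear f" "\<And>x. f x \<le> p x"
proof -
  define A where "A = {q. sublinear q \<and> q \<le> p}"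
  let ?R = "\<lambda>q r::'a \<Rightarrow> real. r \<le> q"
  have "\<exists>m\<in>A. \<forall>a\<in>A. ?R m a \<longrightarrow> a = m"
  proof (rule predicate_Zorn)
    show "partial_order_on A (relation_of ?R A)"
      by (auto simp: partial_order_on_def preorder_on_def refl_on_def trans_def antisym_def relation_of_def)
  next
    fix C assume "C \<in> Chains (relation_of ?R A)"
    then have CA: "C \<subseteq> A" and ch: "\<And>q r. q \<in> C \<Longrightarrow> r \<in> C \<Longrightarrow> q \<le> r \<or> r \<le> q"
      by (auto simp: Chains_def relation_of_def)
    show "\<exists>u\<in>A. \<forall>a\<in>C. u \<le> a"
    proof (cases "C = {}")
      case True
      then show ?thesis using p by (auto simp: A_def)
    next
      case False
      have sl: "sublinear q" if "q \<in> C" for q using CA that by (auto simp: A_def)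
      have low: "- p (- x) \<le> q x" if "q \<in> C" for q x
      proof -
        have "q (- x) \<le> p (- x)" using CA that by (auto simp: A_def le_fun_def)
        then show ?thesis using sublinear_minus[OF sl[OF that], of x] by linarith
      qed
      define u where "u = (\<lambda>x. INF q\<in>C. q x)"
      have bdd: "bdd_below ((\<lambda>q. q x) ` C)" for x using low by (intro bdd_belowI2) auto
      have le: "u x \<le> q x" if "q \<in> C" for q x
        unfolding u_def using that by (intro cINF_lower[OF bdd])
      have ge: "c \<le> u x" if "\<And>q. q \<in> C \<Longrightarrow> c \<le> q x" for c x
        unfolding u_def using that False by (intro cINF_greatest)
      have "sublinear u"
      proof (rule sublinearI)
        show "u 0 = 0" using le ge[of 0 0] False sublinear_zero[OF sl]
          by (metis all_not_in_conv order_antisym order_refl)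
      next
        fix x y
        have "u (x + y) - r y \<le> u x" if r: "r \<in> C" for r
        proof (rule ge)
          fix q assume q: "q \<in> C"
          from ch[OF q r] obtain m where "m \<in> C" "m \<le> q" "m \<le> r" using q r by blast
          have "u (x + y) \<le> m (x + y)" by (rule le) fact
          also have "\<dots> \<le> m x + m y" using sl[OF \<open>m \<in> C\<close>] by (auto simp: sublinear_def)
          also have "\<dots> \<le> q x + r y" using \<open>m \<le> q\<close> \<open>m \<le> r\<close> by (auto simp: le_fun_def add_mono)
          finally show "u (x + y) - r y \<le> q x" by simp
        qed
        then have "u (x + y) - u x \<le> u y" by (intro ge) (simp add: algebra_simps)
        then show "u (x + y) \<le> u x + u y" by simp
      next
        fix t :: real and x assume t: "t > 0"
        have "u (t *\<^sub>R x) / t \<le> u x"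
        proof (rule ge)
          fix q assume q: "q \<in> C"
          have "u (t *\<^sub>R x) \<le> q (t *\<^sub>R x)" by (rule le[OF q])
          also have "\<dots> = t * q x" using sl[OF q] t by (auto simp: sublinear_def)
          finally show "u (t *\<^sub>R x) / t \<le> q x" using t by (simp add: field_simps)
        qed
        then show "u (t *\<^sub>R x) \<le> t * u x" using t by (simp add: field_simps)
      qed
      moreover obtain q0 where q0: "q0 \<in> C" using False by blast
      have "u \<le> p"
      proof (rule le_funI)
        fix x
        have "u x \<le> q0 x" by (rule le[OF q0])
        also have "q0 x \<le> p x" using q0 CA by (auto simp: A_def le_fun_def)
        finally show "u x \<le> p x" .
      qed
      ultimately show ?thesis using le by (intro bexI[of _ u]) (auto simp: A_def le_fun_def)
    qed
  qed
  then obtain f where fA: "f \<in> A" and min: "\<And>q. q \<in> A \<Longrightarrow> q \<le> f \<Longrightarrow> q = f" by blast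
  have f: "sublinear f" "f \<le> p" using fA by (auto simp: A_def)
  have odd: "f (- z) = - f z" for z
  proof -
    have "lowered_at z f \<in> A" "lowered_at z f \<le> f"
      using lowered_at(1,2)[OF f(1), of z] f(2) by (auto simp: A_def le_fun_def intro: order_trans)
    then have "lowered_at z f = f" by (intro min)
    then have "f (- z) \<le> - f z" using lowered_at(3)[OF f(1), of z] by simp
    moreover have "- f z \<le> f (- z)" using sublinear_minus[OF f(1), of "- z"] by simp
    ultimately show ?thesis by simp
  qed
  have sub: "f (x + y) \<le> f x + f y" and hom: "t \<ge> 0 \<Longrightarrow> f (t *\<^sub>R x) = t * f x" for x y t
    using f(1) by (auto simp: sublinear_def)
  have "linear f"
  proof (rule linearI)
    fix x y
    have "f (- x + - y) \<le> f (- x) + f (- y)" by (rule sub)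
    then have "f x + f y \<le> f (x + y)" using odd[of "x + y"] odd[of x] odd[of y] by simp
    with sub[of x y] show "f (x + y) = f x + f y" by simp
  next
    fix c :: real and x
    show "f (c *\<^sub>R x) = c *\<^sub>R f x"
    proof (cases "c \<ge> 0")
      case False
      have "f (c *\<^sub>R x) = f (- ((- c) *\<^sub>R x))" by simp
      also have "\<dots> = - ((- c) * f x)" using False by (subst odd) (simp add: hom del: scaleR_minus_left)
      finally show ?thesis by simp
    qed (simp add: hom)
  qed
  with f(2) that show thesis by (auto simp: le_fun_def)
qed

text \<open>Starting from the functional lowered at \<open>z\<close> makes the linear functional touch \<open>p\<close> at \<open>z\<close>.\<close>

lemma hahn_banach_dominated_at:
  assumes p: "sublinear p"
  obtains f where "linear f" "\<And>x. f x \<le> p x" "f z = p z"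
proof -
  obtain f where f: "linear f" "\<And>x. f x \<le> lowered_at z p x"
    using hahn_banach_dominated[OF lowered_at(1)[OF p]] by metis
  have le: "f x \<le> p x" for x using f(2) lowered_at(2)[OF p] by (rule order_trans)
  have "f (- z) \<le> - p z" using f(2) lowered_at(3)[OF p] by (rule order_trans)
  then have "p z \<le> f z" using linear_neg[OF f(1), of z] by simp
  with le[of z] have "f z = p z" by simp
  with that f(1) le show thesis by blast
qed

lemma linear_dominated_bounded_linear:
  fixes f :: "'a::real_normed_vector \<Rightarrow> real"
  assumes "linear f" "\<And>x. f x \<le> K * norm x"
  shows "bounded_linear f" "\<bar>f x\<bar> \<le> K * norm x"
proof -
  have abs: "\<bar>f x\<bar> \<le> K * norm x" for x
    using assms(2)[of x] assms(2)[of "- x"] linear_neg[OF assms(1), of x] by (simp add: abs_le_iff)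
  then show "\<bar>f x\<bar> \<le> K * norm x" .
  show "bounded_linear f"
    using assms(1) abs
    by (intro bounded_linear_intro[of f K]) (auto simp: linear_add linear_scale mult.commute)
qed

lemma norming_functional:
  fixes x :: "'a::real_normed_vector"
  obtains \<phi> :: "'a \<Rightarrow> real" where "bounded_linear \<phi>" "\<phi> x = norm x" "\<And>y. \<bar>\<phi> y\<bar> \<le> norm y"
proof -
  have "sublinear (norm :: 'a \<Rightarrow> real)"
    by (auto simp: sublinear_def norm_triangle_ineq)
  then obtain f where f: "linear f" "\<And>y. f y \<le> norm y" "f x = norm x"
    using hahn_banach_dominated_at by metis
  with linear_dominated_bounded_linear[OF f(1), of 1] that show thesis by simp
qed

text \<open>The sublinear functional \<open>y \<mapsto> inf\<^sub>v (\<bar>K\<bar> \<parallel>y - v\<parallel> + g v)\<close> is at most \<open>g\<close> on \<open>V\<close>, and a linear functional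
  below it agrees with \<open>g\<close> on \<open>V\<close> because \<open>V = - V\<close>.\<close>

lemma functional_extension:
  fixes V :: "'a::real_normed_vector set"
  assumes V: "subspace V"
    and add: "\<And>u v. u \<in> V \<Longrightarrow> v \<in> V \<Longrightarrow> g (u + v) = g u + g v"
    and scale: "\<And>r v. v \<in> V \<Longrightarrow> g (r *\<^sub>R v) = r * g v"
    and bound: "\<And>v. v \<in> V \<Longrightarrow> \<bar>g v\<bar> \<le> K * norm v"
  obtains \<phi> :: "'a \<Rightarrow> real" where "bounded_linear \<phi>" "\<And>v. v \<in> V \<Longrightarrow> \<phi> v = g v"
proof -
  define L where "L = \<bar>K\<bar>"
  have L: "L \<ge> 0" and bL: "\<bar>g v\<bar> \<le> L * norm v" if "v \<in> V" for v
    using bound[OF that] mult_right_mono[OF abs_ge_self[of K] norm_ge_zero[of v]] by (auto simp: L_def)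
  have L0: "L \<ge> 0" by (simp add: L_def)
  have ne: "V \<noteq> {}" using subspace_0[OF V] by blast
  define p where "p = (\<lambda>y. INF v\<in>V. L * norm (y - v) + g v)"
  have low: "- L * norm y \<le> L * norm (y - v) + g v" if "v \<in> V" for y v
  proof -
    have "norm v \<le> norm y + norm (y - v)" by (metis norm_triangle_sub norm_minus_commute)
    then have "L * norm v \<le> L * norm y + L * norm (y - v)"
      using L0 by (metis distrib_left mult_left_mono)
    then show ?thesis using bL[OF that] by simp
  qed
  have bdd: "bdd_below ((\<lambda>v. L * norm (y - v) + g v) ` V)" for y
    using low by (intro bdd_belowI2) auto
  have le: "p y \<le> L * norm (y - v) + g v" if "v \<in> V" for v y
    unfolding p_def using that by (intro cINF_lower[OF bdd])
  have ge: "c \<le> p y" if "\<And>v. v \<in> V \<Longrightarrow> c \<le> L * norm (y - v) + g v" for c y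
    unfolding p_def using that ne by (intro cINF_greatest)
  have g0: "g 0 = 0" using scale[OF subspace_0[OF V], of 0] by simp
  have pn: "p y \<le> L * norm y" for y using le[OF subspace_0[OF V], of y] g0 by simp
  have "sublinear p"
  proof (rule sublinearI)
    show "p 0 = 0" using pn[of 0] ge[of 0 0] low[of _ 0] by (intro order_antisym) auto
  next
    fix x y
    have "p (x + y) - (L * norm (y - w) + g w) \<le> p x" if w: "w \<in> V" for w
    proof (rule ge)
      fix v assume v: "v \<in> V"
      have "p (x + y) \<le> L * norm ((x + y) - (v + w)) + g (v + w)"
        by (intro le subspace_add[OF V] v w)
      also have "L * norm ((x + y) - (v + w)) \<le> L * (norm (x - v) + norm (y - w))"
        using L0 by (intro mult_left_mono) (metis add_diff_add norm_triangle_ineq)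
      finally show "p (x + y) - (L * norm (y - w) + g w) \<le> L * norm (x - v) + g v"
        using add[OF v w] by (simp add: algebra_simps)
    qed
    then have "p (x + y) - p x \<le> p y" by (intro ge) (simp add: algebra_simps)
    then show "p (x + y) \<le> p x + p y" by simp
  next
    fix t :: real and x assume t: "t > 0"
    have "p (t *\<^sub>R x) / t \<le> p x"
    proof (rule ge)
      fix v assume v: "v \<in> V"
      have "p (t *\<^sub>R x) \<le> L * norm (t *\<^sub>R x - t *\<^sub>R v) + g (t *\<^sub>R v)"
        by (intro le subspace_scale[OF V] v)
      also have "norm (t *\<^sub>R x - t *\<^sub>R v) = t * norm (x - v)"
        using t by (metis abs_of_pos norm_scaleR scaleR_right_diff_distrib)
      finally show "p (t *\<^sub>R x) / t \<le> L * norm (x - v) + g v"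
        using t scale[OF v] by (simp add: field_simps)
    qed
    then show "p (t *\<^sub>R x) \<le> t * p x" using t by (simp add: field_simps)
  qed
  then obtain f where f: "linear f" "\<And>x. f x \<le> p x" using hahn_banach_dominated by metis
  have "f x \<le> L * norm x" for x using f(2) pn by (rule order_trans)
  then have bl: "bounded_linear f" by (rule linear_dominated_bounded_linear[OF f(1)])
  have "f v = g v" if v: "v \<in> V" for v
  proof -
    have up: "f w \<le> g w" if "w \<in> V" for w using f(2)[of w] le[OF that, of w] by simp
    have "f (- v) \<le> g (- v)" using v by (intro up subspace_neg[OF V])
    moreover have "g (- v) = - g v" using scale[OF v, of "- 1"] by simp
    ultimately show ?thesis using up[OF v] linear_neg[OF f(1), of v] by simp
  qed
  with bl that show thesis by blast
qed

text \<open>The convex set is lifted to the cone over \<open>C \<times> {1}\<close> in \<open>'a \<times> \<real>\<close>. The weighted distance \<open>p\<close> to that cone is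
  sublinear, vanishes on the cone, and is positive at \<open>(x, 1)\<close>; a linear functional below \<open>p\<close> that touches
  it at \<open>(x, 1)\<close> is an affine functional on \<open>'a\<close> separating \<open>x\<close> from \<open>C\<close>.\<close>

lemma separation_point_closed_convex:
  fixes C :: "'a::real_normed_vector set"
  assumes "closed C" "convex C" "C \<noteq> {}" "x \<notin> C"
  obtains \<phi> :: "'a \<Rightarrow> real" and a where "bounded_linear \<phi>" "\<And>c. c \<in> C \<Longrightarrow> \<phi> c \<le> a" "a < \<phi> x"
proof -
  obtain d where d: "d > 0" "\<And>c. c \<in> C \<Longrightarrow> d \<le> norm (x - c)"
  proof -
    obtain d where "d > 0" "ball x d \<subseteq> - C"
      using assms(1,4) open_Compl openE by (metis ComplI)
    then show thesis by (intro that[of d]) (force simp: dist_norm not_less[symmetric])+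
  qed
  \<comment> \<open>with this weight the value of \<open>p\<close> at \<open>(x, 1)\<close> is at least \<open>d\<close>\<close>
  define K where "K = norm x + d"
  have K: "K > 0" using d by (simp add: K_def add_nonneg_pos)
  define p where "p = (\<lambda>(y::'a, r::real). INF (t, c)\<in>{0..} \<times> C. norm (y - t *\<^sub>R c) + K * \<bar>r - t\<bar>)"
  have bdd: "bdd_below ((\<lambda>(t, c). norm (y - t *\<^sub>R c) + K * \<bar>r - t\<bar>) ` ({0..} \<times> C))" for y r
    using K by (intro bdd_belowI2[of _ 0]) (auto intro!: add_nonneg_nonneg)
  have le: "p (y, r) \<le> norm (y - t *\<^sub>R c) + K * \<bar>r - t\<bar>" if "t \<ge> 0" "c \<in> C" for y r t c
    unfolding p_def using that cINF_lower[OF bdd[of y r], of "(t, c)"] by simp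
  have ge: "l \<le> p (y, r)" if "\<And>t c. t \<ge> 0 \<Longrightarrow> c \<in> C \<Longrightarrow> l \<le> norm (y - t *\<^sub>R c) + K * \<bar>r - t\<bar>" for l y r
    unfolding p_def using that assms(3) by (auto intro!: cINF_greatest)
  obtain c0 where c0: "c0 \<in> C" using assms(3) by blast
  have pos: "0 \<le> p (y, r)" for y r using K by (intro ge) simp
  have "sublinear p"
  proof (rule sublinearI)
    show "p 0 = 0" using le[of 0 c0 0 0] c0 pos[of 0 0] by (simp add: zero_prod_def)
  next
    fix X Y :: "'a \<times> real"
    obtain y r z s where XY: "X = (y, r)" "Y = (z, s)" by (metis surj_pair)
    have key: "p (y + z, r + s) \<le> (norm (y - t *\<^sub>R c) + K * \<bar>r - t\<bar>) + (norm (z - t' *\<^sub>R c') + K * \<bar>s - t'\<bar>)"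
      if tc: "t \<ge> 0" "c \<in> C" "t' \<ge> 0" "c' \<in> C" for t c t' c'
    proof -
      obtain c'' where c'': "c'' \<in> C" "(t + t') *\<^sub>R c'' = t *\<^sub>R c + t' *\<^sub>R c'"
      proof (cases "t + t' = 0")
        case True
        then have "t = 0" "t' = 0" using tc by auto
        with tc that show ?thesis by auto
      next
        case False
        have "(t / (t + t')) *\<^sub>R c + (t' / (t + t')) *\<^sub>R c' \<in> C"
          using tc False by (intro convexD[OF assms(2)]) (auto simp: add_divide_distrib[symmetric])
        moreover have "(t + t') *\<^sub>R ((t / (t + t')) *\<^sub>R c + (t' / (t + t')) *\<^sub>R c') = t *\<^sub>R c + t' *\<^sub>R c'"
          using False by (simp add: scaleR_right_distrib)
        ultimately show ?thesis by (rule that)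
      qed
      have "p (y + z, r + s) \<le> norm (y + z - (t + t') *\<^sub>R c'') + K * \<bar>r + s - (t + t')\<bar>"
        using tc c'' by (intro le) auto
      also have "norm (y + z - (t + t') *\<^sub>R c'') \<le> norm (y - t *\<^sub>R c) + norm (z - t' *\<^sub>R c')"
        unfolding c''(2) by (metis add_diff_add norm_triangle_ineq)
      also have "K * \<bar>r + s - (t + t')\<bar> \<le> K * (\<bar>r - t\<bar> + \<bar>s - t'\<bar>)"
        using K by (intro mult_left_mono) auto
      finally show ?thesis by (simp add: algebra_simps)
    qed
    have "p (y + z, r + s) - (norm (z - t' *\<^sub>R c') + K * \<bar>s - t'\<bar>) \<le> p (y, r)"
      if "t' \<ge> 0" "c' \<in> C" for t' c'
      using key that by (intro ge) (simp add: algebra_simps)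
    then have "p (y + z, r + s) - p (y, r) \<le> p (z, s)" by (intro ge) (simp add: algebra_simps)
    then show "p (X + Y) \<le> p X + p Y" by (simp add: XY)
  next
    fix t :: real and X :: "'a \<times> real" assume t: "t > 0"
    obtain y r where X: "X = (y, r)" by (metis surj_pair)
    have "p (t *\<^sub>R y, t * r) / t \<le> p (y, r)"
    proof (rule ge)
      fix s :: real and c assume s: "s \<ge> 0" "c \<in> C"
      have "p (t *\<^sub>R y, t * r) \<le> norm (t *\<^sub>R y - (t * s) *\<^sub>R c) + K * \<bar>t * r - t * s\<bar>"
        using s t by (intro le) auto
      also have "t *\<^sub>R y - (t * s) *\<^sub>R c = t *\<^sub>R (y - s *\<^sub>R c)" by (simp add: scaleR_right_diff_distrib)
      also have "norm \<dots> = t * norm (y - s *\<^sub>R c)" using t by simp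
      also have "\<bar>t * r - t * s\<bar> = t * \<bar>r - s\<bar>" using t by (simp add: abs_mult flip: right_diff_distrib)
      finally show "p (t *\<^sub>R y, t * r) / t \<le> norm (y - s *\<^sub>R c) + K * \<bar>r - s\<bar>"
        using t by (simp add: field_simps)
    qed
    then show "p (t *\<^sub>R X) \<le> t * p X" using t by (simp add: X field_simps)
  qed
  then obtain f where f: "linear f" "\<And>X. f X \<le> p X" "f (x, 1) = p (x, 1)"
    using hahn_banach_dominated_at by metis
  have "d \<le> p (x, 1)"
  proof (rule ge)
    fix t :: real and c assume t: "t \<ge> 0" "c \<in> C"
    have "t * d \<le> norm (t *\<^sub>R (x - c))" using d(2)[OF t(2)] t(1) by (simp add: mult_left_mono)
    also have "t *\<^sub>R (x - c) = (x - t *\<^sub>R c) - (1 - t) *\<^sub>R x" by (simp add: algebra_simps)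
    also have "norm \<dots> \<le> norm (x - t *\<^sub>R c) + \<bar>1 - t\<bar> * norm x"
      by (metis norm_scaleR norm_triangle_ineq4)
    finally have 1: "t * d \<le> norm (x - t *\<^sub>R c) + \<bar>1 - t\<bar> * norm x" .
    have "1 * d \<le> (t + \<bar>1 - t\<bar>) * d" using d(1) by (intro mult_right_mono) auto
    with 1 show "d \<le> norm (x - t *\<^sub>R c) + K * \<bar>1 - t\<bar>"
      by (simp add: K_def algebra_simps)
  qed
  then have fx: "f (x, 1) > 0" using d f(3) by simp
  define \<phi> where "\<phi> = (\<lambda>y. f (y, 0))"
  have split: "f (y, 1) = \<phi> y + f (0, 1)" for y
    using linear_add[OF f(1), of "(y, 0)" "(0, 1)"] by (simp add: \<phi>_def)
  have "linear \<phi>"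
    using linear_add[OF f(1), of "(_, 0)" "(_, 0)"] linear_scale[OF f(1), of _ "(_, 0)"]
    by (intro linearI) (auto simp: \<phi>_def)
  moreover have "\<phi> y \<le> 1 * norm y" for y
    using f(2)[of "(y, 0)"] le[of 0 c0 y 0] c0 by (simp add: \<phi>_def)
  ultimately have "bounded_linear \<phi>" by (rule linear_dominated_bounded_linear)
  moreover have "\<phi> c \<le> - f (0, 1)" if "c \<in> C" for c
    using f(2)[of "(c, 1)"] le[of 1 c c 1] that split[of c] by simp
  moreover have "- f (0, 1) < \<phi> x" using fx split[of x] by simp
  ultimately show thesis by (rule that)
qed

section \<open>The weak topology of a real normed space\<close>

abbreviation weak :: "'a::real_normed_vector topology" where
  "weak \<equiv> initial_topology UNIV {\<phi> :: 'a \<Rightarrow> real. bounded_linear \<phi>}"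

lemma Hausdorff_weak: "Hausdorff_space (weak :: 'a::real_normed_vector topology)"
proof (rule Hausdorff_initial_topology)
  fix x y :: 'a assume "x \<noteq> y"
  obtain \<phi> :: "'a \<Rightarrow> real" where \<phi>: "bounded_linear \<phi>" "\<phi> (x - y) = norm (x - y)" "\<And>z. \<bar>\<phi> z\<bar> \<le> norm z"
    by (rule norming_functional[of "x - y"]) (rule that)
  with \<open>x \<noteq> y\<close> have "\<phi> x \<noteq> \<phi> y"
    using linear_diff[OF bounded_linear.linear[OF \<phi>(1)], of x y] by auto
  with \<phi>(1) show "\<exists>f\<in>{\<phi> :: 'a \<Rightarrow> real. bounded_linear \<phi>}. f x \<noteq> f y" by (intro bexI[of _ \<phi>]) auto
qed

lemma continuous_map_weak_functional:
  "bounded_linear \<phi> \<Longrightarrow> continuous_map weak euclidean (\<phi> :: 'a::real_normed_vector \<Rightarrow> real)"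
  by (intro continuous_map_from_initial_topology) simp

lemma continuous_map_weak_weak:
  assumes "bounded_linear T" shows "continuous_map weak weak T"
  unfolding continuous_map_into_initial_topology
  using bounded_linear_compose[OF _ assms] by (auto intro: continuous_map_weak_functional)

lemma closedin_weak_halfspace:
  assumes "bounded_linear \<phi>" shows "closedin weak {x. \<phi> x \<le> (a::real)}"
  using closedin_continuous_map_preimage[OF continuous_map_weak_functional[OF assms], of "{..a}"]
  by simp

text \<open>Mazur's theorem: by separation, a closed convex set is an intersection of closed half-spaces.\<close>

lemma closedin_weak_closed_convex:
  fixes C :: "'a::real_normed_vector set"
  assumes "closed C" "convex C" shows "closedin weak C"
proof (cases "C = {}")
  case False
  have "C = \<Inter> {{x. \<phi> x \<le> a} | (\<phi> :: 'a \<Rightarrow> real) a. bounded_linear \<phi> \<and> (\<forall>c\<in>C. \<phi> c \<le> a)}" (is "_ = \<Inter> ?H")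
  proof
    show "C \<subseteq> \<Inter> ?H" by auto
    show "\<Inter> ?H \<subseteq> C"
    proof
      fix x assume x: "x \<in> \<Inter> ?H"
      show "x \<in> C"
      proof (rule ccontr)
        assume "x \<notin> C"
        obtain \<phi> :: "'a \<Rightarrow> real" and a
          where \<phi>: "bounded_linear \<phi>" "\<And>c. c \<in> C \<Longrightarrow> \<phi> c \<le> a" "a < \<phi> x"
          by (rule separation_point_closed_convex[OF assms False \<open>x \<notin> C\<close>]) (rule that)
        then have "{x. \<phi> x \<le> a} \<in> ?H" by (intro CollectI exI[of _ \<phi>] exI[of _ a]) auto
        with x have "x \<in> {x. \<phi> x \<le> a}" by (rule InterD)
        with \<phi>(3) show False by simp
      qed
    qed
  qed
  moreover have "{x::'a. (0::real) \<le> 0} \<in> ?H"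
    by (intro CollectI exI[of _ "\<lambda>_. 0"] exI[of _ "0::real"]) (auto intro: bounded_linear_zero)
  then have "?H \<noteq> {}" by blast
  then have "closedin weak (\<Inter> ?H)"
    by (intro closedin_Inter) (auto intro: closedin_weak_halfspace)
  ultimately show ?thesis by metis
qed simp

lemma weak_closure_subset_closure_convex_hull:
  "weak closure_of S \<subseteq> closure (convex hull S)"
  by (intro closure_of_minimal closedin_weak_closed_convex convex_closure convex_convex_hull closed_closure)
     (meson closure_subset hull_subset subset_trans)

lemma compactin_weak_imp_closedin: "compactin weak K \<Longrightarrow> closedin weak K"
  by (rule compactin_imp_closedin[OF Hausdorff_weak])

lemma convex_hull_finite_subset:
  assumes "x \<in> convex hull S"
  obtains F where "finite F" "F \<subseteq> S" "x \<in> convex hull F"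
proof -
  obtain F u where "finite F" "F \<subseteq> S" "\<forall>x\<in>F. 0 \<le> u x" "sum u F = 1" "(\<Sum>v\<in>F. u v *\<^sub>R v) = x"
    using assms unfolding convex_hull_explicit by blast
  then show thesis
    by (intro that[of F]) (auto simp: convex_hull_finite)
qed

lemma minimal_closed_set:
  assumes K: "compactin X K" "closedin X K" "K \<noteq> {}" "P K"
    and inter: "\<And>\<C>. \<C> \<noteq> {} \<Longrightarrow> \<forall>C\<in>\<C>. P C \<Longrightarrow> P (\<Inter>\<C>)"
  obtains Z where "Z \<subseteq> K" "Z \<noteq> {}" "closedin X Z" "P Z"
    "\<And>Z'. Z' \<subseteq> Z \<Longrightarrow> Z' \<noteq> {} \<Longrightarrow> closedin X Z' \<Longrightarrow> P Z' \<Longrightarrow> Z' = Z"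
proof -
  define A where "A = {Z. Z \<subseteq> K \<and> Z \<noteq> {} \<and> closedin X Z \<and> P Z}"
  have "\<exists>m\<in>A. \<forall>a\<in>A. a \<subseteq> m \<longrightarrow> a = m"
  proof (rule predicate_Zorn)
    show "partial_order_on A (relation_of (\<lambda>a b. b \<subseteq> a) A)"
      by (auto simp: partial_order_on_def preorder_on_def refl_on_def trans_def antisym_def relation_of_def)
  next
    fix \<C> assume "\<C> \<in> Chains (relation_of (\<lambda>a b. b \<subseteq> a) A)"
    then have CA: "\<C> \<subseteq> A" and ch: "\<And>q r. q \<in> \<C> \<Longrightarrow> r \<in> \<C> \<Longrightarrow> q \<subseteq> r \<or> r \<subseteq> q"
      by (auto simp: Chains_def relation_of_def)
    show "\<exists>u\<in>A. \<forall>a\<in>\<C>. u \<subseteq> a"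
    proof (cases "\<C> = {}")
      case True
      then show ?thesis using K by (auto simp: A_def)
    next
      case False
      have "K \<inter> \<Inter>\<F> \<noteq> {}" if F: "finite \<F>" "\<F> \<subseteq> \<C>" for \<F>
      proof (cases "\<F> = {}")
        case True
        then show ?thesis using K by simp
      next
        case ne: False
        obtain m where m: "m \<in> \<F>" "\<And>b. b \<in> \<F> \<Longrightarrow> b \<subseteq> m \<Longrightarrow> m = b"
          using finite_has_minimal[OF F(1) ne] by blast
        have "m \<subseteq> b" if b: "b \<in> \<F>" for b
        proof -
          have "m \<in> \<C>" "b \<in> \<C>" using m(1) b F(2) by auto
          from ch[OF this] m(2)[OF b] show ?thesis by auto
        qed
        then have "m \<subseteq> \<Inter>\<F>" by (rule Inf_greatest)
        moreover have "m \<noteq> {}" "m \<subseteq> K" using m(1) F(2) CA by (auto simp: A_def)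
        ultimately show ?thesis by blast
      qed
      moreover have "\<forall>C\<in>\<C>. closedin X C" using CA by (auto simp: A_def)
      ultimately have "K \<inter> \<Inter>\<C> \<noteq> {}"
        using K(1) unfolding compactin_fip by blast
      moreover have "\<Inter>\<C> \<subseteq> K" using False CA by (auto simp: A_def)
      moreover have "closedin X (\<Inter>\<C>)" "P (\<Inter>\<C>)"
        using False CA by (auto simp: A_def intro!: closedin_Inter inter)
      ultimately have "\<Inter>\<C> \<in> A" by (auto simp: A_def)
      then show ?thesis by blast
    qed
  qed
  then obtain Z where "Z \<in> A" "\<forall>a\<in>A. a \<subseteq> Z \<longrightarrow> a = Z" by blast
  with that[of Z] show thesis by (auto simp: A_def)
qed

text \<open>The usual category argument: some set of points at which the family is bounded by \<open>n\<close> contains a ball.\<close>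

lemma uniform_boundedness:
  fixes \<A> :: "('a::banach \<Rightarrow>\<^sub>L 'b::real_normed_vector) set"
  assumes "\<And>x. \<exists>B. \<forall>A\<in>\<A>. norm (blinfun_apply A x) \<le> B"
  obtains C where "C > 0" "\<And>A. A \<in> \<A> \<Longrightarrow> norm A \<le> C"
proof -
  define E where "E = (\<lambda>n::nat. {x::'a. \<forall>A\<in>\<A>. norm (blinfun_apply A x) \<le> real n})"
  have cl: "closed (E n)" for n
  proof -
    have "E n = (\<Inter>A\<in>\<A>. {x. norm (blinfun_apply A x) \<le> real n})" by (auto simp: E_def)
    moreover have "closed {x. norm (blinfun_apply A x) \<le> real n}" for A :: "'a \<Rightarrow>\<^sub>L 'b"
      by (intro closed_Collect_le continuous_intros)
    ultimately show ?thesis by (simp add: closed_INT)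
  qed
  have un: "(\<Union>n. E n) = UNIV"
  proof -
    have "\<exists>n. x \<in> E n" for x
    proof -
      obtain B where B: "\<forall>A\<in>\<A>. norm (blinfun_apply A x) \<le> B" using assms by blast
      obtain n where "B \<le> real n" using real_arch_simple by blast
      with B show ?thesis unfolding E_def by (blast intro: order_trans)
    qed
    then show ?thesis by auto
  qed
  have "\<exists>n. interior (E n) \<noteq> {}"
  proof (rule ccontr)
    assume "\<not> ?thesis"
    then have "euclidean interior_of \<Union> (range E) = {}"
      using cl by (intro Baire_category_alt) (auto simp: completely_metrizable_space_euclidean)
    then show False using un by simp
  qed
  then obtain n x where "x \<in> interior (E n)" by blast
  then obtain r where r: "r > 0" "cball x r \<subseteq> E n" by (meson mem_interior_cball)
  have b: "norm (blinfun_apply A y) \<le> (2 * real n / r) * norm y" if "A \<in> \<A>" for A y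
  proof (cases "y = 0")
    case False
    define z where "z = (r / norm y) *\<^sub>R y"
    have nz: "norm z = r" using r False by (simp add: z_def)
    have "x + z \<in> E n" "x \<in> E n" using r nz by (auto intro!: subsetD[OF r(2)] simp: dist_norm)
    then have "norm (blinfun_apply A (x + z)) \<le> real n" "norm (blinfun_apply A x) \<le> real n"
      using that by (auto simp: E_def)
    moreover have "blinfun_apply A z = blinfun_apply A (x + z) - blinfun_apply A x"
      by (simp add: blinfun.add_right)
    ultimately have "norm (blinfun_apply A z) \<le> 2 * real n"
      using norm_triangle_ineq4[of "blinfun_apply A (x + z)" "blinfun_apply A x"] by simp
    then show ?thesis using r False by (simp add: z_def blinfun.scaleR_right field_simps)
  qed simp
  have "norm A \<le> 2 * real n / r + 1" if "A \<in> \<A>" for A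
    using norm_blinfun_bound[OF _ b[OF that]] r by (simp add: divide_nonneg_pos)
  moreover have "2 * real n / r + 1 > 0" using r by (simp add: add_nonneg_pos)
  ultimately show thesis using that by blast
qed


section \<open>Fixed points of countable bounded groups of operators\<close>

locale operator_group =
  fixes \<U> :: "('a::banach \<Rightarrow>\<^sub>L 'a) set" and C :: real
  assumes id_mem: "id_blinfun \<in> \<U>"
    and comp_mem: "\<lbrakk>U \<in> \<U>; V \<in> \<U>\<rbrakk> \<Longrightarrow> U o\<^sub>L V \<in> \<U>"
    and inv_mem: "U \<in> \<U> \<Longrightarrow> \<exists>V\<in>\<U>. V o\<^sub>L U = id_blinfun \<and> U o\<^sub>L V = id_blinfun"
    and C_pos: "C > 0"
    and bound: "U \<in> \<U> \<Longrightarrow> norm U \<le> C"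
begin

lemma norm_apply_le: "U \<in> \<U> \<Longrightarrow> norm (blinfun_apply U x) \<le> C * norm x"
  using norm_blinfun[of U x] bound[of U] by (meson mult_right_mono norm_ge_zero order_trans)

lemma inverse_op:
  assumes "U \<in> \<U>"
  shows "\<exists>V\<in>\<U>. (\<forall>x. blinfun_apply V (blinfun_apply U x) = x) \<and>
    (\<forall>x. blinfun_apply U (blinfun_apply V x) = x)"
  using inv_mem[OF assms] by (metis blinfun_apply_blinfun_compose blinfun_apply_id_blinfun id_apply)

definition orb :: "'a \<Rightarrow> 'a set" where
  "orb x = (\<lambda>U. blinfun_apply U x) ` \<U>"

lemma orb_self: "x \<in> orb x"
  unfolding orb_def using id_mem by (intro image_eqI[of _ _ id_blinfun]) auto

lemma orb_invariant: "U \<in> \<U> \<Longrightarrow> y \<in> orb x \<Longrightarrow> blinfun_apply U y \<in> orb x"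
  unfolding orb_def using comp_mem by (force simp flip: blinfun_apply_blinfun_compose)

definition invariant :: "'a set \<Rightarrow> bool" where
  "invariant Z \<longleftrightarrow> (\<forall>U\<in>\<U>. \<forall>z\<in>Z. blinfun_apply U z \<in> Z)"

lemma invariant_Inter: "\<forall>Z\<in>\<C>. invariant Z \<Longrightarrow> invariant (\<Inter>\<C>)"
  by (auto simp: invariant_def)

lemma invariant_weak_closure:
  assumes "invariant Z" shows "invariant (weak closure_of Z)"
  unfolding invariant_def
proof (intro ballI)
  fix U z assume U: "U \<in> \<U>" and z: "z \<in> weak closure_of Z"
  have "blinfun_apply U ` (weak closure_of Z) \<subseteq> weak closure_of (blinfun_apply U ` Z)"
    by (intro continuous_map_image_closure_subset continuous_map_weak_weak blinfun.bounded_linear_right)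
  also have "\<dots> \<subseteq> weak closure_of Z"
    using U assms by (intro closure_of_mono) (auto simp: invariant_def)
  finally show "blinfun_apply U z \<in> weak closure_of Z" using z by blast
qed

lemma invariant_closure_convex_hull:
  assumes "invariant Z" shows "invariant (closure (convex hull Z))"
  unfolding invariant_def
proof (intro ballI)
  fix U z assume U: "U \<in> \<U>" and z: "z \<in> closure (convex hull Z)"
  have "blinfun_apply U ` closure (convex hull Z) \<subseteq> closure (blinfun_apply U ` (convex hull Z))"
    by (intro closure_bounded_linear_image_subset blinfun.bounded_linear_right)
  also have "blinfun_apply U ` (convex hull Z) = convex hull (blinfun_apply U ` Z)"
    by (intro convex_hull_linear_image bounded_linear.linear blinfun.bounded_linear_right)
  also have "closure \<dots> \<subseteq> closure (convex hull Z)"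
    using U assms by (intro closure_mono hull_mono) (auto simp: invariant_def)
  finally show "blinfun_apply U z \<in> closure (convex hull Z)" using z by blast
qed

text \<open>The countable orbit of \<open>x\<close> is enumerated by \<open>w\<close>. The sets \<open>D n\<close>, which are closed neighbourhoods of the
  compact convex hulls of \<open>w 0, \<dots>, w n\<close>, cover \<open>Z\<close> and are weakly closed, so one of them has weak interior
  in \<open>Z\<close>. By minimality finitely many translates of that interior cover \<open>Z\<close>, and a translate of a set close
  to a compact convex polytope is again such a set, at the price of the factor \<open>C\<close>.\<close>

lemma minimal_set_near_compact:
  assumes count: "countable \<U>"
    and Z: "compactin weak Z" "Z \<noteq> {}" "invariant Z" "Z \<subseteq> closure (convex hull (orb x))"
    and min: "\<And>Z'. Z' \<subseteq> Z \<Longrightarrow> Z' \<noteq> {} \<Longrightarrow> closedin weak Z' \<Longrightarrow> invariant Z' \<Longrightarrow> Z' = Z"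
    and e: "e > 0"
  obtains F where "finite F" "\<And>z. z \<in> Z \<Longrightarrow> \<exists>a\<in>convex hull F. norm (z - a) \<le> e"
proof -
  define \<delta> where "\<delta> = e / C"
  have \<delta>: "\<delta> > 0" using e C_pos by (simp add: \<delta>_def)
  have co: "countable (orb x)" "orb x \<noteq> {}" using count orb_self by (auto simp: orb_def)
  define w where "w = from_nat_into (orb x)"
  have rw: "range w = orb x" unfolding w_def using co by (intro range_from_nat_into) auto
  define D where "D = (\<lambda>n. (\<Union>a\<in>convex hull (w ` {..n}). \<Union>b\<in>cball 0 \<delta>. {a + b}))"
  have Dcl: "closedin weak (D n)" for n :: nat
    unfolding D_def
    by (intro closedin_weak_closed_convex compact_closed_sums convex_sums
          finite_imp_compact_convex_hull convex_convex_hull) auto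
  have DZ: "z \<in> (\<Union>n. D n)" if "z \<in> Z" for z
  proof -
    have "z \<in> closure (convex hull (orb x))" using that Z by blast
    then obtain a where a: "a \<in> convex hull (orb x)" "dist a z < \<delta>"
      using \<delta> closure_approachable by blast
    obtain F where F: "finite F" "F \<subseteq> orb x" "a \<in> convex hull F"
      using convex_hull_finite_subset[OF a(1)] by metis
    obtain N where N: "finite N" "F = w ` N"
      using F finite_subset_image[of F w UNIV] rw by auto
    obtain n where "N \<subseteq> {..n}" using N(1) finite_nat_iff_bounded_le by blast
    then have "a \<in> convex hull (w ` {..n})" using F(3) N(2) by (meson hull_mono image_mono subsetD)
    moreover have "z = a + (z - a)" "z - a \<in> cball 0 \<delta>" using a(2) by (auto simp: dist_norm norm_minus_commute)
    ultimately show ?thesis unfolding D_def by blast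
  qed
  let ?X = "subtopology weak Z"
  have cX: "compact_space ?X" using Z(1) by (rule compact_space_subtopology)
  have hX: "Hausdorff_space ?X" by (rule Hausdorff_space_subtopology[OF Hausdorff_weak])
  have tX: "topspace ?X = Z" by simp
  have "\<exists>n. ?X interior_of (D n \<inter> Z) \<noteq> {}"
  proof (rule ccontr)
    assume *: "\<not> ?thesis"
    have "?X interior_of \<Union> (range (\<lambda>n. D n \<inter> Z)) = {}"
    proof (rule Baire_category_alt)
      show "completely_metrizable_space ?X \<or> locally_compact_space ?X \<and> regular_space ?X"
        using cX hX compact_Hausdorff_imp_regular_space compact_imp_locally_compact_space by blast
    qed (use * Dcl in \<open>auto simp: closedin_subtopology\<close>)
    moreover have "\<Union> (range (\<lambda>n. D n \<inter> Z)) = topspace ?X" using DZ tX by auto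
    ultimately show False using Z(2) tX by (metis interior_of_topspace)
  qed
  then obtain n W where W: "W = ?X interior_of (D n \<inter> Z)" "W \<noteq> {}" by blast
  then have "openin ?X W" by simp
  then obtain W' where W': "openin weak W'" "W = W' \<inter> Z" by (auto simp: openin_subtopology)
  have WD: "W \<subseteq> D n" using interior_of_subset[of ?X "D n \<inter> Z"] W(1) by auto
  \<comment> \<open>By minimality every orbit in \<open>Z\<close> is weakly dense in \<open>Z\<close> and so enters \<open>W'\<close>.\<close>
  have hit: "\<exists>U\<in>\<U>. blinfun_apply U z \<in> W'" if z: "z \<in> Z" for z
  proof -
    have "orb z \<subseteq> Z" using Z(3) z by (auto simp: orb_def invariant_def)
    then have "weak closure_of (orb z) \<subseteq> Z"
      by (intro closure_of_minimal compactin_weak_imp_closedin Z(1))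
    moreover have "invariant (orb z)" using orb_invariant by (auto simp: invariant_def)
    then have "invariant (weak closure_of (orb z))" by (rule invariant_weak_closure)
    moreover have "orb z \<subseteq> weak closure_of (orb z)" by (intro closure_of_subset) simp
    then have "weak closure_of (orb z) \<noteq> {}" using orb_self by blast
    ultimately have "weak closure_of (orb z) = Z" by (intro min) auto
    then obtain y where "y \<in> weak closure_of (orb z)" "y \<in> W'" using W(2) W'(2) by blast
    with W'(1) obtain y' where "y' \<in> orb z" "y' \<in> W'" unfolding in_closure_of by blast
    then show ?thesis by (auto simp: orb_def)
  qed
  define O' where "O' = (\<lambda>U :: 'a \<Rightarrow>\<^sub>L 'a. {z. blinfun_apply U z \<in> W'})"
  have "openin weak (O' U)" for U
    using openin_continuous_map_preimage[OF continuous_map_weak_weak[OF blinfun.bounded_linear_right[of U]] W'(1)]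
    by (simp add: O'_def)
  then have "\<exists>\<F>. finite \<F> \<and> \<F> \<subseteq> O' ` \<U> \<and> Z \<subseteq> \<Union>\<F>"
    using Z(1) hit by (intro compactinD) (auto simp: O'_def)
  then obtain \<F> where \<F>: "finite \<F>" "\<F> \<subseteq> \<U>" "Z \<subseteq> (\<Union>U\<in>\<F>. O' U)"
    by (metis finite_subset_image)
  have "\<forall>U\<in>\<U>. \<exists>V. V \<in> \<U> \<and> (\<forall>z. blinfun_apply V (blinfun_apply U z) = z)"
    using inverse_op by blast
  then obtain J where "\<forall>U\<in>\<U>. J U \<in> \<U> \<and> (\<forall>z. blinfun_apply (J U) (blinfun_apply U z) = z)"
    by (rule bchoice[THEN exE])
  then have J: "\<And>U. U \<in> \<U> \<Longrightarrow> J U \<in> \<U>" "\<And>U z. U \<in> \<U> \<Longrightarrow> blinfun_apply (J U) (blinfun_apply U z) = z"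
    by auto
  define F where "F = (\<Union>U\<in>\<F>. blinfun_apply (J U) ` w ` {..n})"
  show thesis
  proof (rule that[of F])
    show "finite F" using \<F> by (auto simp: F_def)
    fix z assume z: "z \<in> Z"
    then obtain U where U: "U \<in> \<F>" "blinfun_apply U z \<in> W'" using \<F>(3) by (auto simp: O'_def)
    then have "blinfun_apply U z \<in> W" using W'(2) Z(3) z \<F>(2) by (auto simp: invariant_def)
    then obtain a b where ab: "a \<in> convex hull (w ` {..n})" "norm b \<le> \<delta>" "blinfun_apply U z = a + b"
      using WD by (auto simp: D_def)
    have U': "U \<in> \<U>" using U \<F> by blast
    have "z = blinfun_apply (J U) a + blinfun_apply (J U) b"
      using J(2)[OF U', of z] ab(3) by (simp add: blinfun.add_right)
    moreover have "norm (blinfun_apply (J U) b) \<le> e"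
    proof -
      have "norm (blinfun_apply (J U) b) \<le> C * norm b" by (intro norm_apply_le J U')
      also have "\<dots> \<le> C * \<delta>" using ab(2) C_pos by (intro mult_left_mono) auto
      finally show ?thesis using C_pos by (simp add: \<delta>_def)
    qed
    moreover have "blinfun_apply (J U) a \<in> convex hull F"
    proof -
      have "blinfun_apply (J U) a \<in> blinfun_apply (J U) ` (convex hull (w ` {..n}))" using ab by blast
      also have "\<dots> = convex hull (blinfun_apply (J U) ` w ` {..n})"
        by (intro convex_hull_linear_image bounded_linear.linear blinfun.bounded_linear_right)
      also have "\<dots> \<subseteq> convex hull F" using U(1) by (intro hull_mono) (auto simp: F_def)
      finally show ?thesis .
    qed
    ultimately show "\<exists>a\<in>convex hull F. norm (z - a) \<le> e"
      by (intro bexI[of _ "blinfun_apply (J U) a"]) auto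
  qed
qed

text \<open>Kakutani's argument. In a minimal invariant convex set of positive diameter \<open>d\<close>, measured in the
  \<open>\<U>\<close>-invariant norm \<open>sup\<^sub>U \<parallel>U x\<parallel>\<close>, the barycentre of a \<open>d/2\<close>-net is at distance at most some \<open>r < d\<close> from
  every point; the set of all such centres is convex, closed and invariant, hence everything, which
  contradicts the choice of \<open>d\<close>.\<close>

lemma fixed_point_in_compact_convex:
  assumes Y: "compact Y" "convex Y" "Y \<noteq> {}" "invariant Y"
  obtains p where "p \<in> Y" "\<And>U. U \<in> \<U> \<Longrightarrow> blinfun_apply U p = p"
proof -
  obtain Y0 where Y0: "Y0 \<subseteq> Y" "Y0 \<noteq> {}" "closedin euclidean Y0" "convex Y0 \<and> invariant Y0"
    and min: "\<And>Z'. Z' \<subseteq> Y0 \<Longrightarrow> Z' \<noteq> {} \<Longrightarrow> closedin euclidean Z' \<Longrightarrow> convex Z' \<and> invariant Z' \<Longrightarrow> Z' = Y0"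
  proof (rule minimal_closed_set[of euclidean Y "\<lambda>Z. convex Z \<and> invariant Z"])
    show "\<And>\<C>. \<C> \<noteq> {} \<Longrightarrow> \<forall>C\<in>\<C>. convex C \<and> invariant C \<Longrightarrow> convex (\<Inter>\<C>) \<and> invariant (\<Inter>\<C>)"
      using invariant_Inter convex_Inter by blast
  qed (use Y in \<open>auto intro: compact_imp_closed\<close>)
  have cpt: "compact Y0"
    using Y(1) Y0(1,3) by (metis closed_closedin compact_Int_closed inf.absorb_iff2)
  have cvx: "convex Y0" and inv: "invariant Y0" using Y0 by auto
  have "x = y" if xy: "x \<in> Y0" "y \<in> Y0" for x y
  proof (rule ccontr)
    assume ne: "x \<noteq> y"
    define S where "S = {norm (blinfun_apply U (x - y)) | U x y. U \<in> \<U> \<and> x \<in> Y0 \<and> y \<in> Y0}"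
    define d where "d = Sup S"
    obtain B where B: "\<And>y. y \<in> Y0 \<Longrightarrow> norm y \<le> B"
      using compact_imp_bounded[OF cpt] by (auto simp: bounded_iff)
    have "s \<le> C * (2 * B)" if sS: "s \<in> S" for s
    proof -
      obtain U x y where s: "s = norm (blinfun_apply U (x - y))" "U \<in> \<U>" "x \<in> Y0" "y \<in> Y0"
        using sS by (auto simp: S_def)
      have "norm (x - y) \<le> 2 * B" using norm_triangle_ineq4[of x y] B[OF s(3)] B[OF s(4)] by linarith
      then have "C * norm (x - y) \<le> C * (2 * B)" using C_pos by (intro mult_left_mono) auto
      then show ?thesis using norm_apply_le[OF s(2), of "x - y"] s(1) by simp
    qed
    then have bdd: "bdd_above S" by (intro bdd_aboveI)
    have dU: "norm (blinfun_apply U (a - b)) \<le> d" if "U \<in> \<U>" "a \<in> Y0" "b \<in> Y0" for U a b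
      unfolding d_def using that by (intro cSup_upper bdd) (auto simp: S_def)
    have "norm (x - y) \<le> d" using dU[OF id_mem xy] by simp
    with ne have d: "d > 0" by (metis less_le_trans zero_less_norm_iff right_minus_eq)
    define \<rho> where "\<rho> = d / (2 * C)"
    have \<rho>: "\<rho> > 0" using d C_pos by (simp add: \<rho>_def)
    obtain F where F: "F \<subseteq> Y0" "finite F" "Y0 \<subseteq> (\<Union>a\<in>F. ball a \<rho>)"
      using compactE_image[OF cpt, of Y0 "\<lambda>a. ball a \<rho>"] \<rho> by (metis UN_I centre_in_ball open_ball subsetI)
    have Fne: "F \<noteq> {}" using F(3) xy by auto
    define n where "n = real (card F)"
    have n: "n > 0" using F(2) Fne by (simp add: n_def card_gt_0_iff)
    define z where "z = (\<Sum>a\<in>F. (1 / n) *\<^sub>R a)"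
    have zY: "z \<in> Y0"
      unfolding z_def using F n by (intro convex_sum[OF _ cvx]) (auto simp: n_def)
    define r where "r = d - d / (2 * n)"
    have rd: "r < d" using d n by (simp add: r_def)
    have zr: "norm (blinfun_apply U (z - b)) \<le> r" if U: "U \<in> \<U>" and b: "b \<in> Y0" for U b
    proof -
      obtain a0 where a0: "a0 \<in> F" "dist a0 b < \<rho>" using F(3) b by auto
      have "z - b = (\<Sum>a\<in>F. (1 / n) *\<^sub>R (a - b))"
        using n by (simp add: z_def scaleR_right_diff_distrib sum_subtractf n_def scaleR_left.sum[symmetric] sum_constant_scaleR)
      then have "norm (blinfun_apply U (z - b)) = norm (\<Sum>a\<in>F. (1 / n) *\<^sub>R blinfun_apply U (a - b))"
        by (simp add: blinfun.sum_right blinfun.scaleR_right)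
      also have "\<dots> \<le> (\<Sum>a\<in>F. (1 / n) * norm (blinfun_apply U (a - b)))"
        using n by (intro sum_norm_le) simp
      also have "\<dots> = (1 / n) * (norm (blinfun_apply U (a0 - b)) + (\<Sum>a\<in>F - {a0}. norm (blinfun_apply U (a - b))))"
        using sum.remove[OF F(2) a0(1), of "\<lambda>a. norm (blinfun_apply U (a - b))"]
        by (simp only: sum_distrib_left[symmetric])
      also have "\<dots> \<le> (1 / n) * (d / 2 + (n - 1) * d)"
      proof (intro mult_left_mono add_mono)
        have "norm (blinfun_apply U (a0 - b)) \<le> C * norm (a0 - b)" by (rule norm_apply_le[OF U])
        also have "\<dots> \<le> C * \<rho>" using a0(2) C_pos by (intro mult_left_mono) (auto simp: dist_norm)
        finally show "norm (blinfun_apply U (a0 - b)) \<le> d / 2" using C_pos by (simp add: \<rho>_def)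
        have "(\<Sum>a\<in>F - {a0}. norm (blinfun_apply U (a - b))) \<le> (\<Sum>a\<in>F - {a0}. d)"
          using F(1) by (intro sum_mono dU U b) auto
        also have "\<dots> = (n - 1) * d"
          using F(2) a0(1) n by (simp add: n_def of_nat_diff card_gt_0_iff Suc_leI)
        finally show "(\<Sum>a\<in>F - {a0}. norm (blinfun_apply U (a - b))) \<le> (n - 1) * d" .
      qed (use n in simp)
      also have "\<dots> = r" using n by (simp add: r_def field_simps)
      finally show ?thesis .
    qed
    define Q where "Q = {a \<in> Y0. \<forall>b\<in>Y0. \<forall>U\<in>\<U>. norm (blinfun_apply U (a - b)) \<le> r}"
    have "Q = Y0"
    proof (rule min)
      show "Q \<subseteq> Y0" by (auto simp: Q_def)
      show "Q \<noteq> {}" using zY zr by (auto simp: Q_def)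
      have Q: "Q = Y0 \<inter> (\<Inter>b\<in>Y0. \<Inter>U\<in>\<U>. blinfun_apply U -` cball (blinfun_apply U b) r)"
        by (auto simp: Q_def dist_norm norm_minus_commute blinfun.diff_right)
      have "closed (blinfun_apply U -` cball (blinfun_apply U b) r)" for U :: "'a \<Rightarrow>\<^sub>L 'a" and b
        by (intro closed_vimage closed_cball linear_continuous_on blinfun.bounded_linear_right)
      then have "closed (\<Inter>b\<in>Y0. \<Inter>U\<in>\<U>. blinfun_apply U -` cball (blinfun_apply U b) r)"
        by (intro closed_INT ballI)
      moreover have "closed Y0" using Y0(3) by simp
      ultimately have "closed Q" unfolding Q by (simp only: closed_Int)
      then show "closedin euclidean Q" by simp
      show "convex Q \<and> invariant Q"
      proof
        show "convex Q"
          unfolding Q by (intro convex_Int cvx convex_INT convex_linear_vimage convex_cball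
              bounded_linear.linear blinfun.bounded_linear_right)
        show "invariant Q" unfolding invariant_def
        proof (intro ballI)
          fix V a assume V: "V \<in> \<U>" and a: "a \<in> Q"
          obtain V' where V': "V' \<in> \<U>" "\<And>x. blinfun_apply V (blinfun_apply V' x) = x"
            using inverse_op[OF V] by blast
          have "norm (blinfun_apply U (blinfun_apply V a - b)) \<le> r" if b: "b \<in> Y0" and U: "U \<in> \<U>" for b U
          proof -
            have "blinfun_apply U (blinfun_apply V a - b) = blinfun_apply (U o\<^sub>L V) (a - blinfun_apply V' b)"
              using V'(2)[of b] by (simp add: blinfun.diff_right)
            moreover have "blinfun_apply V' b \<in> Y0" using inv V' b by (auto simp: invariant_def)
            ultimately show ?thesis using a comp_mem[OF U V] unfolding Q_def by (metis (mono_tags, lifting) mem_Collect_eq)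
          qed
          moreover have "blinfun_apply V a \<in> Y0" using inv V a by (auto simp: invariant_def Q_def)
          ultimately show "blinfun_apply V a \<in> Q" by (auto simp: Q_def)
        qed
      qed
    qed
    then have "\<And>s. s \<in> S \<Longrightarrow> s \<le> r" by (force simp: S_def Q_def)
    moreover have "S \<noteq> {}" using id_mem xy by (auto simp: S_def)
    ultimately have "d \<le> r" unfolding d_def by (intro cSup_least)
    with rd show False by simp
  qed
  note uniq = this
  obtain p where p: "p \<in> Y0" using Y0 by blast
  then have "blinfun_apply U p = p" if "U \<in> \<U>" for U
    using uniq that inv by (auto simp: invariant_def)
  with p Y0(1) that show thesis by blast
qed

text \<open>The closed convex hull of a minimal set is norm compact, since for every \<open>e > 0\<close> it lies in
  the \<open>e\<close>-neighbourhood of a polytope.\<close>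

theorem countable_group_fixed_point:
  assumes count: "countable \<U>" and K: "compactin weak K" "orb x \<subseteq> K"
  obtains p where "p \<in> closure (convex hull (orb x))" "\<And>U. U \<in> \<U> \<Longrightarrow> blinfun_apply U p = p"
proof -
  have inv: "invariant (orb x)" using orb_invariant by (auto simp: invariant_def)
  have sub: "orb x \<subseteq> weak closure_of (orb x)" by (intro closure_of_subset) simp
  have "weak closure_of (orb x) \<subseteq> K"
    by (intro closure_of_minimal compactin_weak_imp_closedin K)
  then have cpt: "compactin weak (weak closure_of (orb x))"
    using K(1) by (intro closed_compactin[OF K(1)]) auto
  obtain Z where Z: "Z \<subseteq> weak closure_of (orb x)" "Z \<noteq> {}" "closedin weak Z" "invariant Z"
    and min: "\<And>Z'. Z' \<subseteq> Z \<Longrightarrow> Z' \<noteq> {} \<Longrightarrow> closedin weak Z' \<Longrightarrow> invariant Z' \<Longrightarrow> Z' = Z"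
  proof (rule minimal_closed_set[of weak "weak closure_of (orb x)" invariant])
    show "weak closure_of (orb x) \<noteq> {}" using sub orb_self by blast
  qed (use cpt invariant_weak_closure[OF inv] invariant_Inter in auto)
  have Zc: "compactin weak Z" by (rule closed_compactin[OF cpt Z(1,3)])
  have ZH: "Z \<subseteq> closure (convex hull (orb x))"
    using Z(1) weak_closure_subset_closure_convex_hull by blast
  define Y where "Y = closure (convex hull Z)"
  have "compact Y"
    unfolding compact_eq_totally_bounded
  proof (intro conjI allI impI)
    show "complete Y" by (simp add: Y_def complete_eq_closed)
    fix e :: real assume e: "e > 0"
    obtain F where F: "finite F" "\<And>z. z \<in> Z \<Longrightarrow> \<exists>a\<in>convex hull F. norm (z - a) \<le> e / 2"
      using minimal_set_near_compact[OF count Zc Z(2,4) ZH min, of "e / 2"] e by auto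
    let ?D = "\<Union>a\<in>convex hull F. \<Union>b\<in>cball 0 (e / 2). {a + b}"
    have "Z \<subseteq> ?D"
    proof
      fix z assume "z \<in> Z"
      then obtain a where "a \<in> convex hull F" "norm (z - a) \<le> e / 2" using F(2) by blast
      moreover have "z = a + (z - a)" by simp
      ultimately show "z \<in> ?D" by (intro UN_I[of a] UN_I[of "z - a"]) auto
    qed
    moreover have cF: "compact (convex hull F)" by (intro finite_imp_compact_convex_hull F)
    ultimately have YD: "Y \<subseteq> ?D"
      unfolding Y_def by (intro closure_minimal hull_minimal convex_sums compact_closed_sums) auto
    obtain k where k: "finite k" "convex hull F \<subseteq> (\<Union>x\<in>k. ball x (e / 2))"
      using cF e unfolding compact_eq_totally_bounded by (meson half_gt_zero)
    have "Y \<subseteq> (\<Union>x\<in>k. ball x e)"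
    proof
      fix y assume "y \<in> Y"
      then obtain a b where ab: "a \<in> convex hull F" "norm b \<le> e / 2" "y = a + b" using YD by auto
      then obtain c where "c \<in> k" "dist c a < e / 2" using k by auto
      moreover have "dist c y \<le> dist c a + dist a y" by (rule dist_triangle)
      moreover have "dist a y = norm b" using ab by (simp add: dist_norm)
      ultimately show "y \<in> (\<Union>x\<in>k. ball x e)" using ab by force
    qed
    with k show "\<exists>k. finite k \<and> Y \<subseteq> (\<Union>x\<in>k. ball x e)" by blast
  qed
  moreover have "convex Y" unfolding Y_def by (intro convex_closure convex_convex_hull)
  moreover have "Z \<subseteq> Y" unfolding Y_def by (meson closure_subset hull_subset subset_trans)
  then have "Y \<noteq> {}" using Z(2) by blast
  moreover have "invariant Y" unfolding Y_def by (intro invariant_closure_convex_hull Z)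
  ultimately obtain p where p: "p \<in> Y" "\<And>U. U \<in> \<U> \<Longrightarrow> blinfun_apply U p = p"
    using fixed_point_in_compact_convex by metis
  have "Y \<subseteq> closure (convex hull (orb x))"
    unfolding Y_def by (intro closure_minimal hull_minimal convex_closure convex_convex_hull ZH) auto
  with p that show thesis by blast
qed

end

section \<open>Bounded functions and the double limit criterion\<close>

instance bcontfun :: (metric_space, banach) banach ..

type_synonym 't bfun = "'t discrete \<Rightarrow>\<^sub>C complex"

definition to_bfun :: "('t \<Rightarrow> complex) \<Rightarrow> 't bfun" where
  "to_bfun f = Bcontfun (\<lambda>x. f (of_discrete x))"

definition val :: "'t bfun \<Rightarrow> 't \<Rightarrow> complex" where
  "val h t = apply_bcontfun h (discrete t)"

lemma continuous_on_discrete: "continuous_on S (f :: 't discrete \<Rightarrow> 'b::topological_space)"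
  by (rule continuous_on_subset[of UNIV]) (auto simp: continuous_on_open_vimage open_discrete)

lemma val_to_bfun:
  assumes "bounded (range f)" shows "val (to_bfun f) t = f t"
proof -
  have "range (\<lambda>x. f (of_discrete x)) \<subseteq> range f" by auto
  then have "(\<lambda>x. f (of_discrete x)) \<in> bcontfun"
    using assms by (auto simp: bcontfun_def continuous_on_discrete intro: bounded_subset)
  then show ?thesis by (simp add: val_def to_bfun_def Bcontfun_inverse discrete_inverse)
qed

lemma val_to_bfun': "(\<And>t. norm (f t) \<le> B) \<Longrightarrow> val (to_bfun f) t = f t"
  by (intro val_to_bfun) (auto simp: bounded_iff)

lemma bfun_eqI: "(\<And>t. val g t = val h t) \<Longrightarrow> g = h"
  unfolding val_def by (rule bcontfun_eqI) (metis of_discrete_inverse)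

lemma val_simps [simp]:
  "val (g + h) t = val g t + val h t" "val (g - h) t = val g t - val h t"
  "val (r *\<^sub>R h) t = r *\<^sub>R val h t" "val 0 t = 0" "val (- h) t = - val h t"
  by (simp_all add: val_def plus_bcontfun.rep_eq minus_bcontfun.rep_eq scaleR_bcontfun.rep_eq
      zero_bcontfun.rep_eq uminus_bcontfun.rep_eq)

lemma norm_val_le: "norm (val h t) \<le> norm h"
  unfolding val_def by (rule norm_bounded)

lemma norm_bfun_le: "(\<And>t. norm (val h t) \<le> b) \<Longrightarrow> norm h \<le> b"
  unfolding val_def by (rule norm_bound) (metis of_discrete_inverse)

lemma bounded_range_val: "bounded (range (val h))"
  using norm_val_le[of h] by (auto simp: bounded_iff)

lemma to_bfun_val: "to_bfun (val h) = h"
  by (rule bfun_eqI) (simp add: val_to_bfun bounded_range_val)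

lemma bounded_linear_val: "bounded_linear (\<lambda>h. val h t)"
  using norm_val_le[of _ t] by (intro bounded_linear_intro[of _ 1]) auto

lemma bounded_linear_bfunI:
  fixes F :: "'a::real_normed_vector \<Rightarrow> 't \<Rightarrow> complex"
  assumes "\<And>x y t. F (x + y) t = F x t + F y t" "\<And>r x t. F (r *\<^sub>R x) t = r *\<^sub>R F x t"
    and bd: "\<And>x t. norm (F x t) \<le> K * norm x"
  shows "bounded_linear (\<lambda>x. to_bfun (F x))"
proof -
  have v: "val (to_bfun (F x)) t = F x t" for x t by (rule val_to_bfun'[OF bd])
  show ?thesis
  proof (rule bounded_linear_intro[of _ K])
    show "norm (to_bfun (F x)) \<le> norm x * K" for x
      using bd by (intro norm_bfun_le) (simp add: v mult.commute)
  qed (auto intro!: bfun_eqI simp: v assms)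
qed

lemma continuous_map_weak_euclidean:
  fixes T :: "'a::real_normed_vector \<Rightarrow> 'b::euclidean_space"
  assumes "bounded_linear T" shows "continuous_map weak euclidean T"
proof -
  have "continuous_map weak euclidean (\<lambda>x. (T x \<bullet> b) *\<^sub>R b)" for b
  proof -
    have 1: "continuous_map weak euclidean (\<lambda>x. T x \<bullet> b)"
      using bounded_linear_compose[OF bounded_linear_inner_left assms]
      by (intro continuous_map_weak_functional)
    have 2: "continuous_map euclidean euclidean (\<lambda>r::real. r *\<^sub>R b)"
      by (simp add: continuous_intros)
    show ?thesis using continuous_map_compose[OF 1 2] by (simp add: o_def)
  qed
  then have "continuous_map weak euclidean (\<lambda>x. \<Sum>b\<in>Basis. (T x \<bullet> b) *\<^sub>R b)"
    by (intro continuous_map_sum) auto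
  then show ?thesis by (simp add: euclidean_representation)
qed

text \<open>The double limit criterion in a form without limits. A weak cluster point \<open>g\<close> of the columns
  \<open>f(\<cdot>, t\<^sub>k)\<close> inherits from late columns that its values at the \<open>s\<^sub>i\<close> are far from \<open>\<gamma>\<close>; by Mazur's theorem it is
  also approximated by convex combinations of finitely many columns, and at late \<open>s\<^sub>i\<close> these are near \<open>\<gamma>\<close>.\<close>

lemma no_gap:
  fixes f :: "'s \<Rightarrow> 't \<Rightarrow> complex" and s :: "nat \<Rightarrow> 's" and t :: "nat \<Rightarrow> 't"
  assumes K: "compactin weak K" "\<And>t. to_bfun (\<lambda>s. f s t) \<in> K" and B: "\<And>s t. norm (f s t) \<le> B"
    and far: "\<And>i k. i \<le> k \<Longrightarrow> a \<le> norm (f (s i) (t k) - \<gamma>)"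
    and near: "\<And>i k. k < i \<Longrightarrow> norm (f (s i) (t k) - \<gamma>) \<le> b"
    and ab: "b < a"
  shows False
proof -
  define F where "F = (\<lambda>k::nat. to_bfun (\<lambda>s. f s (t k)))"
  have vF: "val (F k) x = f x (t k)" for k x unfolding F_def by (rule val_to_bfun'[OF B])
  have FK: "F k \<in> K" for k by (simp add: F_def K)
  define A where "A = (\<lambda>n. weak closure_of (F ` {n..}))"
  have AK: "A n \<subseteq> K" for n
    unfolding A_def using FK by (intro closure_of_minimal compactin_weak_imp_closedin K) auto
  have "(\<Inter>n. A n) \<noteq> {}"
  proof (rule compact_space_imp_nest)
    show "compact_space (subtopology weak K)" using K by (simp add: compact_space_subtopology)
    show "closedin (subtopology weak K) (A n)" for n
      using AK[of n] by (auto simp: closedin_subtopology A_def intro!: exI[of _ "A n"])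
    have "F ` {n..} \<subseteq> A n" for n unfolding A_def by (intro closure_of_subset) simp
    then show "A n \<noteq> {}" for n by (metis atLeast_iff empty_iff image_eqI order_refl subset_empty)
    show "decseq A" unfolding A_def by (intro decseq_SucI closure_of_mono) auto
  qed
  then obtain g where g: "\<And>n. g \<in> A n" by blast
  \<comment> \<open>Evaluated at \<open>s i\<close>, the tail of the sequence stays away from \<open>\<gamma>\<close>, hence so does its cluster point.\<close>
  have g_far: "a \<le> norm (val g (s i) - \<gamma>)" for i
  proof -
    have "closedin weak {h. val h (s i) \<in> {z. a \<le> norm (z - \<gamma>)}}"
      using closedin_continuous_map_preimage[OF continuous_map_weak_euclidean[OF bounded_linear_val[of "s i"]],
          of "{z. a \<le> norm (z - \<gamma>)}"]
      by (simp add: closed_Collect_le continuous_intros)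
    then have "A i \<subseteq> {h. val h (s i) \<in> {z. a \<le> norm (z - \<gamma>)}}"
      unfolding A_def using far by (intro closure_of_minimal) (auto simp: vF)
    with g[of i] show ?thesis by auto
  qed
  \<comment> \<open>But it is a norm limit of convex combinations of the sequence, and those come close to \<open>\<gamma>\<close>.\<close>
  define \<eta> where "\<eta> = (a - b) / 2"
  have \<eta>: "\<eta> > 0" using ab by (simp add: \<eta>_def)
  have "g \<in> closure (convex hull (F ` {0..}))"
    using g[of 0] weak_closure_subset_closure_convex_hull unfolding A_def by blast
  then obtain h where h: "h \<in> convex hull (F ` {0..})" "dist h g < \<eta>"
    using \<eta> closure_approachable by blast
  obtain \<F> where \<F>: "finite \<F>" "\<F> \<subseteq> F ` {0..}" "h \<in> convex hull \<F>"
    using convex_hull_finite_subset[OF h(1)] by metis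
  obtain N where N: "finite N" "\<F> = F ` N"
    using \<F> finite_subset_image[of \<F> F "{0..}"] by auto
  obtain m where m: "N \<subseteq> {..<m}" using N(1) finite_nat_iff_bounded by blast
  have "h \<in> convex hull {h. val h (s m) \<in> cball \<gamma> b}"
    using \<F>(3) m near N(2)
    by (elim subsetD[OF hull_mono, rotated]) (auto simp: vF dist_norm norm_minus_commute)
  also have "\<dots> = {h. val h (s m) \<in> cball \<gamma> b}"
  proof -
    have "convex ((\<lambda>h. val h (s m)) -` cball \<gamma> b)"
      by (intro convex_linear_vimage bounded_linear.linear bounded_linear_val convex_cball)
    then show ?thesis by (intro hull_same) (simp add: vimage_def)
  qed
  finally have "norm (val h (s m) - \<gamma>) \<le> b" by (simp add: dist_norm norm_minus_commute)
  moreover have "norm (val (g - h) (s m)) < \<eta>"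
    using norm_val_le[of "g - h" "s m"] h(2) by (simp add: dist_norm norm_minus_commute)
  moreover have "norm (val g (s m) - \<gamma>) \<le> norm (val (g - h) (s m)) + norm (val h (s m) - \<gamma>)"
    using norm_triangle_ineq[of "val (g - h) (s m)" "val h (s m) - \<gamma>"] by simp
  ultimately show False using g_far[of m] ab by (simp add: \<eta>_def field_simps)
qed

text \<open>The total variation of a real functional on bounded functions, as a finitely additive measure.\<close>

definition variation :: "('t bfun \<Rightarrow> real) \<Rightarrow> 't set \<Rightarrow> real" where
  "variation \<Psi> E = Sup (\<Psi> ` {h. \<forall>t. norm (val h t) \<le> indicator E t})"

lemma variation:
  fixes \<Psi> :: "'t bfun \<Rightarrow> real"
  assumes lin: "bounded_linear \<Psi>" and L: "\<And>h. \<bar>\<Psi> h\<bar> \<le> L * norm h" "L \<ge> 0"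
  shows variation_upper: "\<And>h E. (\<And>t. norm (val h t) \<le> indicator E t) \<Longrightarrow> \<bar>\<Psi> h\<bar> \<le> variation \<Psi> E"
    and variation_le: "\<And>E. variation \<Psi> E \<le> L"
    and variation_nonneg: "\<And>E. 0 \<le> variation \<Psi> E"
    and variation_empty: "variation \<Psi> {} = 0"
    and variation_Un: "\<And>E F. E \<inter> F = {} \<Longrightarrow> variation \<Psi> (E \<union> F) = variation \<Psi> E + variation \<Psi> F"
proof -
  let ?H = "\<lambda>E. {h. \<forall>t::'t. norm (val h t) \<le> indicator E t}"
  have up: "\<Psi> h \<le> L" if "h \<in> ?H E" for h E
  proof -
    have "norm h \<le> 1" using that by (intro norm_bfun_le) (auto simp: indicator_def intro: order_trans split: if_splits)
    then have "L * norm h \<le> L * 1" using L(2) by (rule mult_left_mono)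
    with L(1)[of h] show ?thesis by simp
  qed
  have bdd: "bdd_above (\<Psi> ` ?H E)" for E using up by (intro bdd_aboveI2) auto
  have zero: "0 \<in> ?H E" for E by simp
  have \<Psi>0: "\<Psi> 0 = 0" using linear_0[OF bounded_linear.linear[OF lin]] .
  have upper: "\<Psi> h \<le> variation \<Psi> E" if "h \<in> ?H E" for h E
    unfolding variation_def using that by (intro cSup_upper bdd) auto
  have least: "variation \<Psi> E \<le> c" if "\<And>h. h \<in> ?H E \<Longrightarrow> \<Psi> h \<le> c" for c E
  proof (unfold variation_def, rule cSup_least)
    show "\<Psi> ` ?H E \<noteq> {}" using zero by blast
  qed (use that in blast)
  show "\<bar>\<Psi> h\<bar> \<le> variation \<Psi> E" if "\<And>t. norm (val h t) \<le> indicator E t" for h E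
  proof -
    have "\<Psi> (- h) = - \<Psi> h" using linear_neg[OF bounded_linear.linear[OF lin]] .
    moreover have "\<Psi> h \<le> variation \<Psi> E" "\<Psi> (- h) \<le> variation \<Psi> E" using that by (auto intro!: upper)
    ultimately show ?thesis by simp
  qed
  show "variation \<Psi> E \<le> L" for E using up by (intro least)
  show nn: "0 \<le> variation \<Psi> E" for E using upper[OF zero, of E] \<Psi>0 by simp
  have "\<Psi> h \<le> 0" if "h \<in> ?H {}" for h
  proof -
    have "h = 0" using that by (intro bfun_eqI) simp
    with \<Psi>0 show ?thesis by simp
  qed
  then show "variation \<Psi> {} = 0" using nn[of "{}"] by (intro order_antisym least) auto
  fix E F :: "'t set" assume EF: "E \<inter> F = {}"
  show "variation \<Psi> (E \<union> F) = variation \<Psi> E + variation \<Psi> F"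
  proof (rule order_antisym)
    show "variation \<Psi> (E \<union> F) \<le> variation \<Psi> E + variation \<Psi> F"
    proof (rule least)
      fix h assume h: "h \<in> ?H (E \<union> F)"
      define hE where "hE = to_bfun (\<lambda>t. if t \<in> E then val h t else 0)"
      have vE: "val hE t = (if t \<in> E then val h t else 0)" for t
        unfolding hE_def by (rule val_to_bfun'[of _ "norm h"]) (auto simp: norm_val_le)
      have ht: "norm (val h t) \<le> indicator (E \<union> F) t" for t using h by blast
      have "norm (val hE t) \<le> indicator E t" for t
        using ht[of t] by (cases "t \<in> E") (auto simp: vE)
      then have "hE \<in> ?H E" by blast
      moreover have "norm (val (h - hE) t) \<le> indicator F t" for t
        using ht[of t] by (cases "t \<in> E"; cases "t \<in> F") (auto simp: vE)
      then have "h - hE \<in> ?H F" by blast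
      ultimately have "\<Psi> hE + \<Psi> (h - hE) \<le> variation \<Psi> E + variation \<Psi> F" by (intro add_mono upper)
      moreover have "\<Psi> h = \<Psi> hE + \<Psi> (h - hE)"
        using linear_add[OF bounded_linear.linear[OF lin], of hE "h - hE"] by simp
      ultimately show "\<Psi> h \<le> variation \<Psi> E + variation \<Psi> F" by simp
    qed
    have "\<Psi> h + \<Psi> k \<le> variation \<Psi> (E \<union> F)" if h: "h \<in> ?H E" and k: "k \<in> ?H F" for h k
    proof -
      have "h + k \<in> ?H (E \<union> F)"
      proof (intro CollectI allI)
        fix t
        have "norm (val (h + k) t) \<le> norm (val h t) + norm (val k t)" by (simp add: norm_triangle_ineq)
        also have "\<dots> \<le> indicator E t + indicator F t" using h k by (intro add_mono) auto
        also have "\<dots> = indicator (E \<union> F) t" using EF by (auto simp: indicator_def)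
        finally show "norm (val (h + k) t) \<le> indicator (E \<union> F) t" .
      qed
      from upper[OF this] show ?thesis using linear_add[OF bounded_linear.linear[OF lin], of h k] by simp
    qed
    note sum = this
    have "\<Psi> h \<le> variation \<Psi> (E \<union> F) - variation \<Psi> F" if h: "h \<in> ?H E" for h
    proof -
      have "\<Psi> k \<le> variation \<Psi> (E \<union> F) - \<Psi> h" if "k \<in> ?H F" for k
        using sum[OF h that] by simp
      then have "variation \<Psi> F \<le> variation \<Psi> (E \<union> F) - \<Psi> h" by (rule least)
      then show ?thesis by simp
    qed
    then have "variation \<Psi> E \<le> variation \<Psi> (E \<union> F) - variation \<Psi> F" by (rule least)
    then show "variation \<Psi> E + variation \<Psi> F \<le> variation \<Psi> (E \<union> F)" by simp
  qed
qed

text \<open>Among sets of measure at least \<open>c\<close> in a space of measure at most \<open>L\<close>, more than \<open>L / c\<close> cannot be almost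
  disjoint: the measure of the union of \<open>k\<close> of them is at least \<open>k c\<close> minus the measures of the pairwise
  intersections.\<close>

lemma additive_large_intersection:
  fixes m :: "'t set \<Rightarrow> real"
  assumes m: "\<And>E. 0 \<le> m E" "\<And>E. m E \<le> L" "m {} = 0"
    and add: "\<And>E F. E \<inter> F = {} \<Longrightarrow> m (E \<union> F) = m E + m F" and c: "c > 0"
  shows "\<exists>c'>0. \<forall>E :: nat \<Rightarrow> 't set. (\<forall>i. c \<le> m (E i)) \<longrightarrow> (\<exists>i j. i < j \<and> c' \<le> m (E i \<inter> E j))"
proof -
  have split: "m E = m (E \<inter> F) + m (E - F)" for E F
    using add[of "E \<inter> F" "E - F"] by (simp add: Int_Diff_Un Diff_Int_distrib Int_Diff)
  have mono: "m E \<le> m F" if "E \<subseteq> F" for E F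
    using split[of F E] m(1)[of "F - E"] that by (simp add: inf.absorb2)
  have subadd: "m (E \<union> F) \<le> m E + m F" for E F
    using add[of E "F - E"] mono[of "F - E" F] by simp
  have subadd': "m (E \<inter> (\<Union>i<n. D i)) \<le> (\<Sum>i<n. m (E \<inter> D i))" for E and D :: "nat \<Rightarrow> 't set" and n
  proof (induction n)
    case (Suc n)
    have "E \<inter> (\<Union>i<Suc n. D i) = (E \<inter> (\<Union>i<n. D i)) \<union> (E \<inter> D n)" by (auto simp: less_Suc_eq)
    with subadd[of "E \<inter> (\<Union>i<n. D i)" "E \<inter> D n"] Suc show ?case by simp
  qed (simp add: m)
  obtain k :: nat where k: "(L + 1) / c \<le> real k" using real_arch_simple by blast
  have L: "L \<ge> 0" using m(1,2) order_trans by blast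
  have kc: "L + 1 \<le> real k * c" using k c by (simp add: field_simps)
  define c' where "c' = 1 / (2 * (real k ^ 2 + 1))"
  have c': "c' > 0" unfolding c'_def by (intro divide_pos_pos mult_pos_pos) (auto intro: add_nonneg_pos)
  show ?thesis
  proof (intro exI[of _ c'] conjI c' allI impI)
    fix E :: "nat \<Rightarrow> 't set" assume E': "\<forall>i. c \<le> m (E i)"
    then have E: "\<And>i. c \<le> m (E i)" by blast
    show "\<exists>i j. i < j \<and> c' \<le> m (E i \<inter> E j)"
    proof (rule ccontr)
      assume "\<not> ?thesis"
      then have small: "m (E j \<inter> E i) \<le> c'" if "i < j" for i j
        using that by (auto simp: not_le Int_commute intro: less_imp_le)
      have "real n * c - real n * real n * c' \<le> m (\<Union>i<n. E i)" for n
      proof (induction n)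
        case (Suc n)
        have "m (E n \<inter> (\<Union>i<n. E i)) \<le> (\<Sum>i<n. m (E n \<inter> E i))" by (rule subadd')
        also have "\<dots> \<le> (\<Sum>i<n. c')" by (intro sum_mono small) auto
        finally have 1: "m (E n \<inter> (\<Union>i<n. E i)) \<le> real n * c'" by simp
        have "(\<Union>i<Suc n. E i) = (\<Union>i<n. E i) \<union> (E n - (\<Union>i<n. E i))" by (auto simp: less_Suc_eq)
        then have "m (\<Union>i<Suc n. E i) = m (\<Union>i<n. E i) + m (E n - (\<Union>i<n. E i))"
          using add[of "\<Union>i<n. E i" "E n - (\<Union>i<n. E i)"] by auto
        then have 2: "m (\<Union>i<Suc n. E i) = m (\<Union>i<n. E i) + m (E n) - m (E n \<inter> (\<Union>i<n. E i))"
          using split[of "E n" "\<Union>i<n. E i"] by simp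
        have 3: "real (Suc n) * c - real (Suc n) * real (Suc n) * c' \<le>
            (real n * c - real n * real n * c') + c - real n * c'"
        proof -
          have "0 \<le> (real n + 1) * c'" using c' by simp
          then show ?thesis by (simp add: algebra_simps)
        qed
        show ?case using Suc.IH 1 2 3 E[of n] by linarith
      qed (simp add: m)
      from this[of k] have "real k * c - real k * real k * c' \<le> L" using m(2) order_trans by blast
      moreover have "real k * real k * c' < 1"
      proof -
        have "real k * real k < 2 * ((real k)\<^sup>2 + 1)"
        proof -
          have "q < 2 * (q + 1)" if "q \<ge> 0" for q :: real using that by simp
          from this[OF zero_le_power2[of "real k"]] show ?thesis by (simp only: power2_eq_square)
        qed
        moreover have "2 * ((real k)\<^sup>2 + 1) > 0" by (intro mult_pos_pos add_nonneg_pos) auto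
        ultimately have "real k * real k / (2 * ((real k)\<^sup>2 + 1)) < 1"
          by (simp only: divide_less_eq_1_pos)
        then show ?thesis by (simp add: c'_def)
      qed
      ultimately show False using kc by linarith
    qed
  qed
qed

text \<open>Neighbourhoods of \<open>g\<close> for the topology of pointwise convergence, restricted to the family \<open>f\<close>.\<close>

definition ptwise_near :: "('s \<Rightarrow> 't \<Rightarrow> complex) \<Rightarrow> ('t \<Rightarrow> complex) \<Rightarrow> 't set \<Rightarrow> real \<Rightarrow> 's \<Rightarrow> bool" where
  "ptwise_near f g T \<eta> s \<longleftrightarrow> (\<forall>t\<in>T. norm (f s t - g t) < \<eta>)"

text \<open>The sequences are built so that the points \<open>t\<^sub>k\<close> lie in a decreasing sequence of sets
  \<open>D\<^sub>k = E(s\<^sub>0) \<inter> \<dots> \<inter> E(s\<^sub>k)\<close>, while each \<open>s\<^sub>i\<close> is chosen close to \<open>g\<close> at all earlier points. The invariant \<open>\<P>\<close> keeps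
  \<open>D\<^sub>k\<close> from becoming null for the remaining choices; if it broke down for every admissible next \<open>s\<close>, the sets
  \<open>D \<inter> E(s)\<close> would contain an infinite almost disjoint family.\<close>

lemma gap_sequences:
  fixes f :: "'s \<Rightarrow> 't \<Rightarrow> complex" and m :: "'t set \<Rightarrow> real"
  assumes m: "\<And>E. 0 \<le> m E" "\<And>E. m E \<le> L" "m {} = 0"
    and add: "\<And>E F. E \<inter> F = {} \<Longrightarrow> m (E \<union> F) = m E + m F"
    and \<delta>: "\<delta> > 0" and \<epsilon>: "\<epsilon> > 0"
    and fam: "\<And>T \<eta>. finite T \<Longrightarrow> \<eta> > 0 \<Longrightarrow>
      \<exists>s. ptwise_near f g T \<eta> s \<and> \<delta> \<le> m {t. a \<le> norm (f s t - g t)}"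
  obtains s t where "\<And>i k. i \<le> k \<Longrightarrow> a \<le> norm (f (s i) (t k) - g (t k))"
    "\<And>i k::nat. k < i \<Longrightarrow> norm (f (s i) (t k) - g (t k)) < \<epsilon>"
proof -
  define E where "E = (\<lambda>s. {t. a \<le> norm (f s t - g t)})"
  \<comment> \<open>\<open>D\<close> meets, in measure at least \<open>c\<close>, some \<open>E s\<close> with \<open>f s\<close> in any prescribed neighbourhood of \<open>g\<close>.\<close>
  define \<P> where "\<P> = (\<lambda>D c. \<forall>T \<eta>. finite T \<longrightarrow> \<eta> > 0 \<longrightarrow> (\<exists>s. ptwise_near f g T \<eta> s \<and> c \<le> m (D \<inter> E s)))"
  have start: "\<P> UNIV \<delta>" using fam by (auto simp: \<P>_def E_def)
  have step: "\<exists>s c'. ptwise_near f g T0 \<eta>0 s \<and> c' > 0 \<and> \<P> (D \<inter> E s) c'"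
    if P: "\<P> D c" and c: "c > 0" and T0: "finite T0" and \<eta>0: "\<eta>0 > 0" for D c T0 \<eta>0
  proof -
    obtain c' where c': "c' > 0"
      "\<And>F :: nat \<Rightarrow> 't set. (\<And>i. c \<le> m (F i)) \<Longrightarrow> \<exists>i j. i < j \<and> c' \<le> m (F i \<inter> F j)"
    proof -
      have "\<exists>c'>0. \<forall>F :: nat \<Rightarrow> 't set. (\<forall>i. c \<le> m (F i)) \<longrightarrow> (\<exists>i j. i < j \<and> c' \<le> m (F i \<inter> F j))"
        by (rule additive_large_intersection[where m = m and L = L]) (use m add c in auto)
      then show thesis using that by blast
    qed
    show ?thesis
    proof (rule ccontr)
      assume neg: "\<not> ?thesis"
      have "\<exists>T \<eta>. finite T \<and> \<eta> > 0 \<and> (\<forall>s'. ptwise_near f g T \<eta> s' \<longrightarrow> m ((D \<inter> E s) \<inter> E s') < c')"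
        if "ptwise_near f g T0 \<eta>0 s" for s
      proof -
        have "\<not> \<P> (D \<inter> E s) c'" using neg that c'(1) by blast
        then show ?thesis unfolding \<P>_def by (meson not_le)
      qed
      then obtain TT \<eta>\<eta> where TT: "\<And>s. ptwise_near f g T0 \<eta>0 s \<Longrightarrow> finite (TT s) \<and> \<eta>\<eta> s > 0 \<and>
          (\<forall>s'. ptwise_near f g (TT s) (\<eta>\<eta> s) s' \<longrightarrow> m ((D \<inter> E s) \<inter> E s') < c')"
        by metis
      define R where "R = (\<lambda>(q::nat \<Rightarrow> 's) n r. ptwise_near f g T0 \<eta>0 r \<and> c \<le> m (D \<inter> E r) \<and>
          (\<forall>i<n. m ((D \<inter> E (q i)) \<inter> E r) < c'))"
      have "\<exists>q. \<forall>n. R q n (q n)"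
      proof (rule dependent_wellorder_choice)
        show "R q n r = R q' n r" if "\<And>y. y < n \<Longrightarrow> q y = q' y" for r q q' n
          using that by (simp add: R_def)
        fix n q assume prev: "\<And>y. y < n \<Longrightarrow> R q y (q y)"
        define T where "T = T0 \<union> (\<Union>i<n. TT (q i))"
        define \<eta> where "\<eta> = Min (insert \<eta>0 ((\<lambda>i. \<eta>\<eta> (q i)) ` {..<n}))"
        have near: "ptwise_near f g T0 \<eta>0 (q i)" if "i < n" for i using prev[OF that] by (simp add: R_def)
        have "finite T" using T0 TT near by (auto simp: T_def)
        moreover have "\<eta> > 0" using \<eta>0 TT near by (auto simp: \<eta>_def)
        ultimately obtain r where r: "ptwise_near f g T \<eta> r" "c \<le> m (D \<inter> E r)"
          using P unfolding \<P>_def by blast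
        have "\<eta> \<le> \<eta>0" by (simp add: \<eta>_def)
        then have "ptwise_near f g T0 \<eta>0 r" using r(1) by (force simp: ptwise_near_def T_def)
        moreover have "m ((D \<inter> E (q i)) \<inter> E r) < c'" if "i < n" for i
        proof -
          have "\<eta> \<le> \<eta>\<eta> (q i)" using that by (simp add: \<eta>_def)
          then have "ptwise_near f g (TT (q i)) (\<eta>\<eta> (q i)) r" using r(1) that by (force simp: ptwise_near_def T_def)
          with TT[OF near[OF that]] show ?thesis by blast
        qed
        ultimately show "\<exists>r. R q n r" using r(2) by (auto simp: R_def)
      qed
      then obtain q where q: "\<And>n. R q n (q n)" by blast
      have "c \<le> m (D \<inter> E (q i))" for i using q[of i] by (simp add: R_def)
      from c'(2)[OF this] obtain i j where ij: "i < j" "c' \<le> m ((D \<inter> E (q i)) \<inter> (D \<inter> E (q j)))" by blast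
      moreover have "(D \<inter> E (q i)) \<inter> (D \<inter> E (q j)) = (D \<inter> E (q i)) \<inter> E (q j)" by blast
      ultimately show False using q[of j] by (auto simp: R_def)
    qed
  qed
  have nonempty: "\<exists>t. t \<in> D" if P: "\<P> D c" and c: "c > 0" for D c
  proof -
    have "\<exists>s. ptwise_near f g {} 1 s \<and> c \<le> m (D \<inter> E s)" using P unfolding \<P>_def by simp
    then obtain s where "c \<le> m (D \<inter> E s)" by blast
    with c m(3) have "D \<inter> E s \<noteq> {}" by force
    then show ?thesis by blast
  qed
  define Inv where "Inv = (\<lambda>(D, c, s, t, T). \<P> D c \<and> c > 0 \<and> D \<subseteq> E s \<and> t \<in> D \<and> finite T \<and> t \<in> T)"
  define Nxt where "Nxt = (\<lambda>(D::'t set, c::real, s::'s, t::'t, T) (D', c'::real, s', t'::'t, T').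
      D' \<subseteq> D \<and> T \<subseteq> T' \<and> ptwise_near f g T \<epsilon> s')"
  have "\<exists>x. \<forall>n. Inv (x n) \<and> Nxt (x n) (x (Suc n))"
  proof (rule dependent_nat_choice)
    obtain s c' where s: "c' > 0" "\<P> (UNIV \<inter> E s) c'"
      using step[OF start \<delta>, of "{}" 1] by auto
    obtain t where "t \<in> UNIV \<inter> E s" using nonempty[OF s(2,1)] by blast
    with s have "Inv (UNIV \<inter> E s, c', s, t, {t})" by (simp add: Inv_def)
    then show "\<exists>x. Inv x" by blast
  next
    fix x n assume x: "Inv x"
    obtain D c s t T where [simp]: "x = (D, c, s, t, T)" by (metis surj_pair)
    have x': "\<P> D c" "c > 0" "finite T" using x by (auto simp: Inv_def)
    obtain s' c' where s: "ptwise_near f g T \<epsilon> s'" "c' > 0" "\<P> (D \<inter> E s') c'"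
      using step[OF x'(1,2,3) \<epsilon>] by blast
    obtain t' where "t' \<in> D \<inter> E s'" using nonempty[OF s(3,2)] by blast
    with s x' have "Inv (D \<inter> E s', c', s', t', insert t' T) \<and> Nxt x (D \<inter> E s', c', s', t', insert t' T)"
      by (auto simp: Inv_def Nxt_def)
    then show "\<exists>y. Inv y \<and> Nxt x y" by blast
  qed
  then obtain x where x: "\<And>n. Inv (x n)" "\<And>n. Nxt (x n) (x (Suc n))" by blast
  define D where "D = (\<lambda>n. fst (x n))"
  define s where "s = (\<lambda>n. fst (snd (snd (x n))))"
  define t where "t = (\<lambda>n. fst (snd (snd (snd (x n)))))"
  define T where "T = (\<lambda>n. snd (snd (snd (snd (x n)))))"
  have I: "D n \<subseteq> E (s n)" "t n \<in> D n" "t n \<in> T n" for n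
    using x(1)[of n] by (auto simp: Inv_def D_def s_def t_def T_def split: prod.splits)
  have X: "D (Suc n) \<subseteq> D n" "T n \<subseteq> T (Suc n)" "ptwise_near f g (T n) \<epsilon> (s (Suc n))" for n
    using x(2)[of n] by (auto simp: Nxt_def D_def s_def t_def T_def split: prod.splits)
  have Dm: "D k \<subseteq> D i" if "i \<le> k" for i k using lift_Suc_antimono_le[of D, OF X(1) that] .
  have Tm: "T i \<subseteq> T k" if "i \<le> k" for i k using lift_Suc_mono_le[of T, OF X(2) that] .
  show thesis
  proof (rule that[of s t])
    fix i k :: nat assume "i \<le> k"
    then have "t k \<in> E (s i)" using I Dm by blast
    then show "a \<le> norm (f (s i) (t k) - g (t k))" by (simp add: E_def)
  next
    fix i k :: nat assume "k < i"
    then obtain i' where i': "i = Suc i'" "k \<le> i'" by (metis less_eq_Suc_le Suc_le_D Suc_le_mono)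
    then have "t k \<in> T i'" using I(3)[of k] Tm by blast
    then show "norm (f (s i) (t k) - g (t k)) < \<epsilon>" using X(3)[of i'] i'(1) by (auto simp: ptwise_near_def)
  qed
qed

text \<open>If rows pointwise near \<open>g\<close> had \<open>\<Psi>\<close>-values far from that of \<open>g\<close>, the sets where such a row differs from
  \<open>g\<close> by at least \<open>a\<close> would have variation at least \<open>\<delta>\<close>. The resulting sequences have a gap once \<open>g(t\<^sub>k)\<close> is
  replaced by a cluster value \<open>\<gamma>\<close>.\<close>

lemma functional_continuous_on_family:
  fixes f :: "'s \<Rightarrow> 't \<Rightarrow> complex" and \<Psi> :: "'t bfun \<Rightarrow> real"
  assumes K: "compactin weak K" "\<And>t. to_bfun (\<lambda>s. f s t) \<in> K" and B: "\<And>s t. norm (f s t) \<le> B"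
    and lin: "bounded_linear \<Psi>"
    and g: "\<And>T \<eta>. finite T \<Longrightarrow> \<eta> > 0 \<Longrightarrow> \<exists>s. ptwise_near f g T \<eta> s" and gB: "\<And>t. norm (g t) \<le> B"
    and \<epsilon>: "\<epsilon> > 0"
  shows "\<exists>T \<eta>. finite T \<and> \<eta> > 0 \<and> (\<forall>s. ptwise_near f g T \<eta> s \<longrightarrow> \<bar>\<Psi> (to_bfun (f s)) - \<Psi> (to_bfun g)\<bar> < \<epsilon>)"
proof (rule ccontr)
  assume neg: "\<not> ?thesis"
  obtain L where L: "L > 0" "\<And>h. \<bar>\<Psi> h\<bar> \<le> L * norm h"
    using bounded_linear.pos_bounded[OF lin] by (auto simp: mult.commute)
  have B0: "B \<ge> 0" using gB norm_ge_zero order_trans by blast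
  \<comment> \<open>the part of \<open>f s - g\<close> that is smaller than \<open>a\<close> accounts for at most half of \<open>\<epsilon>\<close>\<close>
  define a where "a = \<epsilon> / (2 * L)"
  define \<delta> where "\<delta> = \<epsilon> / (2 * (2 * B + 1))"
  have a: "a > 0" using \<epsilon> L by (simp add: a_def)
  have \<delta>: "\<delta> > 0" using \<epsilon> B0 by (simp add: \<delta>_def add_nonneg_pos)
  have L0: "L \<ge> 0" using L by simp
  note var = variation_upper[OF lin L(2) L0] variation_nonneg[OF lin L(2) L0] variation_le[OF lin L(2) L0]
    variation_empty[OF lin L(2) L0] variation_Un[OF lin L(2) L0]
  have big: "\<delta> \<le> variation \<Psi> {t. a \<le> norm (f s t - g t)}"
    if far: "\<epsilon> \<le> \<bar>\<Psi> (to_bfun (f s)) - \<Psi> (to_bfun g)\<bar>" for s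
  proof -
    define E where "E = {t. a \<le> norm (f s t - g t)}"
    have hB: "norm (f s t - g t) \<le> 2 * B" for t using norm_triangle_ineq4[of "f s t" "g t"] B[of s t] gB[of t] by linarith
    define h where "h = to_bfun (f s) - to_bfun g"
    have vh: "val h t = f s t - g t" for t
      by (simp add: h_def val_to_bfun'[OF B] val_to_bfun'[OF gB])
    define h1 where "h1 = to_bfun (\<lambda>t. if t \<in> E then val h t else 0)"
    have v1: "val h1 t = (if t \<in> E then val h t else 0)" for t
      unfolding h1_def by (rule val_to_bfun'[of _ "norm h"]) (auto simp: norm_val_le)
    have "\<bar>\<Psi> ((1 / (2 * B + 1)) *\<^sub>R h1)\<bar> \<le> variation \<Psi> E"
    proof (rule var(1))
      fix t show "norm (val ((1 / (2 * B + 1)) *\<^sub>R h1) t) \<le> indicator E t"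
        using hB[of t] B0 by (simp add: v1 vh field_simps)
    qed
    then have 1: "\<bar>\<Psi> h1\<bar> \<le> (2 * B + 1) * variation \<Psi> E"
      using B0 by (simp add: linear_scale[OF bounded_linear.linear[OF lin]] abs_mult field_simps)
    have "norm (h - h1) \<le> a"
      using a by (intro norm_bfun_le) (auto simp: v1 vh E_def)
    then have "L * norm (h - h1) \<le> L * a" using L0 by (rule mult_left_mono)
    then have 2: "\<bar>\<Psi> (h - h1)\<bar> \<le> \<epsilon> / 2"
      using L(2)[of "h - h1"] L(1) by (simp add: a_def)
    have "\<Psi> (to_bfun (f s)) - \<Psi> (to_bfun g) = \<Psi> h1 + \<Psi> (h - h1)"
      using linear_add[OF bounded_linear.linear[OF lin], of h1 "h - h1"]
        linear_diff[OF bounded_linear.linear[OF lin], of "to_bfun (f s)" "to_bfun g"] by (simp add: h_def)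
    then have "\<epsilon> / 2 \<le> (2 * B + 1) * variation \<Psi> E" using far 1 2 by linarith
    then show ?thesis using B0 by (simp add: \<delta>_def E_def field_simps)
  qed
  obtain s t where st: "\<And>i k. i \<le> k \<Longrightarrow> a \<le> norm (f (s i) (t k) - g (t k))"
    "\<And>i k::nat. k < i \<Longrightarrow> norm (f (s i) (t k) - g (t k)) < a / 4"
  proof (rule gap_sequences[where m = "variation \<Psi>" and L = L and \<delta> = \<delta> and \<epsilon> = "a / 4" and f = f and g = g and a = a])
    show "\<exists>s. ptwise_near f g T \<eta> s \<and> \<delta> \<le> variation \<Psi> {t. a \<le> norm (f s t - g t)}"
      if "finite T" "\<eta> > 0" for T \<eta>
      using neg that big by (meson not_le)
  qed (use var \<delta> a that in auto)
  have "bounded (range (\<lambda>k. g (t k)))" using gB by (auto simp: bounded_iff)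
  then obtain \<gamma> r where r: "strict_mono r" "((\<lambda>k. g (t k)) \<circ> r) \<longlonglongrightarrow> \<gamma>"
    using bounded_imp_convergent_subsequence by blast
  obtain n where n: "\<And>k. k \<ge> n \<Longrightarrow> norm (g (t (r k)) - \<gamma>) < a / 4"
    using LIMSEQ_D[OF r(2), of "a / 4"] a by (auto simp: o_def)
  have r': "strict_mono (\<lambda>k. r (k + n))" using r(1) by (simp add: strict_mono_def)
  show False
  proof (rule no_gap[OF K B, where s = "\<lambda>k. s (r (k + n))" and t = "\<lambda>k. t (r (k + n))" and \<gamma> = \<gamma>
        and a = "3 * a / 4" and b = "a / 2"])
    fix i k :: nat
    have split: "f x (t y) - \<gamma> = (f x (t y) - g (t y)) + (g (t y) - \<gamma>)" for x y by simp
    have g': "norm (g (t (r (k + n))) - \<gamma>) < a / 4" by (rule n) simp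
    {
      assume "i \<le> k"
      then have "r (i + n) \<le> r (k + n)" using r(1) by (simp add: strict_mono_less_eq)
      from st(1)[OF this] show "3 * a / 4 \<le> norm (f (s (r (i + n))) (t (r (k + n))) - \<gamma>)"
        using g' norm_diff_ineq[of "f (s (r (i + n))) (t (r (k + n))) - g (t (r (k + n)))" "g (t (r (k + n))) - \<gamma>"]
        by simp
    next
      assume "k < i"
      then have "r (k + n) < r (i + n)" using r(1) by (simp add: strict_mono_less)
      from st(2)[OF this] show "norm (f (s (r (i + n))) (t (r (k + n))) - \<gamma>) \<le> a / 2"
        using g' norm_triangle_ineq[of "f (s (r (i + n))) (t (r (k + n))) - g (t (r (k + n)))" "g (t (r (k + n))) - \<gamma>"]
        by simp
    }
  qed (use a in simp)
qed

lemma compact_bounded_functions: "compact {h :: 't \<Rightarrow> complex. \<forall>t. norm (h t) \<le> B}"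
proof -
  have "compactin (product_topology (\<lambda>_::'t. euclidean) UNIV) (PiE UNIV (\<lambda>_. cball (0::complex) B))"
    unfolding compactin_PiE by simp
  then have "compact (PiE UNIV (\<lambda>_::'t. cball (0::complex) B))"
    by (simp add: euclidean_product_topology)
  moreover have "PiE UNIV (\<lambda>_::'t. cball (0::complex) B) = {h. \<forall>t. norm (h t) \<le> B}"
    by (auto simp: PiE_def Pi_def)
  ultimately show ?thesis by simp
qed

lemma open_ptwise_ball:
  fixes g :: "'t \<Rightarrow> complex"
  assumes "finite T" shows "open {h. \<forall>t\<in>T. norm (h t - g t) < \<eta>}"
proof -
  have "open {h::'t \<Rightarrow> complex. norm (h t - g t) < \<eta>}" for t
    by (intro open_Collect_less continuous_intros continuous_on_product_coordinates)
  then have "open (\<Inter>t\<in>T. {h. norm (h t - g t) < \<eta>})" using assms by (intro open_INT) auto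
  moreover have "(\<Inter>t\<in>T. {h. norm (h t - g t) < \<eta>}) = {h. \<forall>t\<in>T. norm (h t - g t) < \<eta>}" by auto
  ultimately show ?thesis by simp
qed

text \<open>On the pointwise closure \<open>S\<close> of the rows, which is pointwise compact, every functional is continuous
  for pointwise convergence: it is so along the rows at each point of \<open>S\<close>, and the rows are dense.
  Hence \<open>S\<close> is weakly compact.\<close>

theorem weakly_compact_transpose:
  fixes f :: "'s \<Rightarrow> 't \<Rightarrow> complex"
  assumes K: "compactin weak K" "\<And>t. to_bfun (\<lambda>s. f s t) \<in> K" and B: "\<And>s t. norm (f s t) \<le> B"
  obtains K' where "compactin weak K'" "\<And>s. to_bfun (f s) \<in> K'"
proof -
  define S where "S = closure (range f)"
  let ?Q = "{h :: 't \<Rightarrow> complex. \<forall>t. norm (h t) \<le> B}"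
  have cQ: "compact ?Q" by (rule compact_bounded_functions)
  have SQ: "S \<subseteq> ?Q"
  proof -
    have "?Q = (\<Inter>t. {h. norm (h t) \<le> B})" by auto
    moreover have "closed {h::'t \<Rightarrow> complex. norm (h t) \<le> B}" for t
      by (intro closed_Collect_le continuous_intros continuous_on_product_coordinates)
    ultimately have "closed ?Q" by (simp add: closed_INT)
    then show ?thesis unfolding S_def using B by (intro closure_minimal) auto
  qed
  have cS: "compact S"
    using cQ SQ by (metis S_def closed_closure compact_Int_closed inf.absorb_iff2)
  have near: "\<exists>s. ptwise_near f g T \<eta> s \<and> f s \<in> U" if g: "g \<in> S" and T: "finite T" "\<eta> > 0" and U: "open U" "g \<in> U" for g T \<eta> U
  proof -
    have "open (U \<inter> {h. \<forall>t\<in>T. norm (h t - g t) < \<eta>})" using T U by (intro open_Int open_ptwise_ball)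
    moreover have "g \<in> U \<inter> {h. \<forall>t\<in>T. norm (h t - g t) < \<eta>}" using T U by simp
    ultimately have "(U \<inter> {h. \<forall>t\<in>T. norm (h t - g t) < \<eta>}) \<inter> range f \<noteq> {}"
      using g open_Int_closure_eq_empty unfolding S_def by blast
    then show ?thesis by (auto simp: ptwise_near_def)
  qed
  have cont: "continuous_on S (\<lambda>g. \<Psi> (to_bfun g))" if lin: "bounded_linear \<Psi>" for \<Psi> :: "'t bfun \<Rightarrow> real"
    unfolding continuous_on_topological
  proof (intro ballI allI impI)
    fix g V assume g: "g \<in> S" and V: "open V" "\<Psi> (to_bfun g) \<in> V"
    obtain \<epsilon> where \<epsilon>: "\<epsilon> > 0" "ball (\<Psi> (to_bfun g)) \<epsilon> \<subseteq> V" using V openE by blast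
    have approx: "\<exists>T \<eta>. finite T \<and> \<eta> > 0 \<and> (\<forall>s. ptwise_near f h T \<eta> s \<longrightarrow> \<bar>\<Psi> (to_bfun (f s)) - \<Psi> (to_bfun h)\<bar> < \<epsilon> / 2)"
      if h: "h \<in> S" for h
    proof (rule functional_continuous_on_family[OF K B lin])
      show "\<exists>s. ptwise_near f h T \<eta> s" if "finite T" "\<eta> > 0" for T \<eta>
        using near[OF h that, of UNIV] by auto
    qed (use SQ h \<epsilon> in auto)
    obtain T \<eta> where T: "finite T" "\<eta> > 0"
      "\<And>s. ptwise_near f g T \<eta> s \<Longrightarrow> \<bar>\<Psi> (to_bfun (f s)) - \<Psi> (to_bfun g)\<bar> < \<epsilon> / 2"
      using approx[OF g] by blast
    let ?U = "{h. \<forall>t\<in>T. norm (h t - g t) < \<eta>}"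
    have oU: "open ?U" by (rule open_ptwise_ball[OF T(1)])
    have "\<Psi> (to_bfun h) \<in> V" if h: "h \<in> S" "h \<in> ?U" for h
    proof -
      obtain T' \<eta>' where T': "finite T'" "\<eta>' > 0"
        "\<And>s. ptwise_near f h T' \<eta>' s \<Longrightarrow> \<bar>\<Psi> (to_bfun (f s)) - \<Psi> (to_bfun h)\<bar> < \<epsilon> / 2"
        using approx[OF h(1)] by blast
      obtain s where "ptwise_near f h T' \<eta>' s" "f s \<in> ?U" using near[OF h(1) T'(1,2) oU h(2)] by blast
      then have "\<bar>\<Psi> (to_bfun (f s)) - \<Psi> (to_bfun h)\<bar> < \<epsilon> / 2" "\<bar>\<Psi> (to_bfun (f s)) - \<Psi> (to_bfun g)\<bar> < \<epsilon> / 2"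
        using T(3)[of s] T'(3)[of s] by (auto simp: ptwise_near_def)
      then have "dist (\<Psi> (to_bfun g)) (\<Psi> (to_bfun h)) < \<epsilon>" unfolding dist_real_def by linarith
      with \<epsilon>(2) show ?thesis by auto
    qed
    moreover have "g \<in> ?U" using T by simp
    ultimately show "\<exists>A. open A \<and> g \<in> A \<and> (\<forall>y\<in>S. y \<in> A \<longrightarrow> \<Psi> (to_bfun y) \<in> V)"
      using oU by blast
  qed
  have "continuous_map (top_of_set S) weak to_bfun"
    unfolding continuous_map_into_initial_topology using cont by auto
  moreover have "compactin (top_of_set S) S" using cS by (simp add: compactin_subtopology)
  ultimately have "compactin weak (to_bfun ` S)" by (rule image_compactin[rotated])
  moreover have "to_bfun (f s) \<in> to_bfun ` S" for s
    using closure_subset[of "range f"] by (auto simp: S_def)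
  ultimately show thesis using that by blast
qed

section \<open>The mean ergodic projection\<close>

text \<open>The second conjunct says that \<open>p\<close> lies in the norm closed convex hull of the orbit, phrased through the
  convex hull of the operators so that one operator can act on several vectors.\<close>

definition ergodic_limit :: "('a::banach \<Rightarrow>\<^sub>L 'a) set \<Rightarrow> 'a \<Rightarrow> 'a \<Rightarrow> bool" where
  "ergodic_limit \<V> x p \<longleftrightarrow> (\<forall>U\<in>\<V>. blinfun_apply U p = p) \<and>
     (\<forall>e>0. \<exists>T\<in>convex hull \<V>. norm (blinfun_apply T x - p) < e)"

lemma linear_compose_left: "linear (\<lambda>S. S o\<^sub>L (T :: 'a::real_normed_vector \<Rightarrow>\<^sub>L 'a))"
  by (intro bounded_linear.linear bounded_bilinear.bounded_linear_left[OF bounded_bilinear_blinfun_compose])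

lemma linear_compose_right: "linear (\<lambda>S. (T :: 'a::real_normed_vector \<Rightarrow>\<^sub>L 'a) o\<^sub>L S)"
  by (intro bounded_linear.linear bounded_bilinear.bounded_linear_right[OF bounded_bilinear_blinfun_compose])

lemma linear_apply_blinfun: "linear (\<lambda>S. blinfun_apply S x)"
  by (intro bounded_linear.linear blinfun.bounded_linear_left)

context operator_group
begin

lemma norm_hull_le: "T \<in> convex hull \<U> \<Longrightarrow> norm T \<le> C"
  using hull_minimal[of \<U> "cball 0 C" convex] bound by (auto simp: subset_iff)

lemma norm_hull_apply_le:
  assumes "T \<in> convex hull \<U>" shows "norm (blinfun_apply T x) \<le> C * norm x"
  using norm_blinfun[of T x] norm_hull_le[OF assms] by (meson mult_right_mono norm_ge_zero order_trans)

lemma hull_compose: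
  assumes S: "S \<in> convex hull \<U>" and T: "T \<in> convex hull \<U>"
  shows "S o\<^sub>L T \<in> convex hull \<U>"
proof -
  have 1: "U o\<^sub>L T \<in> convex hull \<U>" if U: "U \<in> \<U>" for U
  proof -
    have "U o\<^sub>L T \<in> (\<lambda>T. U o\<^sub>L T) ` (convex hull \<U>)" using T by blast
    also have "\<dots> = convex hull ((\<lambda>T. U o\<^sub>L T) ` \<U>)"
      by (rule convex_hull_linear_image[OF linear_compose_right])
    also have "\<dots> \<subseteq> convex hull \<U>" using U comp_mem by (intro hull_mono) auto
    finally show ?thesis .
  qed
  have "S o\<^sub>L T \<in> (\<lambda>S. S o\<^sub>L T) ` (convex hull \<U>)" using S by blast
  also have "\<dots> = convex hull ((\<lambda>S. S o\<^sub>L T) ` \<U>)"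
    by (rule convex_hull_linear_image[OF linear_compose_left])
  also have "\<dots> \<subseteq> convex hull \<U>" using 1 by (intro hull_minimal convex_convex_hull) auto
  finally show ?thesis .
qed

lemma hull_fixed:
  assumes p: "\<And>U. U \<in> \<U> \<Longrightarrow> blinfun_apply U p = p" and T: "T \<in> convex hull \<U>"
  shows "blinfun_apply T p = p"
proof -
  have "convex ((\<lambda>T. blinfun_apply T p) -` {p})"
    by (intro convex_linear_vimage linear_apply_blinfun) simp
  then have "convex hull \<U> \<subseteq> (\<lambda>T. blinfun_apply T p) -` {p}" using p by (intro hull_minimal) auto
  with T show ?thesis by blast
qed

definition rel_compact_orbit :: "'a \<Rightarrow> bool" where
  "rel_compact_orbit x \<longleftrightarrow> (\<exists>K. compactin weak K \<and> orb x \<subseteq> K)"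

lemma rel_compact_orbit_fixed:
  assumes "\<And>U. U \<in> \<U> \<Longrightarrow> blinfun_apply U p = p" shows "rel_compact_orbit p"
  unfolding rel_compact_orbit_def using assms by (intro exI[of _ "{p}"]) (auto simp: orb_def)

lemma rel_compact_orbit_image:
  assumes x: "rel_compact_orbit x" and S: "bounded_linear S"
    and comm: "\<And>U. U \<in> \<U> \<Longrightarrow> \<exists>U'\<in>\<U>. blinfun_apply U (S x) = S (blinfun_apply U' x)"
  shows "rel_compact_orbit (S x)"
proof -
  obtain K where K: "compactin weak K" "orb x \<subseteq> K" using x by (auto simp: rel_compact_orbit_def)
  have "compactin weak (S ` K)" by (rule image_compactin[OF K(1) continuous_map_weak_weak[OF S]])
  moreover have "orb (S x) \<subseteq> S ` K" using comm K(2) by (fastforce simp: orb_def)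
  ultimately show ?thesis by (auto simp: rel_compact_orbit_def)
qed

lemma rel_compact_orbit_add:
  assumes "rel_compact_orbit x" "rel_compact_orbit y" shows "rel_compact_orbit (x + y)"
proof -
  obtain K L where K: "compactin weak K" "orb x \<subseteq> K" and L: "compactin weak L" "orb y \<subseteq> L"
    using assms by (auto simp: rel_compact_orbit_def)
  have "continuous_map (prod_topology weak weak) weak (\<lambda>p::'a \<times> 'a. fst p + snd p)"
    unfolding continuous_map_into_initial_topology
  proof (intro conjI ballI)
    fix \<phi> :: "'a \<Rightarrow> real" assume "\<phi> \<in> {\<phi>. bounded_linear \<phi>}"
    then have \<phi>: "bounded_linear \<phi>" by simp
    have "continuous_map (prod_topology weak weak) euclidean (\<lambda>p::'a \<times> 'a. \<phi> (fst p))"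
      "continuous_map (prod_topology weak weak) euclidean (\<lambda>p::'a \<times> 'a. \<phi> (snd p))"
      using continuous_map_compose[OF continuous_map_fst continuous_map_weak_functional[OF \<phi>]]
        continuous_map_compose[OF continuous_map_snd continuous_map_weak_functional[OF \<phi>]]
      by (auto simp: o_def)
    then have "continuous_map (prod_topology weak weak) euclidean (\<lambda>p::'a \<times> 'a. \<phi> (fst p) + \<phi> (snd p))"
      by (rule continuous_map_add)
    then show "continuous_map (prod_topology weak weak) euclidean (\<lambda>p::'a \<times> 'a. \<phi> (fst p + snd p))"
      by (simp add: linear_add[OF bounded_linear.linear[OF \<phi>]])
  qed auto
  moreover have "compactin (prod_topology weak weak) (K \<times> L)" using K L by (simp add: compactin_Times)
  ultimately have "compactin weak ((\<lambda>p. fst p + snd p) ` (K \<times> L))" by (rule image_compactin[rotated])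
  moreover have "orb (x + y) \<subseteq> (\<lambda>p. fst p + snd p) ` (K \<times> L)"
  proof
    fix z assume "z \<in> orb (x + y)"
    then obtain U where U: "U \<in> \<U>" "z = blinfun_apply U x + blinfun_apply U y"
      by (auto simp: orb_def blinfun.add_right)
    then have "(blinfun_apply U x, blinfun_apply U y) \<in> K \<times> L" using K(2) L(2) by (auto simp: orb_def)
    then show "z \<in> (\<lambda>p. fst p + snd p) ` (K \<times> L)" using U(2) by (intro image_eqI) auto
  qed
  ultimately show ?thesis by (auto simp: rel_compact_orbit_def)
qed

lemma rel_compact_orbit_scaleR: "rel_compact_orbit x \<Longrightarrow> rel_compact_orbit (r *\<^sub>R x)"
  by (rule rel_compact_orbit_image[OF _ bounded_linear_scaleR_right]) (auto simp: blinfun.scaleR_right)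

lemma rel_compact_orbit_hull:
  assumes x: "rel_compact_orbit x" and T: "T \<in> convex hull \<U>"
  shows "rel_compact_orbit (blinfun_apply T x)"
proof -
  obtain K where K: "compactin weak K" "orb x \<subseteq> K" using x by (auto simp: rel_compact_orbit_def)
  have "convex hull \<U> \<subseteq> {T. rel_compact_orbit (blinfun_apply T x)}"
  proof (rule hull_minimal)
    show "\<U> \<subseteq> {T. rel_compact_orbit (blinfun_apply T x)}"
    proof
      fix U assume U: "U \<in> \<U>"
      have "orb (blinfun_apply U x) \<subseteq> orb x"
        unfolding orb_def[of "blinfun_apply U x"]
        using orb_invariant[OF _ orb_invariant[OF U orb_self]] by blast
      with K show "U \<in> {T. rel_compact_orbit (blinfun_apply T x)}"
        unfolding rel_compact_orbit_def by blast
    qed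
    show "convex {T. rel_compact_orbit (blinfun_apply T x)}"
      by (rule convexI)
        (simp add: blinfun.add_left blinfun.scaleR_left rel_compact_orbit_add rel_compact_orbit_scaleR)
  qed
  with T show ?thesis by blast
qed

lemma ergodic_limit_from_translate:
  assumes "T \<in> convex hull \<U>" "ergodic_limit \<U> (blinfun_apply T x) p"
  shows "ergodic_limit \<U> x p"
  using assms hull_compose unfolding ergodic_limit_def by (metis blinfun_apply_blinfun_compose)

lemma countable_ergodic_limit:
  assumes "countable \<U>" "rel_compact_orbit x"
  obtains p where "ergodic_limit \<U> x p"
proof -
  obtain K where K: "compactin weak K" "orb x \<subseteq> K" using assms by (auto simp: rel_compact_orbit_def)
  obtain p where p: "p \<in> closure (convex hull (orb x))" "\<And>U. U \<in> \<U> \<Longrightarrow> blinfun_apply U p = p"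
    using countable_group_fixed_point[OF assms(1) K] by metis
  have "convex hull (orb x) = (\<lambda>T. blinfun_apply T x) ` (convex hull \<U>)"
    unfolding orb_def by (rule convex_hull_linear_image[OF linear_apply_blinfun, symmetric])
  with p have "ergodic_limit \<U> x p"
    by (auto simp: ergodic_limit_def closure_approachable dist_norm)
  then show thesis by (rule that)
qed

lemma countable_subgroup:
  assumes S: "countable \<S>" "\<S> \<subseteq> \<U>"
  obtains \<V> where "\<S> \<subseteq> \<V>" "\<V> \<subseteq> \<U>" "countable \<V>" "operator_group \<V> C"
proof -
  have "\<forall>U\<in>\<U>. \<exists>V. V \<in> \<U> \<and> V o\<^sub>L U = id_blinfun \<and> U o\<^sub>L V = id_blinfun" using inv_mem by blast
  then obtain J where J: "\<forall>U\<in>\<U>. J U \<in> \<U> \<and> J U o\<^sub>L U = id_blinfun \<and> U o\<^sub>L J U = id_blinfun"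
    by (rule bchoice[THEN exE])
  define A where "A = \<S> \<union> J ` \<S>"
  have A: "A \<subseteq> \<U>" "countable A" using S J by (auto simp: A_def)
  have Ainv: "\<exists>b\<in>A. b o\<^sub>L a = id_blinfun \<and> a o\<^sub>L b = id_blinfun" if "a \<in> A" for a
    using that S J unfolding A_def by blast
  define prd where "prd = (\<lambda>xs. foldr (o\<^sub>L) xs (id_blinfun :: 'a \<Rightarrow>\<^sub>L 'a))"
  have prd_simps: "prd [] = id_blinfun" "prd (a # xs) = a o\<^sub>L prd xs" for a xs by (simp_all add: prd_def)
  have assoc: "(a o\<^sub>L b) o\<^sub>L c = a o\<^sub>L (b o\<^sub>L c)" for a b c :: "'a \<Rightarrow>\<^sub>L 'a"
    by (rule blinfun_eqI) simp
  have idl: "id_blinfun o\<^sub>L a = a" and idr: "a o\<^sub>L id_blinfun = a" for a :: "'a \<Rightarrow>\<^sub>L 'a"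
    by (rule blinfun_eqI, simp)+
  have prd_app: "prd (xs @ ys) = prd xs o\<^sub>L prd ys" for xs ys
    by (induction xs) (simp_all add: prd_simps idl assoc)
  define \<V> where "\<V> = prd ` lists A"
  have comp: "U o\<^sub>L V \<in> \<V>" if UV: "U \<in> \<V>" "V \<in> \<V>" for U V
  proof -
    obtain xs ys where "U = prd xs" "V = prd ys" "xs \<in> lists A" "ys \<in> lists A"
      using UV by (auto simp: \<V>_def)
    then show ?thesis unfolding \<V>_def by (intro image_eqI[of _ _ "xs @ ys"]) (auto simp: prd_app)
  qed
  have AV: "A \<subseteq> \<V>"
  proof
    fix a assume "a \<in> A"
    then show "a \<in> \<V>" unfolding \<V>_def by (intro image_eqI[of _ _ "[a]"]) (auto simp: prd_simps idr)
  qed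
  have VU: "\<V> \<subseteq> \<U>"
  proof -
    have "prd xs \<in> \<U>" if "xs \<in> lists A" for xs
      using that by (induction xs) (use A id_mem comp_mem in \<open>auto simp: prd_simps\<close>)
    then show ?thesis by (auto simp: \<V>_def)
  qed
  have inv: "\<exists>V\<in>\<V>. V o\<^sub>L prd xs = id_blinfun \<and> prd xs o\<^sub>L V = id_blinfun" if "xs \<in> lists A" for xs
    using that
  proof (induction xs)
    case Nil
    have "id_blinfun \<in> \<V>" unfolding \<V>_def by (intro image_eqI[of _ _ "[]"]) (auto simp: prd_simps)
    then show ?case by (intro bexI[of _ id_blinfun]) (auto simp: prd_simps idl)
  next
    case (Cons a xs)
    then obtain V where V: "V \<in> \<V>" "V o\<^sub>L prd xs = id_blinfun" "prd xs o\<^sub>L V = id_blinfun" by auto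
    obtain b where b: "b \<in> A" "b o\<^sub>L a = id_blinfun" "a o\<^sub>L b = id_blinfun" using Ainv Cons by auto
    have "(V o\<^sub>L b) o\<^sub>L prd (a # xs) = V o\<^sub>L ((b o\<^sub>L a) o\<^sub>L prd xs)" by (simp add: prd_simps assoc)
    also have "\<dots> = id_blinfun" using b V by (simp add: idl)
    finally have 1: "(V o\<^sub>L b) o\<^sub>L prd (a # xs) = id_blinfun" .
    have "prd (a # xs) o\<^sub>L (V o\<^sub>L b) = a o\<^sub>L ((prd xs o\<^sub>L V) o\<^sub>L b)" by (simp add: prd_simps assoc)
    also have "\<dots> = id_blinfun" using b V by (simp add: idl)
    finally have 2: "prd (a # xs) o\<^sub>L (V o\<^sub>L b) = id_blinfun" .
    have "V o\<^sub>L b \<in> \<V>" using V(1) b(1) AV by (intro comp) auto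
    with 1 2 show ?case by blast
  qed
  show thesis
  proof (rule that)
    show "\<S> \<subseteq> \<V>" using AV by (auto simp: A_def)
    show "\<V> \<subseteq> \<U>" by fact
    show "countable \<V>" unfolding \<V>_def using A by (intro countable_image countable_lists)
    show "operator_group \<V> C"
    proof
      show "id_blinfun \<in> \<V>" unfolding \<V>_def by (intro image_eqI[of _ _ "[]"]) (auto simp: prd_simps)
      show "\<exists>V\<in>\<V>. V o\<^sub>L U = id_blinfun \<and> U o\<^sub>L V = id_blinfun" if "U \<in> \<V>" for U
        using that inv by (auto simp: \<V>_def)
    qed (use comp C_pos bound VU in auto)
  qed
qed

lemma rel_compact_orbit_subgroup:
  assumes "rel_compact_orbit x" "\<V> \<subseteq> \<U>" "operator_group \<V> C"
  shows "operator_group.rel_compact_orbit \<V> x"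
proof -
  interpret V: operator_group \<V> C by fact
  show ?thesis using assms(1,2) unfolding rel_compact_orbit_def V.rel_compact_orbit_def
    orb_def V.orb_def by blast
qed

end

subsection \<open>Composition operators on bounded functions\<close>

definition pull :: "('t \<Rightarrow> 't) \<Rightarrow> 't bfun \<Rightarrow>\<^sub>L 't bfun" where
  "pull \<sigma> = Blinfun (\<lambda>h. to_bfun (\<lambda>t. val h (\<sigma> t)))"

lemma val_pull [simp]: "val (blinfun_apply (pull \<sigma>) h) t = val h (\<sigma> t)"
proof -
  have "bounded_linear (\<lambda>h. to_bfun (\<lambda>t. val h (\<sigma> t)))"
    by (rule bounded_linear_bfunI[of _ 1]) (auto simp: norm_val_le)
  then show ?thesis
    by (simp add: pull_def bounded_linear_Blinfun_apply val_to_bfun'[OF norm_val_le])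
qed

lemma operator_group_pull:
  assumes "id \<in> \<Sigma>" "\<And>\<sigma> \<tau>. \<sigma> \<in> \<Sigma> \<Longrightarrow> \<tau> \<in> \<Sigma> \<Longrightarrow> \<sigma> \<circ> \<tau> \<in> \<Sigma>"
    and "\<And>\<sigma>. \<sigma> \<in> \<Sigma> \<Longrightarrow> \<exists>\<tau>\<in>\<Sigma>. \<sigma> \<circ> \<tau> = id \<and> \<tau> \<circ> \<sigma> = id"
  shows "operator_group (pull ` \<Sigma>) 1"
proof -
  have comp: "pull \<sigma> o\<^sub>L pull \<tau> = pull (\<tau> \<circ> \<sigma>)" for \<sigma> \<tau> :: "'a \<Rightarrow> 'a"
    by (intro blinfun_eqI bfun_eqI) simp
  have id: "pull id = (id_blinfun :: 'a bfun \<Rightarrow>\<^sub>L 'a bfun)"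
    by (intro blinfun_eqI bfun_eqI) simp
  show ?thesis
  proof
    show "id_blinfun \<in> pull ` \<Sigma>" using assms(1) id by (metis imageI)
    show "U o\<^sub>L V \<in> pull ` \<Sigma>" if "U \<in> pull ` \<Sigma>" "V \<in> pull ` \<Sigma>" for U V
      using that assms(2) by (auto simp: comp)
    show "\<exists>V\<in>pull ` \<Sigma>. V o\<^sub>L U = id_blinfun \<and> U o\<^sub>L V = id_blinfun" if U: "U \<in> pull ` \<Sigma>" for U
    proof -
      obtain \<sigma> where \<sigma>: "\<sigma> \<in> \<Sigma>" "U = pull \<sigma>" using U by blast
      obtain \<tau> where "\<tau> \<in> \<Sigma>" "\<sigma> \<circ> \<tau> = id" "\<tau> \<circ> \<sigma> = id" using assms(3)[OF \<sigma>(1)] by blast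
      then show ?thesis using \<sigma>(2) by (intro bexI[of _ "pull \<tau>"]) (auto simp: comp id)
    qed
    show "norm U \<le> 1" if "U \<in> pull ` \<Sigma>" for U
      using that by (auto intro!: norm_blinfun_bound norm_bfun_le simp: norm_val_le)
  qed simp
qed

subsection \<open>Uniqueness and existence of ergodic limits\<close>

context operator_group
begin

text \<open>The kernel \<open>f A B = \<phi> (A (B x))\<close> has columns that are images of the orbit of \<open>x\<close>, so its rows, the left
  translates of \<open>A \<mapsto> \<phi> (A x)\<close>, also form a relatively weakly compact set. The fixed point theorem for the
  left translations gives a left invariant function in their closed convex hull, that is, a constant.\<close>

lemma coefficient_nearly_constant:
  assumes count: "countable \<U>" and x: "rel_compact_orbit x"
    and \<phi>: "bounded_linear (\<phi> :: 'a \<Rightarrow> real)" "\<And>y. \<bar>\<phi> y\<bar> \<le> norm y" and \<delta>: "\<delta> > 0"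
  obtains S c where "S \<in> convex hull \<U>" "\<And>V. V \<in> \<U> \<Longrightarrow> \<bar>\<phi> (blinfun_apply S (blinfun_apply V x)) - c\<bar> \<le> \<delta>"
proof -
  obtain K where K: "compactin weak K" "orb x \<subseteq> K" using x by (auto simp: rel_compact_orbit_def)
  note lin = bounded_linear.linear[OF \<phi>(1)]
  define f where "f = (\<lambda>A B. if A \<in> \<U> \<and> B \<in> \<U> then complex_of_real (\<phi> (blinfun_apply A (blinfun_apply B x))) else 0)"
  define \<Theta> where "\<Theta> = (\<lambda>y A. if A \<in> \<U> then complex_of_real (\<phi> (blinfun_apply A y)) else 0)"
  have \<Theta>B: "norm (\<Theta> y A) \<le> C * norm y" for y A
    using \<phi>(2)[of "blinfun_apply A y"] norm_apply_le[of A y] C_pos by (auto simp: \<Theta>_def)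
  have fB: "norm (f A B) \<le> C * (C * norm x)" for A B
  proof (cases "A \<in> \<U> \<and> B \<in> \<U>")
    case True
    have "\<bar>\<phi> (blinfun_apply A (blinfun_apply B x))\<bar> \<le> C * norm (blinfun_apply B x)"
      using \<phi>(2) norm_apply_le True order_trans by blast
    also have "\<dots> \<le> C * (C * norm x)" using True C_pos by (intro mult_left_mono norm_apply_le) auto
    finally show ?thesis using True by (simp add: f_def)
  qed (use C_pos in \<open>auto simp: f_def\<close>)
  have vf: "val (to_bfun (f A)) B = f A B" for A B by (rule val_to_bfun'[OF fB])
  have bl\<Theta>: "bounded_linear (\<lambda>y. to_bfun (\<Theta> y))"
    by (rule bounded_linear_bfunI[OF _ _ \<Theta>B])
      (auto simp: \<Theta>_def blinfun.add_right blinfun.scaleR_right linear_add[OF lin] linear_scale[OF lin] scaleR_conv_of_real)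
  have cK1: "compactin weak ((\<lambda>y. to_bfun (\<Theta> y)) ` K \<union> {0})"
    by (intro compactin_Un image_compactin[OF K(1) continuous_map_weak_weak[OF bl\<Theta>]]) simp
  have mem: "to_bfun (\<lambda>A. f A B) \<in> (\<lambda>y. to_bfun (\<Theta> y)) ` K \<union> {0}" for B
  proof (cases "B \<in> \<U>")
    case True
    then have "(\<lambda>A. f A B) = \<Theta> (blinfun_apply B x)" by (auto simp: f_def \<Theta>_def)
    moreover have "blinfun_apply B x \<in> K" using True K(2) by (auto simp: orb_def)
    ultimately show ?thesis by auto
  next
    case False
    then have "to_bfun (\<lambda>A. f A B) = 0" by (intro bfun_eqI) (simp add: f_def val_to_bfun'[of _ 0])
    then show ?thesis by simp
  qed
  obtain K' where K': "compactin weak K'" "\<And>A. to_bfun (f A) \<in> K'"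
    by (rule weakly_compact_transpose[OF cK1 mem fB]) (rule that)
  define \<sigma> where "\<sigma> = (\<lambda>U B. if B \<in> \<U> then U o\<^sub>L B else B)"
  have id_o: "id_blinfun o\<^sub>L a = a" and o_id: "a o\<^sub>L id_blinfun = a" for a :: "'a \<Rightarrow>\<^sub>L 'a"
    by (rule blinfun_eqI, simp)+
  have assoc: "(a o\<^sub>L b) o\<^sub>L c = a o\<^sub>L (b o\<^sub>L c)" for a b c :: "'a \<Rightarrow>\<^sub>L 'a"
    by (rule blinfun_eqI) simp
  have \<sigma>_comp: "\<sigma> U \<circ> \<sigma> V = \<sigma> (U o\<^sub>L V)" if "V \<in> \<U>" for U V
    using that comp_mem by (auto simp: \<sigma>_def fun_eq_iff assoc)
  have \<sigma>_id: "\<sigma> id_blinfun = id" by (auto simp: \<sigma>_def fun_eq_iff id_o)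
  interpret P: operator_group "pull ` (\<sigma> ` \<U>)" 1
  proof (rule operator_group_pull)
    show "id \<in> \<sigma> ` \<U>" using id_mem \<sigma>_id by (metis imageI)
    show "s \<circ> t \<in> \<sigma> ` \<U>" if "s \<in> \<sigma> ` \<U>" "t \<in> \<sigma> ` \<U>" for s t
      using that comp_mem by (auto simp: \<sigma>_comp)
    show "\<exists>t\<in>\<sigma> ` \<U>. s \<circ> t = id \<and> t \<circ> s = id" if s: "s \<in> \<sigma> ` \<U>" for s
    proof -
      obtain U where U: "U \<in> \<U>" "s = \<sigma> U" using s by blast
      obtain V where "V \<in> \<U>" "V o\<^sub>L U = id_blinfun" "U o\<^sub>L V = id_blinfun" using inv_mem[OF U(1)] by blast
      then show ?thesis using U by (intro bexI[of _ "\<sigma> V"]) (auto simp: \<sigma>_comp \<sigma>_id)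
    qed
  qed
  define h0 where "h0 = to_bfun (f id_blinfun)"
  have pull_h0: "blinfun_apply (pull (\<sigma> U)) h0 = to_bfun (f U)" if "U \<in> \<U>" for U
  proof (rule bfun_eqI)
    show "val (blinfun_apply (pull (\<sigma> U)) h0) t = val (to_bfun (f U)) t" for t
      unfolding h0_def val_pull vf using that comp_mem id_mem by (auto simp: \<sigma>_def f_def)
  qed
  have "P.orb h0 \<subseteq> K'" using K'(2) pull_h0 by (auto simp: P.orb_def)
  then obtain h where h: "h \<in> closure (convex hull (P.orb h0))"
    "\<And>U. U \<in> pull ` (\<sigma> ` \<U>) \<Longrightarrow> blinfun_apply U h = h"
    using P.countable_group_fixed_point[OF _ K'(1)] count by (metis countable_image)
  define c where "c = val h id_blinfun"
  have const: "val h U = c" if U: "U \<in> \<U>" for U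
  proof -
    have "val (blinfun_apply (pull (\<sigma> U)) h) id_blinfun = c" using h(2) U by (simp add: c_def)
    then show ?thesis using id_mem by (simp add: \<sigma>_def o_id)
  qed
  let ?R = "{g. \<exists>S\<in>convex hull \<U>. \<forall>V\<in>\<U>. val g V = complex_of_real (\<phi> (blinfun_apply S (blinfun_apply V x)))}"
  have "convex hull (P.orb h0) \<subseteq> ?R"
  proof (rule hull_minimal)
    show "P.orb h0 \<subseteq> ?R"
    proof
      fix g assume "g \<in> P.orb h0"
      then obtain U where U: "U \<in> \<U>" "g = to_bfun (f U)" using pull_h0 by (auto simp: P.orb_def)
      have "val g V = complex_of_real (\<phi> (blinfun_apply U (blinfun_apply V x)))" if "V \<in> \<U>" for V
        unfolding U(2) vf using U(1) that by (simp add: f_def)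
      then show "g \<in> ?R" using hull_inc[OF U(1), of convex] by blast
    qed
    show "convex ?R"
    proof (rule convexI)
      fix g g' and u v :: real assume g: "g \<in> ?R" "g' \<in> ?R" and uv: "0 \<le> u" "0 \<le> v" "u + v = 1"
      obtain S S' where S: "S \<in> convex hull \<U>" "\<forall>V\<in>\<U>. val g V = complex_of_real (\<phi> (blinfun_apply S (blinfun_apply V x)))"
        and S': "S' \<in> convex hull \<U>" "\<forall>V\<in>\<U>. val g' V = complex_of_real (\<phi> (blinfun_apply S' (blinfun_apply V x)))"
        using g by blast
      have "u *\<^sub>R S + v *\<^sub>R S' \<in> convex hull \<U>"
        using S(1) S'(1) uv by (intro convexD[OF convex_convex_hull])
      moreover have "\<forall>V\<in>\<U>. val (u *\<^sub>R g + v *\<^sub>R g') V =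
          complex_of_real (\<phi> (blinfun_apply (u *\<^sub>R S + v *\<^sub>R S') (blinfun_apply V x)))"
        using S(2) S'(2)
        by (simp add: blinfun.add_left blinfun.scaleR_left linear_add[OF lin] linear_scale[OF lin] scaleR_conv_of_real)
      ultimately show "u *\<^sub>R g + v *\<^sub>R g' \<in> ?R" by blast
    qed
  qed
  moreover obtain g where g: "g \<in> convex hull (P.orb h0)" "dist g h < \<delta>"
    using h(1) \<delta> closure_approachable by blast
  ultimately obtain S where S: "S \<in> convex hull \<U>"
    "\<And>V. V \<in> \<U> \<Longrightarrow> val g V = complex_of_real (\<phi> (blinfun_apply S (blinfun_apply V x)))" by blast
  show thesis
  proof (rule that[OF S(1), of "Re c"])
    fix V assume V: "V \<in> \<U>"
    have "norm (val (g - h) V) \<le> \<delta>" using norm_val_le[of "g - h" V] g(2) by (simp add: dist_norm)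
    then have "\<bar>Re (val g V - val h V)\<bar> \<le> \<delta>" using abs_Re_le_cmod order_trans by fastforce
    then show "\<bar>\<phi> (blinfun_apply S (blinfun_apply V x)) - Re c\<bar> \<le> \<delta>"
      using S(2)[OF V] const[OF V] by simp
  qed
qed

text \<open>Both fixed points are compared with the constant \<open>c\<close>: if \<open>R x\<close> is near a fixed point \<open>r\<close>, then so is
  \<open>S (R x)\<close>, and \<open>\<phi> (S (R x))\<close> is near \<open>c\<close>. Each approximation uses finitely many operators, so the comparison
  takes place in a countable subgroup, where such \<open>S\<close> and \<open>c\<close> exist.\<close>

lemma ergodic_limit_unique:
  assumes x: "rel_compact_orbit x" and p: "ergodic_limit \<U> x p" and q: "ergodic_limit \<U> x q"
  shows "p = q"
proof -
  obtain \<phi> :: "'a \<Rightarrow> real" where \<phi>: "bounded_linear \<phi>" "\<phi> (p - q) = norm (p - q)" "\<And>y. \<bar>\<phi> y\<bar> \<le> norm y"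
    by (rule norming_functional[of "p - q"]) (rule that)
  note lin = bounded_linear.linear[OF \<phi>(1)]
  have small: "norm (p - q) \<le> 2 * (1 + C) * \<delta>" if \<delta>: "\<delta> > 0" for \<delta>
  proof -
    obtain T where T: "T \<in> convex hull \<U>" "norm (blinfun_apply T x - p) < \<delta>"
      using p \<delta> unfolding ergodic_limit_def by blast
    obtain T' where T': "T' \<in> convex hull \<U>" "norm (blinfun_apply T' x - q) < \<delta>"
      using q \<delta> unfolding ergodic_limit_def by blast
    obtain F where F: "finite F" "F \<subseteq> \<U>" "T \<in> convex hull F" using convex_hull_finite_subset[OF T(1)] by metis
    obtain F' where F': "finite F'" "F' \<subseteq> \<U>" "T' \<in> convex hull F'" using convex_hull_finite_subset[OF T'(1)] by metis
    obtain \<V> where V: "F \<union> F' \<subseteq> \<V>" "\<V> \<subseteq> \<U>" "countable \<V>" "operator_group \<V> C"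
      by (rule countable_subgroup[of "F \<union> F'"]) (use F F' in \<open>auto intro: countable_finite\<close>)
    interpret V: operator_group \<V> C by (rule V(4))
    obtain S c where S: "S \<in> convex hull \<V>"
      "\<And>V. V \<in> \<V> \<Longrightarrow> \<bar>\<phi> (blinfun_apply S (blinfun_apply V x)) - c\<bar> \<le> \<delta>"
      by (rule V.coefficient_nearly_constant[OF V(3) rel_compact_orbit_subgroup[OF x V(2,4)] \<phi>(1,3) \<delta>]) (rule that)
    have near: "\<bar>\<phi> r - c\<bar> \<le> (1 + C) * \<delta>"
      if R: "R \<in> convex hull \<V>" "norm (blinfun_apply R x - r) < \<delta>" and r: "\<And>V. V \<in> \<V> \<Longrightarrow> blinfun_apply V r = r" for R r
    proof -
      have "linear (\<lambda>R. \<phi> (blinfun_apply S (blinfun_apply R x)))"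
        by (intro linearI)
          (simp_all add: blinfun.add_left blinfun.add_right blinfun.scaleR_left blinfun.scaleR_right linear_add[OF lin] linear_scale[OF lin])
      then have "convex ((\<lambda>R. \<phi> (blinfun_apply S (blinfun_apply R x))) -` cball c \<delta>)"
        by (rule convex_linear_vimage) (rule convex_cball)
      then have "convex hull \<V> \<subseteq> (\<lambda>R. \<phi> (blinfun_apply S (blinfun_apply R x))) -` cball c \<delta>"
        using S(2) by (intro hull_minimal) (auto simp: dist_real_def abs_minus_commute)
      then have 1: "\<bar>\<phi> (blinfun_apply S (blinfun_apply R x)) - c\<bar> \<le> \<delta>"
        using R(1) by (auto simp: dist_real_def abs_minus_commute)
      have "blinfun_apply S r = r" by (rule V.hull_fixed[OF r S(1)])
      then have "\<phi> (blinfun_apply S (blinfun_apply R x)) - \<phi> r = \<phi> (blinfun_apply S (blinfun_apply R x - r))"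
        by (simp add: blinfun.diff_right linear_diff[OF lin])
      moreover have "\<bar>\<phi> (blinfun_apply S (blinfun_apply R x - r))\<bar> \<le> C * norm (blinfun_apply R x - r)"
        using \<phi>(3) V.norm_hull_apply_le[OF S(1)] order_trans by blast
      moreover have "C * norm (blinfun_apply R x - r) \<le> C * \<delta>" using R(2) C_pos by (intro mult_left_mono) auto
      ultimately show ?thesis using 1 by (simp add: distrib_right)
    qed
    have sub: "convex hull F \<subseteq> convex hull \<V>" "convex hull F' \<subseteq> convex hull \<V>" using V(1) by (auto intro!: hull_mono)
    have "\<bar>\<phi> p - c\<bar> \<le> (1 + C) * \<delta>"
      by (rule near[of T]) (use F(3) sub T(2) V(2) p in \<open>auto simp: ergodic_limit_def\<close>)
    moreover have "\<bar>\<phi> q - c\<bar> \<le> (1 + C) * \<delta>"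
      by (rule near[of T']) (use F'(3) sub T'(2) V(2) q in \<open>auto simp: ergodic_limit_def\<close>)
    moreover have "norm (p - q) = \<phi> p - \<phi> q" using \<phi>(2) linear_diff[OF lin, of p q] by simp
    ultimately show ?thesis by (simp add: algebra_simps)
  qed
  show ?thesis
  proof (rule ccontr)
    assume "p \<noteq> q"
    then have "norm (p - q) > 0" by simp
    then have "norm (p - q) \<le> 2 * (1 + C) * (norm (p - q) / (4 * (1 + C)))"
      using C_pos by (intro small divide_pos_pos) auto
    also have "\<dots> = norm (p - q) / 2" using C_pos by (simp add: field_simps)
    finally show False using \<open>norm (p - q) > 0\<close> by simp
  qed
qed

lemma ergodic_limit_translate:
  assumes x: "rel_compact_orbit x" and T: "T \<in> convex hull \<U>" and p: "ergodic_limit \<U> x p"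
    and r: "ergodic_limit \<U> (blinfun_apply T x) r"
  shows "ergodic_limit \<U> (blinfun_apply T x) p"
  using ergodic_limit_unique[OF x p ergodic_limit_from_translate[OF T r]] r by simp

end

context operator_group
begin

lemma nearly_maximal_displacement:
  obtains U where "U \<in> \<U>" "\<And>U'. U' \<in> \<U> \<Longrightarrow> norm (blinfun_apply U' p - p) \<le> 2 * norm (blinfun_apply U p - p)"
proof -
  define D where "D = (\<lambda>U. norm (blinfun_apply U p - p)) ` \<U>"
  have "norm (blinfun_apply U p - p) \<le> C * norm p + norm p" if "U \<in> \<U>" for U
    using norm_triangle_ineq4[of "blinfun_apply U p" p] norm_apply_le[OF that, of p] by linarith
  then have bdd: "bdd_above D" unfolding D_def by (intro bdd_aboveI2)
  have up: "norm (blinfun_apply U p - p) \<le> Sup D" if "U \<in> \<U>" for U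
    using that unfolding D_def by (intro cSup_upper bdd[unfolded D_def]) auto
  show thesis
  proof (cases "Sup D \<le> 0")
    case True
    show ?thesis
    proof (rule that[OF id_mem])
      show "norm (blinfun_apply U' p - p) \<le> 2 * norm (blinfun_apply id_blinfun p - p)" if "U' \<in> \<U>" for U'
        using order_trans[OF up[OF that] True] by simp
    qed
  next
    case False
    then have "Sup D / 2 < Sup D" by simp
    moreover have "D \<noteq> {}" using id_mem by (auto simp: D_def)
    ultimately have "\<exists>d\<in>D. Sup D / 2 < d" by (meson less_cSupD)
    then obtain U where U: "U \<in> \<U>" "Sup D / 2 < norm (blinfun_apply U p - p)" unfolding D_def by blast
    show ?thesis
    proof (rule that[OF U(1)])
      show "norm (blinfun_apply U' p - p) \<le> 2 * norm (blinfun_apply U p - p)" if "U' \<in> \<U>" for U'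
        using up[OF that] U(2) by linarith
    qed
  qed
qed

lemma union_chain_operator_group:
  fixes \<V> :: "nat \<Rightarrow> ('a \<Rightarrow>\<^sub>L 'a) set"
  assumes V: "\<And>n. \<V> n \<subseteq> \<U>" "\<And>n. operator_group (\<V> n) C" and mono: "\<And>m n. m \<le> n \<Longrightarrow> \<V> m \<subseteq> \<V> n"
  shows "operator_group (\<Union>n. \<V> n) C"
proof
  show "id_blinfun \<in> (\<Union>n. \<V> n)" using operator_group.id_mem[OF V(2)[of 0]] by blast
  show "A o\<^sub>L B \<in> (\<Union>n. \<V> n)" if AB: "A \<in> (\<Union>n. \<V> n)" "B \<in> (\<Union>n. \<V> n)" for A B
  proof -
    obtain m n where "A \<in> \<V> m" "B \<in> \<V> n" using AB by blast
    then have "A \<in> \<V> (max m n)" "B \<in> \<V> (max m n)" using mono by (meson max.cobounded1 max.cobounded2 subsetD)+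
    then show ?thesis using operator_group.comp_mem[OF V(2)] by blast
  qed
  show "\<exists>B\<in>\<Union>n. \<V> n. B o\<^sub>L A = id_blinfun \<and> A o\<^sub>L B = id_blinfun" if "A \<in> (\<Union>n. \<V> n)" for A
    using that operator_group.inv_mem[OF V(2)] by blast
  show "norm A \<le> C" if "A \<in> (\<Union>n. \<V> n)" for A using that V(1) bound by blast
qed (rule C_pos)

text \<open>Countable subgroups \<open>\<V> n\<close> are enlarged by an operator \<open>U\<close> that nearly maximises the displacement of the
  fixed point \<open>P (\<V> n)\<close>. These points converge to the fixed point \<open>p\<close> of the union, because a convex
  combination that brings \<open>x\<close> near \<open>p\<close> has finite support and so already lives in some \<open>\<V> n\<close>. As each \<open>U\<close>
  fixes \<open>p\<close>, the maximal displacements tend to zero, and \<open>p\<close> is fixed by the whole group.\<close>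

lemma ergodic_limit_exists:
  assumes x: "rel_compact_orbit x"
  obtains p where "ergodic_limit \<U> x p"
proof -
  define sub where "sub = (\<lambda>\<V>. \<V> \<subseteq> \<U> \<and> countable \<V> \<and> operator_group \<V> C)"
  define P where "P = (\<lambda>\<V>. SOME p. ergodic_limit \<V> x p)"
  have orbV: "operator_group.rel_compact_orbit \<V> y" if "sub \<V>" "rel_compact_orbit y" for \<V> y
    using that rel_compact_orbit_subgroup by (auto simp: sub_def)
  have ex: "\<exists>p. ergodic_limit \<V> y p" if V: "sub \<V>" and y: "rel_compact_orbit y" for \<V> y
  proof -
    have og: "operator_group \<V> C" and c: "countable \<V>" using V by (auto simp: sub_def)
    show ?thesis by (rule operator_group.countable_ergodic_limit[OF og c orbV[OF V y]]) blast
  qed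
  have P: "ergodic_limit \<V> x (P \<V>)" if "sub \<V>" for \<V>
    unfolding P_def using ex[OF that x] by (rule someI_ex)
  \<comment> \<open>Enlarge countable subgroups by an operator that nearly maximises the displacement of their limit.\<close>
  have "\<exists>\<V>. \<forall>n. sub (\<V> n) \<and> (\<V> n \<subseteq> \<V> (Suc n) \<and> (\<exists>U\<in>\<V> (Suc n). \<forall>U'\<in>\<U>.
      norm (blinfun_apply U' (P (\<V> n)) - P (\<V> n)) \<le> 2 * norm (blinfun_apply U (P (\<V> n)) - P (\<V> n))))"
  proof (rule dependent_nat_choice)
    obtain \<V> where "{} \<subseteq> \<V>" "\<V> \<subseteq> \<U>" "countable \<V>" "operator_group \<V> C"
      by (rule countable_subgroup[of "{}"]) auto
    then show "\<exists>\<V>. sub \<V>" by (auto simp: sub_def)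
  next
    fix \<V> n assume V: "sub \<V>"
    obtain U where U: "U \<in> \<U>" "\<And>U'. U' \<in> \<U> \<Longrightarrow>
        norm (blinfun_apply U' (P \<V>) - P \<V>) \<le> 2 * norm (blinfun_apply U (P \<V>) - P \<V>)"
      by (rule nearly_maximal_displacement[of "P \<V>"]) (rule that)
    obtain \<W> where W: "insert U \<V> \<subseteq> \<W>" "\<W> \<subseteq> \<U>" "countable \<W>" "operator_group \<W> C"
      by (rule countable_subgroup[of "insert U \<V>"]) (use V U in \<open>auto simp: sub_def\<close>)
    show "\<exists>\<W>. sub \<W> \<and> (\<V> \<subseteq> \<W> \<and> (\<exists>U\<in>\<W>. \<forall>U'\<in>\<U>.
        norm (blinfun_apply U' (P \<V>) - P \<V>) \<le> 2 * norm (blinfun_apply U (P \<V>) - P \<V>)))"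
    proof (intro exI[of _ \<W>] conjI bexI[of _ U] ballI)
      show "sub \<W>" using W by (simp add: sub_def)
    qed (use W U in auto)
  qed
  then obtain \<V> where V: "\<And>n. sub (\<V> n)" "\<And>n. \<V> n \<subseteq> \<V> (Suc n)"
    "\<And>n. \<exists>U\<in>\<V> (Suc n). \<forall>U'\<in>\<U>.
      norm (blinfun_apply U' (P (\<V> n)) - P (\<V> n)) \<le> 2 * norm (blinfun_apply U (P (\<V> n)) - P (\<V> n))"
    by blast
  have mono: "\<V> m \<subseteq> \<V> n" if "m \<le> n" for m n using lift_Suc_mono_le[of \<V>, OF V(2) that] .
  define \<W> where "\<W> = (\<Union>n. \<V> n)"
  have subW: "sub \<W>"
    using V(1) union_chain_operator_group[of \<V>] mono unfolding sub_def \<W>_def by (auto simp: countable_UN)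
  have VW: "\<V> n \<subseteq> \<W>" for n by (auto simp: \<W>_def)
  define p where "p = P \<W>"
  have p: "ergodic_limit \<W> x p" using P[OF subW] by (simp add: p_def)
  have conv: "\<exists>n. norm (P (\<V> n) - p) \<le> (C + 1) * \<delta>" if \<delta>: "\<delta> > 0" for \<delta>
  proof -
    obtain T where T: "T \<in> convex hull \<W>" "norm (blinfun_apply T x - p) < \<delta>"
      using p \<delta> unfolding ergodic_limit_def by blast
    obtain F where F: "finite F" "F \<subseteq> \<W>" "T \<in> convex hull F" using convex_hull_finite_subset[OF T(1)] by metis
    have "\<exists>n. F \<subseteq> \<V> n"
      using F(1,2)
    proof (induction F)
      case (insert U F)
      then obtain m n where "F \<subseteq> \<V> m" "U \<in> \<V> n" by (auto simp: \<W>_def)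
      then have "insert U F \<subseteq> \<V> (max m n)" using mono[of m "max m n"] mono[of n "max m n"] by auto
      then show ?case by blast
    qed auto
    then obtain n where "F \<subseteq> \<V> n" by blast
    then have Tn: "T \<in> convex hull (\<V> n)" using F(3) hull_mono by blast
    interpret V: operator_group "\<V> n" C using V(1)[of n] by (simp add: sub_def)
    have TU: "T \<in> convex hull \<U>" using Tn V(1)[of n] hull_mono unfolding sub_def by blast
    obtain r where r: "ergodic_limit (\<V> n) (blinfun_apply T x) r"
      using ex[OF V(1) rel_compact_orbit_hull[OF x TU]] by blast
    have "ergodic_limit (\<V> n) (blinfun_apply T x) (P (\<V> n))"
      by (rule V.ergodic_limit_translate[OF orbV[OF V(1) x] Tn P[OF V(1)] r])
    then obtain S where S: "S \<in> convex hull (\<V> n)" "norm (blinfun_apply S (blinfun_apply T x) - P (\<V> n)) < \<delta>"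
      using \<delta> unfolding ergodic_limit_def by blast
    have "blinfun_apply S p = p"
      by (rule V.hull_fixed[OF _ S(1)]) (use p VW in \<open>auto simp: ergodic_limit_def\<close>)
    then have "norm (blinfun_apply S (blinfun_apply T x) - p) \<le> C * norm (blinfun_apply T x - p)"
      using V.norm_hull_apply_le[OF S(1), of "blinfun_apply T x - p"] by (simp add: blinfun.diff_right)
    also have "\<dots> \<le> C * \<delta>" using T(2) C_pos by (intro mult_left_mono) auto
    finally have "norm (blinfun_apply S (blinfun_apply T x) - p) \<le> C * \<delta>" .
    moreover have "norm (P (\<V> n) - p) \<le> norm (blinfun_apply S (blinfun_apply T x) - P (\<V> n)) +
        norm (blinfun_apply S (blinfun_apply T x) - p)"
      using norm_triangle_ineq4[of "blinfun_apply S (blinfun_apply T x) - p" "blinfun_apply S (blinfun_apply T x) - P (\<V> n)"]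
      by simp
    ultimately have "norm (P (\<V> n) - p) \<le> (C + 1) * \<delta>" using S(2) by (simp add: distrib_right)
    then show ?thesis by blast
  qed
  have fixp: "blinfun_apply U' p = p" if U': "U' \<in> \<U>" for U'
  proof (rule ccontr)
    assume ne: "blinfun_apply U' p \<noteq> p"
    define d where "d = norm (blinfun_apply U' p - p)"
    \<comment> \<open>chosen so that the three displacements estimated below add up to \<open>d / 2\<close>\<close>
    define \<delta> where "\<delta> = d / (6 * (C + 1) * (C + 1))"
    have C1: "C + 1 > 0" using C_pos by simp
    have d: "d > 0" using ne by (simp add: d_def)
    then have \<delta>: "\<delta> > 0" unfolding \<delta>_def using C1 by (intro divide_pos_pos mult_pos_pos) auto
    obtain n where n: "norm (P (\<V> n) - p) \<le> (C + 1) * \<delta>" using conv[OF \<delta>] by blast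
    define q where "q = P (\<V> n)"
    have move: "norm (blinfun_apply U (q - p) - (q - p)) \<le> (C + 1) * ((C + 1) * \<delta>)" if "U \<in> \<U>" for U
    proof -
      have "norm (blinfun_apply U (q - p) - (q - p)) \<le> C * norm (q - p) + norm (q - p)"
        using norm_triangle_ineq4[of "blinfun_apply U (q - p)" "q - p"] norm_apply_le[OF that, of "q - p"] by linarith
      also have "\<dots> = (C + 1) * norm (q - p)" by (simp add: distrib_right)
      also have "\<dots> \<le> (C + 1) * ((C + 1) * \<delta>)" using n C1 by (intro mult_left_mono) (auto simp: q_def)
      finally show ?thesis .
    qed
    obtain U where U: "U \<in> \<V> (Suc n)" "\<And>U'. U' \<in> \<U> \<Longrightarrow> norm (blinfun_apply U' q - q) \<le> 2 * norm (blinfun_apply U q - q)"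
      using V(3)[of n] unfolding q_def by blast
    have UU: "U \<in> \<U>" using U(1) V(1)[of "Suc n"] by (auto simp: sub_def)
    have "blinfun_apply U p = p" using p U(1) VW by (auto simp: ergodic_limit_def)
    then have 1: "norm (blinfun_apply U q - q) \<le> (C + 1) * ((C + 1) * \<delta>)"
      using move[OF UU] by (simp add: blinfun.diff_right)
    have 2: "norm (blinfun_apply U' q - q) \<le> 2 * norm (blinfun_apply U q - q)" by (rule U(2)[OF U'])
    have "d \<le> norm (blinfun_apply U' q - q) + norm (blinfun_apply U' (q - p) - (q - p))"
      unfolding d_def
      using norm_triangle_ineq4[of "blinfun_apply U' q - q" "blinfun_apply U' (q - p) - (q - p)"]
      by (simp add: blinfun.diff_right)
    also have "\<dots> \<le> 3 * ((C + 1) * ((C + 1) * \<delta>))" using 1 2 move[OF U'] by linarith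
    also have "\<dots> = d / 2"
    proof -
      have "3 * (b * (b * (d / (6 * b * b)))) = d / 2" if "b > 0" for b :: real
        using that by (simp add: field_simps)
      from this[OF C1] show ?thesis by (simp only: \<delta>_def)
    qed
    finally show False using d by simp
  qed
  have "convex hull \<W> \<subseteq> convex hull \<U>" using subW by (intro hull_mono) (auto simp: sub_def)
  then have "ergodic_limit \<U> x p"
    using p fixp unfolding ergodic_limit_def by blast
  then show thesis by (rule that)
qed

definition mean :: "'a \<Rightarrow> 'a" where
  "mean x = (THE p. ergodic_limit \<U> x p)"

lemma ergodic_limit_mean:
  assumes x: "rel_compact_orbit x" shows "ergodic_limit \<U> x (mean x)"
proof -
  obtain p where p: "ergodic_limit \<U> x p" by (rule ergodic_limit_exists[OF x]) (rule that)
  show ?thesis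
    unfolding mean_def
    by (rule theI[where P = "ergodic_limit \<U> x", OF p]) (rule ergodic_limit_unique[OF x _ p])
qed

lemma mean_eqI: "rel_compact_orbit x \<Longrightarrow> ergodic_limit \<U> x p \<Longrightarrow> mean x = p"
  using ergodic_limit_mean ergodic_limit_unique by blast

lemma mean_invariant: "rel_compact_orbit x \<Longrightarrow> U \<in> \<U> \<Longrightarrow> blinfun_apply U (mean x) = mean x"
  using ergodic_limit_mean by (auto simp: ergodic_limit_def)

lemma mean_fixed:
  assumes "\<And>U. U \<in> \<U> \<Longrightarrow> blinfun_apply U p = p" shows "mean p = p"
proof (rule mean_eqI)
  show "rel_compact_orbit p" by (rule rel_compact_orbit_fixed[OF assms])
  show "ergodic_limit \<U> p p"
    using assms hull_inc[OF id_mem, of convex] unfolding ergodic_limit_def by (auto intro!: bexI[of _ id_blinfun])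
qed

lemma norm_mean_le:
  assumes x: "rel_compact_orbit x" shows "norm (mean x) \<le> C * norm x"
proof (rule field_le_epsilon)
  fix e :: real assume "e > 0"
  then obtain T where T: "T \<in> convex hull \<U>" "norm (blinfun_apply T x - mean x) < e"
    using ergodic_limit_mean[OF x] unfolding ergodic_limit_def by blast
  show "norm (mean x) \<le> C * norm x + e"
    using norm_hull_apply_le[OF T(1), of x] T(2) norm_triangle_sub[of "mean x" "blinfun_apply T x"]
    by (simp add: norm_minus_commute)
qed

lemma mean_translate:
  assumes x: "rel_compact_orbit x" and T: "T \<in> convex hull \<U>"
  shows "ergodic_limit \<U> (blinfun_apply T x) (mean x)"
  by (rule ergodic_limit_translate[OF x T ergodic_limit_mean[OF x] ergodic_limit_mean[OF rel_compact_orbit_hull[OF x T]]])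

text \<open>The vectors are treated one after another: averaging further does not spoil earlier approximations,
  because \<open>mean\<close> takes fixed vectors as values, and by uniqueness \<open>mean\<close> is the same for \<open>x\<close> and for \<open>T x\<close>.\<close>

lemma mean_simultaneous:
  assumes "finite X" "\<And>x. x \<in> X \<Longrightarrow> rel_compact_orbit x" "\<delta> > 0"
  shows "\<exists>T\<in>convex hull \<U>. \<forall>x\<in>X. norm (blinfun_apply T x - mean x) < \<delta>"
  using assms
proof (induction X arbitrary: \<delta>)
  case empty
  then show ?case using hull_inc[OF id_mem, of convex] by blast
next
  case (insert x X)
  obtain T where T: "T \<in> convex hull \<U>" "\<And>y. y \<in> X \<Longrightarrow> norm (blinfun_apply T y - mean y) < \<delta> / C"
    using insert.IH[of "\<delta> / C"] insert.prems C_pos by auto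
  obtain S where S: "S \<in> convex hull \<U>" "norm (blinfun_apply S (blinfun_apply T x) - mean x) < \<delta>"
    using mean_translate[OF _ T(1), of x] insert.prems unfolding ergodic_limit_def by auto
  have "norm (blinfun_apply (S o\<^sub>L T) y - mean y) < \<delta>" if y: "y \<in> X" for y
  proof -
    have "blinfun_apply S (mean y) = mean y"
      using insert.prems y by (intro hull_fixed[OF _ S(1)] mean_invariant) auto
    then have "norm (blinfun_apply (S o\<^sub>L T) y - mean y) \<le> C * norm (blinfun_apply T y - mean y)"
      using norm_hull_apply_le[OF S(1), of "blinfun_apply T y - mean y"] by (simp add: blinfun.diff_right)
    also have "\<dots> < C * (\<delta> / C)" using T(2)[OF y] C_pos by (intro mult_strict_left_mono)
    finally show ?thesis using C_pos by simp
  qed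
  then show ?case using S hull_compose[OF S(1) T(1)] by (intro bexI[of _ "S o\<^sub>L T"]) auto
qed

lemma mean_add:
  assumes x: "rel_compact_orbit x" and y: "rel_compact_orbit y"
  shows "mean (x + y) = mean x + mean y"
proof (rule mean_eqI[OF rel_compact_orbit_add[OF x y]])
  show "ergodic_limit \<U> (x + y) (mean x + mean y)"
    unfolding ergodic_limit_def
  proof (intro conjI ballI allI impI)
    show "blinfun_apply U (mean x + mean y) = mean x + mean y" if "U \<in> \<U>" for U
      using that x y by (simp add: blinfun.add_right mean_invariant)
    fix e :: real assume "e > 0"
    then obtain T where "T \<in> convex hull \<U>" and T: "\<forall>z\<in>{x, y}. norm (blinfun_apply T z - mean z) < e / 2"
      using mean_simultaneous[of "{x, y}" "e / 2"] x y by auto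
    moreover have "norm (blinfun_apply T (x + y) - (mean x + mean y)) < e"
      using T norm_triangle_ineq[of "blinfun_apply T x - mean x" "blinfun_apply T y - mean y"]
      by (simp add: blinfun.add_right algebra_simps)
    ultimately show "\<exists>T\<in>convex hull \<U>. norm (blinfun_apply T (x + y) - (mean x + mean y)) < e" by blast
  qed
qed

lemma mean_commute:
  assumes x: "rel_compact_orbit x" and S: "bounded_linear S"
    and left: "\<And>U. U \<in> \<U> \<Longrightarrow> \<exists>U'\<in>\<U>. \<forall>z. blinfun_apply U (S z) = S (blinfun_apply U' z)"
    and right: "\<And>U. U \<in> \<U> \<Longrightarrow> \<exists>U'\<in>\<U>. \<forall>z. S (blinfun_apply U z) = blinfun_apply U' (S z)"
  shows "mean (S x) = S (mean x)" "rel_compact_orbit (S x)"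
proof -
  note lin = bounded_linear.linear[OF S]
  show Sx: "rel_compact_orbit (S x)"
    using left by (intro rel_compact_orbit_image[OF x S]) blast
  show "mean (S x) = S (mean x)"
  proof (rule mean_eqI[OF Sx])
    show "ergodic_limit \<U> (S x) (S (mean x))"
      unfolding ergodic_limit_def
    proof (intro conjI ballI allI impI)
      fix U assume "U \<in> \<U>"
      then obtain U' where "U' \<in> \<U>" "\<forall>z. blinfun_apply U (S z) = S (blinfun_apply U' z)" using left by blast
      then show "blinfun_apply U (S (mean x)) = S (mean x)" using mean_invariant[OF x] by simp
    next
      fix e :: real assume e: "e > 0"
      have hull: "convex hull \<U> \<subseteq> {T. \<exists>T'\<in>convex hull \<U>. \<forall>z. S (blinfun_apply T z) = blinfun_apply T' (S z)}" (is "_ \<subseteq> ?R")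
      proof (rule hull_minimal)
        show "\<U> \<subseteq> ?R" using right hull_inc[of _ \<U> convex] by blast
        show "convex ?R"
        proof (rule convexI)
          fix A B and u v :: real assume A: "A \<in> ?R" and B: "B \<in> ?R" and uv: "0 \<le> u" "0 \<le> v" "u + v = 1"
          obtain A' where A': "A' \<in> convex hull \<U>" "\<forall>z. S (blinfun_apply A z) = blinfun_apply A' (S z)" using A by blast
          obtain B' where B': "B' \<in> convex hull \<U>" "\<forall>z. S (blinfun_apply B z) = blinfun_apply B' (S z)" using B by blast
          have "u *\<^sub>R A' + v *\<^sub>R B' \<in> convex hull \<U>"
            using A'(1) B'(1) uv by (intro convexD[OF convex_convex_hull])
          moreover have "\<forall>z. S (blinfun_apply (u *\<^sub>R A + v *\<^sub>R B) z) = blinfun_apply (u *\<^sub>R A' + v *\<^sub>R B') (S z)"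
            using A'(2) B'(2) by (simp add: blinfun.add_left blinfun.scaleR_left linear_add[OF lin] linear_scale[OF lin])
          ultimately show "u *\<^sub>R A + v *\<^sub>R B \<in> ?R" by blast
        qed
      qed
      obtain K where K: "K > 0" "\<And>z. norm (S z) \<le> norm z * K" using bounded_linear.pos_bounded[OF S] by blast
      obtain T where T: "T \<in> convex hull \<U>" "norm (blinfun_apply T x - mean x) < e / K"
        using ergodic_limit_mean[OF x] e K(1) unfolding ergodic_limit_def by (meson divide_pos_pos)
      obtain T' where T': "T' \<in> convex hull \<U>" "\<forall>z. S (blinfun_apply T z) = blinfun_apply T' (S z)"
        using T(1) hull by blast
      have "norm (blinfun_apply T' (S x) - S (mean x)) = norm (S (blinfun_apply T x - mean x))"
        using T'(2) by (simp add: linear_diff[OF lin])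
      also have "\<dots> \<le> norm (blinfun_apply T x - mean x) * K" by (rule K)
      also have "\<dots> < e" using T(2) K(1) by (simp add: field_simps)
      finally show "\<exists>T\<in>convex hull \<U>. norm (blinfun_apply T (S x) - S (mean x)) < e" using T'(1) by blast
    qed
  qed
qed

lemma mean_scaleR:
  assumes "rel_compact_orbit x" shows "mean (r *\<^sub>R x) = r *\<^sub>R mean x"
  by (rule mean_commute(1)[OF assms bounded_linear_scaleR_right]) (auto simp: blinfun.scaleR_right)

end

lemma (in operator_group) subspace_rel_compact_orbit: "subspace {x. rel_compact_orbit x}"
  using rel_compact_orbit_fixed[of 0] rel_compact_orbit_add rel_compact_orbit_scaleR
  by (auto simp: subspace_def)

text \<open>Each functional \<open>\<phi> \<circ> mean\<close> is bounded and linear on the subspace on which \<open>mean\<close> is meaningful, so it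
  extends to a functional on the whole space.\<close>

lemma (in operator_group) continuous_map_mean:
  "continuous_map (subtopology weak {x. rel_compact_orbit x}) weak mean"
  unfolding continuous_map_into_initial_topology
proof (intro conjI ballI)
  fix \<phi> :: "'a \<Rightarrow> real" assume "\<phi> \<in> {\<phi>. bounded_linear \<phi>}"
  then have \<phi>: "bounded_linear \<phi>" by simp
  note lin = bounded_linear.linear[OF \<phi>]
  obtain K where K: "K > 0" "\<And>x. norm (\<phi> x) \<le> norm x * K"
    using bounded_linear.pos_bounded[OF \<phi>] by blast
  obtain \<psi> :: "'a \<Rightarrow> real" where \<psi>: "bounded_linear \<psi>" "\<And>x. x \<in> {x. rel_compact_orbit x} \<Longrightarrow> \<psi> x = \<phi> (mean x)"
  proof (rule functional_extension[OF subspace_rel_compact_orbit, where g = "\<lambda>x. \<phi> (mean x)" and K = "K * C"])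
    fix x assume "x \<in> {x. rel_compact_orbit x}"
    then have "norm (mean x) \<le> C * norm x" by (simp add: norm_mean_le)
    then have "norm (mean x) * K \<le> C * norm x * K" using K(1) by (intro mult_right_mono) auto
    then show "\<bar>\<phi> (mean x)\<bar> \<le> K * C * norm x" using K(2)[of "mean x"] by (simp add: algebra_simps)
  qed (use that in \<open>auto simp: mean_add mean_scaleR linear_add[OF lin] linear_scale[OF lin]\<close>)
  have "continuous_map (subtopology weak {x. rel_compact_orbit x}) euclidean \<psi>"
    by (intro continuous_map_from_subtopology continuous_map_weak_functional \<psi>)
  then show "continuous_map (subtopology weak {x. rel_compact_orbit x}) euclidean (\<lambda>x. \<phi> (mean x))"
    by (rule continuous_map_eq) (auto simp: \<psi>)
qed auto

section \<open>Bounded continuous functions inside the bounded functions\<close>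

lemma continuous_map_complex:
  assumes "continuous_map X euclidean (\<lambda>x. Re (f x))" "continuous_map X euclidean (\<lambda>x. Im (f x))"
  shows "continuous_map X euclidean f"
proof -
  have c: "continuous_map euclidean euclidean (\<lambda>r. complex_of_real r)"
    "continuous_map euclidean euclidean (\<lambda>r. \<i> * complex_of_real r)"
    by (simp_all add: continuous_intros)
  have "continuous_map X euclidean (\<lambda>x. complex_of_real (Re (f x)) + \<i> * complex_of_real (Im (f x)))"
    using continuous_map_compose[OF assms(1) c(1)] continuous_map_compose[OF assms(2) c(2)]
    by (intro continuous_map_add) (simp_all add: o_def)
  then show ?thesis by (simp add: complex_eq[symmetric])
qed

lemma bounded_continuous_bounded:
  assumes "u \<in> bounded_continuous S" shows "bounded (range u)"
proof -
  have "range u \<subseteq> u ` topspace S \<union> {0}" using assms by (auto simp: bounded_continuous_def)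
  moreover have "bounded (u ` topspace S \<union> {0})" using assms by (simp add: bounded_continuous_def)
  ultimately show ?thesis by (rule bounded_subset[rotated])
qed

lemma val_to_bfun_bc: "u \<in> bounded_continuous S \<Longrightarrow> val (to_bfun u) = u"
  by (rule ext) (simp add: val_to_bfun bounded_continuous_bounded)

lemma bounded_continuous_add:
  assumes "u \<in> bounded_continuous S" "v \<in> bounded_continuous S" shows "u + v \<in> bounded_continuous S"
proof -
  have "bounded (range u)" "bounded (range v)" using assms by (auto intro: bounded_continuous_bounded)
  then have "bounded (range (u + v))" unfolding plus_fun_def by (rule bounded_plus_comp)
  then have "bounded ((u + v) ` topspace S)" by (rule bounded_subset) auto
  with assms show ?thesis by (auto simp: bounded_continuous_def plus_fun_def intro: continuous_map_add)
qed

lemma bounded_continuous_scaleC: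
  assumes "u \<in> bounded_continuous S" shows "c *\<^sub>C u \<in> bounded_continuous S"
proof -
  have b: "bounded (range u)" using assms by (rule bounded_continuous_bounded)
  have "bounded (range (\<lambda>x. c * u x))"
    using bounded_linear_image[OF b bounded_linear_mult_right[of c]] by (simp add: image_comp o_def)
  then have "bounded ((\<lambda>x. c * u x) ` topspace S)" by (rule bounded_subset) auto
  moreover have "continuous_map S euclidean (\<lambda>x. c * u x)"
  proof -
    have "continuous_map euclidean euclidean (\<lambda>z. c * z)" by (simp add: continuous_intros)
    moreover have "continuous_map S euclidean u" using assms by (simp add: bounded_continuous_def)
    ultimately have "continuous_map S euclidean ((\<lambda>z. c * z) \<circ> u)" by (intro continuous_map_compose)
    then show ?thesis by (simp add: o_def)
  qed
  ultimately show ?thesis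
    using assms by (auto simp: bounded_continuous_def scaleC_fun_def scaleC_complex_def)
qed

lemma zero_in_bounded_continuous: "0 \<in> bounded_continuous S"
  by (auto simp: bounded_continuous_def zero_fun_def intro: bounded_subset[of "{0}"])

abbreviation bc_bfun :: "'t topology \<Rightarrow> 't bfun set" where
  "bc_bfun S \<equiv> {h. val h \<in> bounded_continuous S}"

lemma val_add_fun: "val (g + h) = val g + val h"
  and val_scaleR_fun: "val (r *\<^sub>R h) = complex_of_real r *\<^sub>C val h"
  and val_zero_fun: "val 0 = 0"
  by (auto simp: fun_eq_iff scaleC_fun_def scaleC_complex_def scaleR_conv_of_real)

lemma subspace_bc_bfun: "subspace (bc_bfun S)"
  unfolding subspace_def
  by (auto simp: val_add_fun val_scaleR_fun val_zero_fun zero_in_bounded_continuous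
      intro: bounded_continuous_add bounded_continuous_scaleC)

lemma closed_bc_bfun: "closed (bc_bfun S :: 't bfun set)"
proof -
  have "h \<in> bc_bfun S" if h: "h \<in> closure (bc_bfun S)" for h :: "'t bfun"
  proof -
    have approx: "\<exists>g\<in>bc_bfun S. \<forall>t. dist (val g t) (val h t) < e" if "e > 0" for e
    proof -
      obtain g where "g \<in> bc_bfun S" "dist g h < e" using h \<open>e > 0\<close> closure_approachable by blast
      then show ?thesis using norm_val_le[of "g - h"]
        by (intro bexI[of _ g]) (auto simp: dist_norm intro: le_less_trans)
    qed
    have "continuous_map S euclidean (val h)"
      unfolding continuous_map_def
    proof (intro conjI allI impI)
      fix U :: "complex set" assume "openin euclidean U"
      then have U: "open U" by simp
      show "openin S {x \<in> topspace S. val h x \<in> U}"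
      proof (subst openin_subopen, intro ballI)
        fix x assume x: "x \<in> {x \<in> topspace S. val h x \<in> U}"
        then obtain e where e: "e > 0" "ball (val h x) e \<subseteq> U" using U openE by blast
        obtain g where g: "val g \<in> bounded_continuous S" "\<And>t. dist (val g t) (val h t) < e / 3"
          using approx[of "e / 3"] e by auto
        let ?T = "{y \<in> topspace S. val g y \<in> ball (val g x) (e / 3)}"
        have "continuous_map S euclidean (val g)" using g(1) by (simp add: bounded_continuous_def)
        then have "openin S ?T" by (rule openin_continuous_map_preimage) simp
        moreover have "x \<in> ?T" using x e by simp
        moreover have "?T \<subseteq> {x \<in> topspace S. val h x \<in> U}"
        proof
          fix y assume "y \<in> ?T"
          then have y: "y \<in> topspace S" "val g y \<in> ball (val g x) (e / 3)" by auto
          have "dist (val h x) (val h y) \<le> dist (val h x) (val g x) + dist (val g x) (val g y) + dist (val g y) (val h y)"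
            using dist_triangle[of "val h x" "val h y" "val g x"] dist_triangle[of "val g x" "val h y" "val g y"] by linarith
          also have "\<dots> < e" using y(2) g(2)[of x] g(2)[of y] by (simp add: dist_commute)
          finally show "y \<in> {x \<in> topspace S. val h x \<in> U}" using e(2) y(1) by auto
        qed
        ultimately show "\<exists>T. openin S T \<and> x \<in> T \<and> T \<subseteq> {x \<in> topspace S. val h x \<in> U}" by blast
      qed
    qed auto
    moreover have "bounded (val h ` topspace S)" by (rule bounded_subset[OF bounded_range_val]) auto
    moreover have "val h x = 0" if x: "x \<notin> topspace S" for x
    proof (rule ccontr)
      assume "val h x \<noteq> 0"
      then have "norm (val h x) > 0" by simp
      then obtain g where "val g \<in> bounded_continuous S" "dist (val g x) (val h x) < norm (val h x)"
        using approx[of "norm (val h x)"] by blast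
      then show False using x by (simp add: bounded_continuous_def dist_norm)
    qed
    ultimately show ?thesis by (auto simp: bounded_continuous_def)
  qed
  then show ?thesis by (meson closure_subset_eq subsetI)
qed

lemma norm_to_bfun_bc:
  assumes u: "u \<in> bounded_continuous S" and ne: "topspace S \<noteq> {}"
  shows "norm (to_bfun u) = sup_norm S u"
proof (rule order_antisym)
  have bdd: "bdd_above ((\<lambda>x. cmod (u x)) ` topspace S)"
    using u bounded_imp_bdd_above[of "(\<lambda>x. cmod (u x)) ` topspace S"] bounded_norm_comp[of u "topspace S"]
    by (auto simp: bounded_continuous_def)
  have up: "cmod (u x) \<le> sup_norm S u" if "x \<in> topspace S" for x
    unfolding sup_norm_def using that by (intro cSUP_upper bdd)
  obtain x0 where "x0 \<in> topspace S" using ne by blast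
  then have 0: "0 \<le> sup_norm S u" using up norm_ge_zero order_trans by blast
  have "cmod (u x) \<le> sup_norm S u" for x
    using up[of x] 0 u by (cases "x \<in> topspace S") (auto simp: bounded_continuous_def)
  then show "norm (to_bfun u) \<le> sup_norm S u"
    by (intro norm_bfun_le) (simp add: val_to_bfun_bc[OF u])
  show "sup_norm S u \<le> norm (to_bfun u)"
    unfolding sup_norm_def
    using norm_val_le[of "to_bfun u"] by (intro cSUP_least ne) (simp add: val_to_bfun_bc[OF u])
qed

lemma to_bfun_add:
  "u \<in> bounded_continuous S \<Longrightarrow> v \<in> bounded_continuous S \<Longrightarrow> to_bfun (u + v) = to_bfun u + to_bfun v"
  by (rule bfun_eqI) (simp add: val_to_bfun_bc[where S = S] bounded_continuous_add)

lemma to_bfun_scaleC: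
  "u \<in> bounded_continuous S \<Longrightarrow> val (to_bfun (c *\<^sub>C u)) t = c * val (to_bfun u) t"
  using val_to_bfun_bc[OF bounded_continuous_scaleC[of u S c]] val_to_bfun_bc[of u S]
  by (simp add: scaleC_fun_def scaleC_complex_def)

definition cmult :: "complex \<Rightarrow> 't bfun \<Rightarrow> 't bfun" where
  "cmult c h = to_bfun (\<lambda>t. c * val h t)"

lemma norm_cmult_val: "norm (c * val h t) \<le> norm c * norm h"
  by (simp add: norm_mult norm_val_le mult_left_mono)

lemma val_cmult [simp]: "val (cmult c h) t = c * val h t"
  unfolding cmult_def by (rule val_to_bfun'[OF norm_cmult_val])

lemma bounded_linear_cmult: "bounded_linear (cmult c)"
  unfolding cmult_def
  by (rule bounded_linear_bfunI[OF _ _ norm_cmult_val]) (auto simp: algebra_simps)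

lemma to_bfun_scaleC_eq: "u \<in> bounded_continuous S \<Longrightarrow> to_bfun (c *\<^sub>C u) = cmult c (to_bfun u)"
  by (rule bfun_eqI) (simp add: to_bfun_scaleC)

text \<open>The next two lemmas identify the weak topology of the complex normed space of bounded continuous
  functions with the one induced by the real space of all bounded functions: restriction of functionals
  gives one direction, extension of their real and imaginary parts the other.\<close>

lemma continuous_map_to_bfun:
  assumes ne: "topspace S \<noteq> {}"
  shows "continuous_map (weak_topology (bounded_continuous S) (sup_norm S)) weak to_bfun"
  unfolding continuous_map_into_initial_topology
proof (intro conjI ballI)
  fix \<psi> :: "'a bfun \<Rightarrow> real" assume "\<psi> \<in> {\<psi>. bounded_linear \<psi>}"
  then have \<psi>: "bounded_linear \<psi>" by simp
  note lin = bounded_linear.linear[OF \<psi>]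
  let ?V = "bounded_continuous S"
  obtain K where K: "K > 0" "\<And>x. norm (\<psi> x) \<le> norm x * K"
    using bounded_linear.pos_bounded[OF \<psi>] by blast
  \<comment> \<open>the complex linear functional with real part \<open>\<psi>\<close>\<close>
  define \<Phi> where "\<Phi> = (\<lambda>u. Complex (\<psi> (to_bfun u)) (- \<psi> (cmult \<i> (to_bfun u))))"
  have cm: "cmult c h = Re c *\<^sub>R h + Im c *\<^sub>R cmult \<i> h" for c and h :: "'a bfun"
    by (rule bfun_eqI) (simp add: complex_eq_iff algebra_simps)
  have cm2: "cmult \<i> (cmult c h) = cmult (\<i> * c) h" for c and h :: "'a bfun"
    by (rule bfun_eqI) simp
  have \<psi>c: "\<psi> (cmult c h) = Re c * \<psi> h + Im c * \<psi> (cmult \<i> h)" for c h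
    by (subst cm) (simp add: linear_add[OF lin] linear_scale[OF lin])
  have "\<Phi> \<in> dual_space ?V (sup_norm S)"
    unfolding dual_space_def bounded_clinear_on_def
  proof (intro CollectI conjI ballI allI exI[of _ "2 * K"])
    fix u v assume uv: "u \<in> ?V" "v \<in> ?V"
    then show "\<Phi> (u + v) = \<Phi> u + \<Phi> v"
      using linear_add[OF bounded_linear.linear[OF bounded_linear_cmult[of \<i>]], of "to_bfun u" "to_bfun v"]
      by (simp add: \<Phi>_def to_bfun_add linear_add[OF lin] complex_eq_iff)
  next
    fix c u assume u: "u \<in> ?V"
    show "\<Phi> (c *\<^sub>C u) = c *\<^sub>C \<Phi> u"
      using u by (simp add: \<Phi>_def to_bfun_scaleC_eq cm2 \<psi>c[of c] \<psi>c[of "\<i> * c"] complex_eq_iff scaleC_complex_def)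
  next
    fix u assume u: "u \<in> ?V"
    have n: "norm (to_bfun u) = sup_norm S u" by (rule norm_to_bfun_bc[OF u ne])
    have "norm (cmult \<i> (to_bfun u)) \<le> norm (to_bfun u)"
      using norm_cmult_val[of \<i> "to_bfun u"] by (intro norm_bfun_le) simp
    then have "norm (cmult \<i> (to_bfun u)) * K \<le> sup_norm S u * K" using n K(1) by (intro mult_right_mono) auto
    then have "\<bar>\<psi> (cmult \<i> (to_bfun u))\<bar> \<le> K * sup_norm S u" using K(2)[of "cmult \<i> (to_bfun u)"] by (simp add: mult.commute)
    moreover have "\<bar>\<psi> (to_bfun u)\<bar> \<le> K * sup_norm S u" using K(2)[of "to_bfun u"] n by (simp add: mult.commute)
    moreover have "cmod (\<Phi> u) \<le> \<bar>Re (\<Phi> u)\<bar> + \<bar>Im (\<Phi> u)\<bar>" by (rule cmod_le)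
    ultimately show "cmod (\<Phi> u) \<le> 2 * K * sup_norm S u" by (simp add: \<Phi>_def)
  qed
  then have "continuous_map (weak_topology ?V (sup_norm S)) euclidean \<Phi>"
    unfolding weak_topology_def by (rule continuous_map_from_initial_topology)
  moreover have "continuous_map euclidean euclidean Re" by (simp add: continuous_intros)
  ultimately have "continuous_map (weak_topology ?V (sup_norm S)) euclidean (Re \<circ> \<Phi>)" by (rule continuous_map_compose)
  then show "continuous_map (weak_topology ?V (sup_norm S)) euclidean (\<lambda>u. \<psi> (to_bfun u))"
    by (simp add: o_def \<Phi>_def)
qed auto

lemma continuous_map_val_bc:
  assumes ne: "topspace S \<noteq> {}"
  shows "continuous_map (subtopology weak (bc_bfun S)) (weak_topology (bounded_continuous S) (sup_norm S)) val"
  unfolding weak_topology_def continuous_map_into_initial_topology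
proof (intro conjI ballI)
  let ?V = "bounded_continuous S"
  fix \<phi> assume \<phi>: "\<phi> \<in> dual_space ?V (sup_norm S)"
  then obtain K where add: "\<And>u v. u \<in> ?V \<Longrightarrow> v \<in> ?V \<Longrightarrow> \<phi> (u + v) = \<phi> u + \<phi> v"
    and scale: "\<And>c u. u \<in> ?V \<Longrightarrow> \<phi> (c *\<^sub>C u) = c *\<^sub>C \<phi> u" and K: "\<And>u. u \<in> ?V \<Longrightarrow> cmod (\<phi> u) \<le> K * sup_norm S u"
    unfolding dual_space_def bounded_clinear_on_def by blast
  have part: "continuous_map (subtopology weak (bc_bfun S)) euclidean (\<lambda>h. r (\<phi> (val h)))"
    if r: "\<And>z w. r (z + w) = r z + r w" "\<And>a z. r (complex_of_real a * z) = a * r z" "\<And>z. \<bar>r z\<bar> \<le> cmod z"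
    for r :: "complex \<Rightarrow> real"
  proof -
    obtain \<psi> :: "'a bfun \<Rightarrow> real" where \<psi>: "bounded_linear \<psi>" "\<And>h. h \<in> bc_bfun S \<Longrightarrow> \<psi> h = r (\<phi> (val h))"
    proof (rule functional_extension[OF subspace_bc_bfun, where g = "\<lambda>h. r (\<phi> (val h))" and K = K])
      fix h assume "h \<in> bc_bfun S"
      then have h: "val h \<in> ?V" by simp
      have "sup_norm S (val h) = norm h" using norm_to_bfun_bc[OF h ne] by (simp add: to_bfun_val)
      then show "\<bar>r (\<phi> (val h))\<bar> \<le> K * norm h" using K[OF h] r(3)[of "\<phi> (val h)"] by simp
    qed (use that r in \<open>auto simp: val_add_fun val_scaleR_fun add scale scaleC_complex_def\<close>)
    have "continuous_map (subtopology weak (bc_bfun S)) euclidean \<psi>"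
      by (intro continuous_map_from_subtopology continuous_map_weak_functional \<psi>)
    then show ?thesis by (rule continuous_map_eq) (auto simp: \<psi>)
  qed
  show "continuous_map (subtopology weak (bc_bfun S)) euclidean (\<lambda>h. \<phi> (val h))"
    by (intro continuous_map_complex part) (auto simp: abs_Re_le_cmod abs_Im_le_cmod)
qed auto

lemma Hausdorff_weak_bc:
  assumes ne: "topspace S \<noteq> {}"
  shows "Hausdorff_space (weak_topology (bounded_continuous S) (sup_norm S))"
  unfolding weak_topology_def
proof (rule Hausdorff_initial_topology)
  let ?V = "bounded_continuous S"
  fix u v assume uv: "u \<in> ?V" "v \<in> ?V" "u \<noteq> v"
  then obtain t where "u t \<noteq> v t" by auto
  moreover have "(\<lambda>u. u t) \<in> dual_space ?V (sup_norm S)"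
    unfolding dual_space_def bounded_clinear_on_def
  proof (intro CollectI conjI ballI allI exI[of _ 1])
    fix u assume u: "u \<in> ?V"
    show "cmod (u t) \<le> 1 * sup_norm S u"
      using norm_val_le[of "to_bfun u" t] norm_to_bfun_bc[OF u ne] by (simp add: val_to_bfun_bc[OF u])
  qed (auto simp: scaleC_fun_def)
  ultimately show "\<exists>f\<in>dual_space ?V (sup_norm S). f u \<noteq> f v" by (intro bexI[of _ "\<lambda>u. u t"])
qed

lemma rel_compact_bc_iff:
  assumes ne: "topspace S \<noteq> {}" and A: "A \<subseteq> bounded_continuous S"
  shows "compactin (weak_topology (bounded_continuous S) (sup_norm S))
      (weak_topology (bounded_continuous S) (sup_norm S) closure_of A) \<longleftrightarrow>
    (\<exists>K. compactin weak K \<and> to_bfun ` A \<subseteq> K)" (is "compactin ?W (?W closure_of A) \<longleftrightarrow> ?R")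
proof
  assume c: "compactin ?W (?W closure_of A)"
  have "A \<subseteq> ?W closure_of A" using A by (intro closure_of_subset) (simp add: weak_topology_def)
  then have "to_bfun ` A \<subseteq> to_bfun ` (?W closure_of A)" by blast
  moreover have "compactin weak (to_bfun ` (?W closure_of A))"
    by (rule image_compactin[OF c continuous_map_to_bfun[OF ne]])
  ultimately show ?R by blast
next
  assume ?R
  then obtain K where K: "compactin weak K" "to_bfun ` A \<subseteq> K" by blast
  let ?J = "K \<inter> bc_bfun S"
  have cl: "closedin weak (bc_bfun S)"
    by (intro closedin_weak_closed_convex closed_bc_bfun subspace_imp_convex subspace_bc_bfun)
  have "closedin weak ?J" by (rule closedin_Int[OF compactin_weak_imp_closedin[OF K(1)] cl])
  then have "compactin weak ?J" by (rule closed_compactin[OF K(1) Int_lower1])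
  then have "compactin (subtopology weak (bc_bfun S)) ?J" by (simp add: compactin_subtopology)
  then have c: "compactin ?W (val ` ?J)" by (rule image_compactin[OF _ continuous_map_val_bc[OF ne]])
  have "A \<subseteq> val ` ?J"
  proof
    fix u assume u: "u \<in> A"
    then have "val (to_bfun u) = u" using A by (intro val_to_bfun_bc) auto
    then show "u \<in> val ` ?J" using u K(2) A by (intro image_eqI[of _ _ "to_bfun u"]) auto
  qed
  then have "?W closure_of A \<subseteq> val ` ?J"
    by (intro closure_of_minimal compactin_imp_closedin[OF Hausdorff_weak_bc[OF ne] c])
  then show "compactin ?W (?W closure_of A)" by (intro closed_compactin[OF c]) auto
qed

section \<open>Weakly almost periodic functions as vectors with weakly compact orbits\<close>

locale semitopological_group = group G for G :: "('g, 'm) monoid_scheme" (structure) +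
  fixes T :: "'g topology"
  assumes topspace_carrier: "topspace T = carrier G"
    and continuous_left: "s \<in> carrier G \<Longrightarrow> continuous_map T T (\<lambda>t. s \<otimes> t)"
    and continuous_right: "s \<in> carrier G \<Longrightarrow> continuous_map T T (\<lambda>t. t \<otimes> s)"
begin

text \<open>The shifts are the identity off the group, so that they are bijections of the type and the composition
  operators with them form a group.\<close>

definition lshift :: "'g \<Rightarrow> 'g \<Rightarrow> 'g" where
  "lshift s t = (if t \<in> carrier G then s \<otimes> t else t)"

definition rshift :: "'g \<Rightarrow> 'g \<Rightarrow> 'g" where
  "rshift s t = (if t \<in> carrier G then t \<otimes> s else t)"

lemma operator_group_lshift:
  assumes N: "subgroup N G" shows "operator_group (pull ` lshift ` N) 1"
proof (rule operator_group_pull)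
  have NG: "N \<subseteq> carrier G" using N by (rule subgroup.subset)
  have comp: "lshift s \<circ> lshift t = lshift (s \<otimes> t)" if "s \<in> carrier G" "t \<in> carrier G" for s t
    using that by (auto simp: fun_eq_iff lshift_def m_assoc)
  have one: "lshift \<one> = id" by (auto simp: fun_eq_iff lshift_def)
  show "id \<in> lshift ` N" using subgroup.one_closed[OF N] one by (metis imageI)
  show "\<sigma> \<circ> \<tau> \<in> lshift ` N" if "\<sigma> \<in> lshift ` N" "\<tau> \<in> lshift ` N" for \<sigma> \<tau>
    using that NG subgroup.m_closed[OF N] by (auto simp: comp subset_iff)
  show "\<exists>\<tau>\<in>lshift ` N. \<sigma> \<circ> \<tau> = id \<and> \<tau> \<circ> \<sigma> = id" if \<sigma>: "\<sigma> \<in> lshift ` N" for \<sigma>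
  proof -
    obtain s where s: "s \<in> N" "\<sigma> = lshift s" using \<sigma> by blast
    have "s \<in> carrier G" "inv s \<in> N" using s(1) NG subgroup.m_inv_closed[OF N] by auto
    then show ?thesis using s NG by (intro bexI[of _ "lshift (inv s)"]) (auto simp: comp one subset_iff)
  qed
qed

sublocale L: operator_group "pull ` lshift ` carrier G" 1
  by (rule operator_group_lshift[OF subgroup_self])

lemma topspace_nonempty: "topspace T \<noteq> {}"
  using one_closed by (auto simp: topspace_carrier)

lemma pull_lshift:
  assumes "u \<in> bounded_continuous T" "s \<in> carrier G"
  shows "left_translate G u s \<in> bounded_continuous T"
    "blinfun_apply (pull (lshift s)) (to_bfun u) = to_bfun (left_translate G u s)"
proof -
  have eq: "left_translate G u s = (\<lambda>t. u (lshift s t))"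
    using assms by (auto simp: fun_eq_iff left_translate_def zero_ext_def lshift_def bounded_continuous_def topspace_carrier)
  have "continuous_map T euclidean (u \<circ> (\<lambda>t. s \<otimes> t))"
    using assms by (intro continuous_map_compose[OF continuous_left]) (auto simp: bounded_continuous_def)
  then have "continuous_map T euclidean (left_translate G u s)"
    by (rule continuous_map_eq) (auto simp: left_translate_def zero_ext_def topspace_carrier)
  moreover have b: "bounded (range (left_translate G u s))"
    unfolding eq by (rule bounded_subset[OF bounded_continuous_bounded[OF assms(1)]]) auto
  moreover have "bounded (left_translate G u s ` topspace T)" by (rule bounded_subset[OF b]) auto
  ultimately show "left_translate G u s \<in> bounded_continuous T"
    by (auto simp: bounded_continuous_def left_translate_def zero_ext_def topspace_carrier)
  show "blinfun_apply (pull (lshift s)) (to_bfun u) = to_bfun (left_translate G u s)"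
    by (rule bfun_eqI) (simp add: val_to_bfun[OF b] val_to_bfun_bc[OF assms(1)], simp add: eq)
qed

lemma pull_rshift:
  assumes "u \<in> bounded_continuous T" "s \<in> carrier G"
  shows "right_translate G u s \<in> bounded_continuous T"
    "blinfun_apply (pull (rshift s)) (to_bfun u) = to_bfun (right_translate G u s)"
proof -
  have eq: "right_translate G u s = (\<lambda>t. u (rshift s t))"
    using assms by (auto simp: fun_eq_iff right_translate_def zero_ext_def rshift_def bounded_continuous_def topspace_carrier)
  have "continuous_map T euclidean (u \<circ> (\<lambda>t. t \<otimes> s))"
    using assms by (intro continuous_map_compose[OF continuous_right]) (auto simp: bounded_continuous_def)
  then have "continuous_map T euclidean (right_translate G u s)"
    by (rule continuous_map_eq) (auto simp: right_translate_def zero_ext_def topspace_carrier)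
  moreover have b: "bounded (range (right_translate G u s))"
    unfolding eq by (rule bounded_subset[OF bounded_continuous_bounded[OF assms(1)]]) auto
  moreover have "bounded (right_translate G u s ` topspace T)" by (rule bounded_subset[OF b]) auto
  ultimately show "right_translate G u s \<in> bounded_continuous T"
    by (auto simp: bounded_continuous_def right_translate_def zero_ext_def topspace_carrier)
  show "blinfun_apply (pull (rshift s)) (to_bfun u) = to_bfun (right_translate G u s)"
    by (rule bfun_eqI) (simp add: val_to_bfun[OF b] val_to_bfun_bc[OF assms(1)], simp add: eq)
qed

lemma wap_functions_iff:
  "u \<in> wap_functions G T \<longleftrightarrow> u \<in> bounded_continuous T \<and> L.rel_compact_orbit (to_bfun u)"
proof (cases "u \<in> bounded_continuous T")
  case True
  have "to_bfun ` left_translate G u ` carrier G = L.orb (to_bfun u)"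
    unfolding L.orb_def unfolding image_image by (rule image_cong) (simp_all add: pull_lshift(2)[OF True])
  moreover have "left_translate G u ` carrier G \<subseteq> bounded_continuous T" using pull_lshift(1)[OF True] by blast
  ultimately show ?thesis
    using True rel_compact_bc_iff[OF topspace_nonempty]
    by (simp add: wap_functions_def Let_def L.rel_compact_orbit_def)
qed (simp add: wap_functions_def)

lemma subspace_wap_functions: "complex_vector.subspace (wap_functions G T)"
  unfolding complex_vector.subspace_def
proof (intro conjI ballI allI)
  have "to_bfun 0 = (0 :: 'g bfun)"
    by (rule bfun_eqI) (simp add: val_to_bfun_bc[OF zero_in_bounded_continuous])
  then show "0 \<in> wap_functions G T"
    by (simp add: wap_functions_iff zero_in_bounded_continuous L.rel_compact_orbit_fixed)
  show "u + v \<in> wap_functions G T" if "u \<in> wap_functions G T" "v \<in> wap_functions G T" for u v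
    using that by (simp add: wap_functions_iff bounded_continuous_add to_bfun_add[where S = T] L.rel_compact_orbit_add)
  show "c *\<^sub>C u \<in> wap_functions G T" if "u \<in> wap_functions G T" for c u
  proof -
    have u: "u \<in> bounded_continuous T" "L.rel_compact_orbit (to_bfun u)" using that by (auto simp: wap_functions_iff)
    have "L.rel_compact_orbit (cmult c (to_bfun u))"
    proof (rule L.rel_compact_orbit_image[OF u(2) bounded_linear_cmult])
      show "\<exists>U'\<in>pull ` lshift ` carrier G. blinfun_apply U (cmult c (to_bfun u)) = cmult c (blinfun_apply U' (to_bfun u))"
        if "U \<in> pull ` lshift ` carrier G" for U
        using that by (intro bexI[of _ U]) (auto intro!: bfun_eqI)
    qed
    then show ?thesis using u(1) by (simp add: wap_functions_iff bounded_continuous_scaleC to_bfun_scaleC_eq)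
  qed
qed

lemma left_translate_wap:
  assumes "u \<in> wap_functions G T" "s \<in> carrier G" shows "left_translate G u s \<in> wap_functions G T"
proof -
  have u: "u \<in> bounded_continuous T" "L.rel_compact_orbit (to_bfun u)" using assms by (auto simp: wap_functions_iff)
  have "L.rel_compact_orbit (blinfun_apply (pull (lshift s)) (to_bfun u))"
    using assms(2) by (intro L.rel_compact_orbit_hull[OF u(2)] hull_inc) auto
  then show ?thesis using pull_lshift[OF u(1) assms(2)] by (simp add: wap_functions_iff)
qed

lemma right_translate_wap:
  assumes "u \<in> wap_functions G T" "s \<in> carrier G" shows "right_translate G u s \<in> wap_functions G T"
proof -
  have u: "u \<in> bounded_continuous T" "L.rel_compact_orbit (to_bfun u)" using assms by (auto simp: wap_functions_iff)
  have "L.rel_compact_orbit (blinfun_apply (pull (rshift s)) (to_bfun u))"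
  proof (rule L.rel_compact_orbit_image[OF u(2) blinfun.bounded_linear_right])
    fix U assume U: "U \<in> pull ` lshift ` carrier G"
    then show "\<exists>U'\<in>pull ` lshift ` carrier G. blinfun_apply U (blinfun_apply (pull (rshift s)) (to_bfun u)) =
        blinfun_apply (pull (rshift s)) (blinfun_apply U' (to_bfun u))"
      using assms(2) by (intro bexI[of _ U]) (auto intro!: bfun_eqI simp: lshift_def rshift_def m_assoc)
  qed
  then show ?thesis using pull_rshift[OF u(1) assms(2)] by (simp add: wap_functions_iff)
qed

end

section \<open>Weakly almost periodic functions on a quotient\<close>

lemma (in topological_group) semitopological: "semitopological_group G T"
proof (unfold_locales)
  show "topspace T = carrier G" by (rule topspace_eq)
  fix s assume s: "s \<in> carrier G"
  have "continuous_map T (prod_topology T T) (\<lambda>t. (s, t))" "continuous_map T (prod_topology T T) (\<lambda>t. (t, s))"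
    using s by (auto intro!: continuous_map_pairedI simp: topspace_eq)
  from this[THEN continuous_map_compose, OF continuous_mult]
  show "continuous_map T T (\<lambda>t. s \<otimes> t)" "continuous_map T T (\<lambda>t. t \<otimes> s)"
    by (simp_all add: o_def)
qed

locale topological_group_normal = topological_group G T + normal N G
  for G :: "('g, 'm) monoid_scheme" (structure) and T :: "'g topology" and N :: "'g set"
begin

sublocale semitopological_group G T by (rule semitopological)

lemma topspace_quotient: "topspace (quotient_group_topology G T N) = carrier (G Mod N)"
  using quotient_imp_surjective_map[OF quotient_map_quotient_group_topology[of N]]
  by (simp add: topspace_eq carrier_FactGroup)

lemma coset_mult: "s \<in> carrier G \<Longrightarrow> t \<in> carrier G \<Longrightarrow> (N #> s) \<otimes>\<^bsub>G Mod N\<^esub> (N #> t) = N #> (s \<otimes> t)"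
  by (simp add: rcos_sum)

lemma coset_closed: "s \<in> carrier G \<Longrightarrow> N #> s \<in> carrier (G Mod N)"
  by (auto simp: carrier_FactGroup)

sublocale Q: semitopological_group "G Mod N" "quotient_group_topology G T N"
proof (intro semitopological_group.intro semitopological_group_axioms.intro)
  let ?TQ = "quotient_group_topology G T N"
  show "group (G Mod N)" by (rule factorgroup_is_group)
  show "topspace ?TQ = carrier (G Mod N)" by (rule topspace_quotient)
  have q: "continuous_map T ?TQ (\<lambda>x. N #> x)"
    by (intro quotient_imp_continuous_map quotient_map_quotient_group_topology)
  fix R assume "R \<in> carrier (G Mod N)"
  then obtain s where s: "s \<in> carrier G" "R = N #> s" by (auto simp: carrier_FactGroup)
  have "continuous_map T ?TQ (\<lambda>t. N #> (s \<otimes> t))" "continuous_map T ?TQ (\<lambda>t. N #> (t \<otimes> s))"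
    using continuous_map_compose[OF continuous_left[OF s(1)] q] continuous_map_compose[OF continuous_right[OF s(1)] q]
    by (simp_all add: o_def)
  note cont = this
  have "continuous_map T ?TQ ((\<lambda>t. R \<otimes>\<^bsub>G Mod N\<^esub> t) \<circ> (\<lambda>x. N #> x))"
    by (rule continuous_map_eq[OF cont(1)]) (simp add: s coset_mult topspace_eq del: mult_FactGroup)
  moreover have "continuous_map T ?TQ ((\<lambda>t. t \<otimes>\<^bsub>G Mod N\<^esub> R) \<circ> (\<lambda>x. N #> x))"
    by (rule continuous_map_eq[OF cont(2)]) (simp add: s coset_mult topspace_eq del: mult_FactGroup)
  ultimately show "continuous_map ?TQ ?TQ (\<lambda>t. R \<otimes>\<^bsub>G Mod N\<^esub> t)" "continuous_map ?TQ ?TQ (\<lambda>t. t \<otimes>\<^bsub>G Mod N\<^esub> R)"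
    by (auto intro: continuous_compose_quotient_map[OF quotient_map_quotient_group_topology[of N]])
qed

definition coset_invariant :: "('g \<Rightarrow> complex) \<Rightarrow> bool" where
  "coset_invariant u \<longleftrightarrow> (\<forall>n\<in>N. \<forall>x\<in>carrier G. u (n \<otimes> x) = u x)"

definition lift :: "('g set \<Rightarrow> complex) \<Rightarrow> 'g \<Rightarrow> complex" where
  "lift v = zero_ext (carrier G) (\<lambda>x. v (N #> x))"

definition representative :: "'g set \<Rightarrow> 'g" where
  "representative R = (SOME x. x \<in> carrier G \<and> R = N #> x)"

definition descend :: "('g \<Rightarrow> complex) \<Rightarrow> 'g set \<Rightarrow> complex" where
  "descend u = zero_ext (carrier (G Mod N)) (\<lambda>R. u (representative R))"

lemma representative:
  assumes "R \<in> carrier (G Mod N)"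
  shows "representative R \<in> carrier G" "N #> representative R = R"
proof -
  have "\<exists>x. x \<in> carrier G \<and> R = N #> x" using assms by (auto simp: carrier_FactGroup)
  from someI_ex[OF this] show "representative R \<in> carrier G" "N #> representative R = R"
    by (auto simp: representative_def)
qed

lemma coset_invariant_representative:
  assumes u: "coset_invariant u" and x: "x \<in> carrier G"
  shows "u (representative (N #> x)) = u x"
proof -
  have "representative (N #> x) \<in> N #> x"
    using representative[OF coset_closed[OF x]] by (metis rcos_self subgroup_axioms)
  then obtain n where "n \<in> N" "representative (N #> x) = n \<otimes> x" by (auto simp: r_coset_def)
  with u x show ?thesis by (simp add: coset_invariant_def)
qed

lemma descend_coset:
  "coset_invariant u \<Longrightarrow> x \<in> carrier G \<Longrightarrow> descend u (N #> x) = u x"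
  by (simp add: descend_def zero_ext_def coset_closed coset_invariant_representative)

lemma lift_bounded_continuous:
  assumes v: "v \<in> bounded_continuous (quotient_group_topology G T N)"
  shows "lift v \<in> bounded_continuous T"
proof -
  have "continuous_map T (quotient_group_topology G T N) (\<lambda>x. N #> x)"
    by (intro quotient_imp_continuous_map quotient_map_quotient_group_topology)
  then have "continuous_map T euclidean (v \<circ> (\<lambda>x. N #> x))"
    using v by (intro continuous_map_compose) (auto simp: bounded_continuous_def)
  then have "continuous_map T euclidean (lift v)"
    by (rule continuous_map_eq) (simp add: lift_def zero_ext_def topspace_eq)
  moreover have "lift v ` topspace T \<subseteq> range v" by (auto simp: lift_def zero_ext_def topspace_eq)
  then have "bounded (lift v ` topspace T)" by (rule bounded_subset[OF bounded_continuous_bounded[OF v]])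
  ultimately show ?thesis by (auto simp: bounded_continuous_def lift_def zero_ext_def topspace_eq)
qed

lemma descend_bounded_continuous:
  assumes u: "u \<in> bounded_continuous T" and inv: "coset_invariant u"
  shows "descend u \<in> bounded_continuous (quotient_group_topology G T N)"
proof -
  have "continuous_map T euclidean (descend u \<circ> (\<lambda>x. N #> x))"
    by (rule continuous_map_eq[of _ _ u]) (use u inv in \<open>auto simp: bounded_continuous_def descend_coset topspace_eq\<close>)
  then have "continuous_map (quotient_group_topology G T N) euclidean (descend u)"
    by (rule continuous_compose_quotient_map[OF quotient_map_quotient_group_topology])
  moreover have "descend u ` topspace (quotient_group_topology G T N) \<subseteq> range u"
    by (auto simp: descend_def zero_ext_def topspace_quotient)
  then have "bounded (descend u ` topspace (quotient_group_topology G T N))"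
    by (rule bounded_subset[OF bounded_continuous_bounded[OF u]])
  ultimately show ?thesis by (auto simp: bounded_continuous_def descend_def zero_ext_def topspace_quotient)
qed

lemma lift_descend:
  assumes u: "u \<in> bounded_continuous T" and inv: "coset_invariant u"
  shows "lift (descend u) = u"
  using u inv by (auto simp: fun_eq_iff lift_def zero_ext_def descend_coset bounded_continuous_def topspace_eq)

lemma coset_invariant_lift: "coset_invariant (lift v)"
proof -
  have "N #> (n \<otimes> x) = N #> x" if "n \<in> N" "x \<in> carrier G" for n x
    using that by (metis coset_mult_assoc mem_carrier rcos_const subset is_group)
  then show ?thesis by (simp add: coset_invariant_def lift_def zero_ext_def)
qed

lemma lift_wap:
  assumes v: "v \<in> wap_functions (G Mod N) (quotient_group_topology G T N)"
  shows "lift v \<in> wap_functions G T"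
proof -
  have v': "v \<in> bounded_continuous (quotient_group_topology G T N)" "Q.L.rel_compact_orbit (to_bfun v)"
    using v by (auto simp: Q.wap_functions_iff)
  define E where "E = (\<lambda>h. to_bfun (\<lambda>x. if x \<in> carrier G then val h (N #> x) else 0))"
  have b: "norm (if x \<in> carrier G then val h (N #> x) else 0) \<le> 1 * norm h" for h :: "'g set bfun" and x
    by (simp add: norm_val_le)
  have vE: "val (E h) x = (if x \<in> carrier G then val h (N #> x) else 0)" for h x
    unfolding E_def by (rule val_to_bfun'[OF b])
  have E: "bounded_linear E"
    unfolding E_def by (rule bounded_linear_bfunI[OF _ _ b]) auto
  obtain K where K: "compactin weak K" "Q.L.orb (to_bfun v) \<subseteq> K" using v'(2) by (auto simp: Q.L.rel_compact_orbit_def)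
  have Ev: "E (to_bfun v) = to_bfun (lift v)"
  proof (rule bfun_eqI)
    show "val (E (to_bfun v)) t = val (to_bfun (lift v)) t" for t
      unfolding vE val_to_bfun_bc[OF v'(1)] val_to_bfun_bc[OF lift_bounded_continuous[OF v'(1)]]
      by (simp add: lift_def zero_ext_def)
  qed
  have "L.orb (to_bfun (lift v)) \<subseteq> E ` K"
  proof
    fix h assume "h \<in> L.orb (to_bfun (lift v))"
    then obtain s where s: "s \<in> carrier G" "h = blinfun_apply (pull (lshift s)) (E (to_bfun v))"
      by (auto simp: L.orb_def Ev)
    have "h = E (blinfun_apply (pull (Q.lshift (N #> s))) (to_bfun v))"
      unfolding s(2) using s(1)
      by (intro bfun_eqI) (auto simp: vE lshift_def Q.lshift_def coset_mult coset_closed simp del: mult_FactGroup)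
    moreover have "blinfun_apply (pull (Q.lshift (N #> s))) (to_bfun v) \<in> Q.L.orb (to_bfun v)"
      using s(1) coset_closed by (auto simp: Q.L.orb_def)
    ultimately show "h \<in> E ` K" using K(2) by blast
  qed
  moreover have "compactin weak (E ` K)" by (rule image_compactin[OF K(1) continuous_map_weak_weak[OF E]])
  ultimately show ?thesis
    using lift_bounded_continuous[OF v'(1)] by (auto simp: wap_functions_iff L.rel_compact_orbit_def)
qed

lemma descend_wap:
  assumes u: "u \<in> wap_functions G T" and inv: "coset_invariant u"
  shows "descend u \<in> wap_functions (G Mod N) (quotient_group_topology G T N)"
proof -
  have u': "u \<in> bounded_continuous T" "L.rel_compact_orbit (to_bfun u)" using u by (auto simp: wap_functions_iff)
  define D where "D = (\<lambda>h. to_bfun (\<lambda>R. if R \<in> carrier (G Mod N) then val h (representative R) else 0))"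
  have b: "norm (if R \<in> carrier (G Mod N) then val h (representative R) else 0) \<le> 1 * norm h" for h :: "'g bfun" and R
    by (simp add: norm_val_le)
  have vD: "val (D h) R = (if R \<in> carrier (G Mod N) then val h (representative R) else 0)" for h R
    unfolding D_def by (rule val_to_bfun'[OF b])
  have D: "bounded_linear D"
    unfolding D_def by (rule bounded_linear_bfunI[OF _ _ b]) auto
  obtain K where K: "compactin weak K" "L.orb (to_bfun u) \<subseteq> K" using u'(2) by (auto simp: L.rel_compact_orbit_def)
  have bc: "descend u \<in> bounded_continuous (quotient_group_topology G T N)"
    by (rule descend_bounded_continuous[OF u'(1) inv])
  have "Q.L.orb (to_bfun (descend u)) \<subseteq> D ` K"
  proof
    fix h assume "h \<in> Q.L.orb (to_bfun (descend u))"
    then obtain R where R: "R \<in> carrier (G Mod N)" "h = blinfun_apply (pull (Q.lshift R)) (to_bfun (descend u))"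
      by (auto simp: Q.L.orb_def)
    define s where "s = representative R"
    have s: "s \<in> carrier G" "R = N #> s" using representative[OF R(1)] by (auto simp: s_def)
    have "h = D (blinfun_apply (pull (lshift s)) (to_bfun u))"
    proof (rule bfun_eqI)
      fix X
      show "val h X = val (D (blinfun_apply (pull (lshift s)) (to_bfun u))) X"
      proof (cases "X \<in> carrier (G Mod N)")
        case True
        define x where "x = representative X"
        have x: "x \<in> carrier G" "X = N #> x" using representative[OF True] by (auto simp: x_def)
        have "val h X = descend u (R \<otimes>\<^bsub>G Mod N\<^esub> X)"
          using True by (simp add: R(2) val_to_bfun_bc[OF bc] Q.lshift_def del: mult_FactGroup)
        also have "\<dots> = u (s \<otimes> x)"
          using s x by (simp add: coset_mult descend_coset[OF inv] del: mult_FactGroup)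
        finally show ?thesis using True s x(1) by (simp add: vD x_def[symmetric] val_to_bfun_bc[OF u'(1)] lshift_def)
      next
        case False
        then have "val (to_bfun (descend u)) X = 0"
          unfolding val_to_bfun_bc[OF bc] by (simp add: descend_def zero_ext_def)
        with False show ?thesis by (simp add: R(2) Q.lshift_def vD del: mult_FactGroup)
      qed
    qed
    moreover have "blinfun_apply (pull (lshift s)) (to_bfun u) \<in> L.orb (to_bfun u)"
      using s(1) by (auto simp: L.orb_def)
    ultimately show "h \<in> D ` K" using K(2) by blast
  qed
  moreover have "compactin weak (D ` K)" by (rule image_compactin[OF K(1) continuous_map_weak_weak[OF D]])
  ultimately show ?thesis using bc by (auto simp: Q.wap_functions_iff Q.L.rel_compact_orbit_def)
qed

text \<open>Lifting and descending are inverse to each other between functions on \<open>G/N\<close> and functions on \<open>G\<close> that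
  are constant on cosets. Both are restrictions of bounded linear maps that intertwine the translations,
  so they preserve relative weak compactness of orbits.\<close>

lemma wap_functions_quotient_eq:
  "wap_functions_quotient G T N = {u \<in> wap_functions G T. coset_invariant u}"
proof -
  have "wap_functions_quotient G T N = lift ` wap_functions (G Mod N) (quotient_group_topology G T N)"
    by (simp add: wap_functions_quotient_def lift_def[abs_def])
  moreover have "u \<in> lift ` wap_functions (G Mod N) (quotient_group_topology G T N)"
    if "u \<in> wap_functions G T" "coset_invariant u" for u
    using descend_wap[OF that] lift_descend[of u] that by (metis image_eqI wap_functions_iff)
  ultimately show ?thesis using lift_wap coset_invariant_lift by auto
qed

lemma subspace_wap_functions_quotient: "complex_vector.subspace (wap_functions_quotient G T N)"
  using subspace_wap_functions
  by (auto simp: wap_functions_quotient_eq complex_vector.subspace_def coset_invariant_def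
      scaleC_fun_def plus_fun_def zero_fun_def)

lemma conj_move:
  assumes "n \<in> N" "s \<in> carrier G"
  obtains n' where "n' \<in> N" "s \<otimes> n = n' \<otimes> s"
proof (rule that)
  show "s \<otimes> n \<otimes> inv s \<in> N" by (rule inv_op_closed2[OF assms(2,1)])
  show "s \<otimes> n = s \<otimes> n \<otimes> inv s \<otimes> s" using assms by (simp add: m_assoc)
qed

lemma conj_move':
  assumes "n \<in> N" "s \<in> carrier G"
  obtains n' where "n' \<in> N" "n \<otimes> s = s \<otimes> n'"
proof (rule that)
  show "inv s \<otimes> n \<otimes> s \<in> N" by (rule inv_op_closed1[OF assms(2,1)])
  show "n \<otimes> s = s \<otimes> (inv s \<otimes> n \<otimes> s)" using assms by (simp add: m_assoc[symmetric])
qed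

lemma translation_invariant_wap_functions_quotient:
  "translation_invariant G (wap_functions_quotient G T N)"
  unfolding translation_invariant_def wap_functions_quotient_eq
proof (intro ballI conjI)
  fix u s assume "u \<in> {u \<in> wap_functions G T. coset_invariant u}" and s: "s \<in> carrier G"
  then have u: "u \<in> wap_functions G T" "coset_invariant u" by auto
  have "left_translate G u s (n \<otimes> x) = left_translate G u s x" if nx: "n \<in> N" "x \<in> carrier G" for n x
  proof -
    obtain n' where n': "n' \<in> N" "s \<otimes> n = n' \<otimes> s" by (rule conj_move[OF nx(1) s])
    have "s \<otimes> (n \<otimes> x) = n' \<otimes> (s \<otimes> x)" using n' s nx by (simp add: m_assoc[symmetric])
    then show ?thesis using u(2) n' s nx by (simp add: left_translate_def zero_ext_def coset_invariant_def)
  qed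
  then show "left_translate G u s \<in> {u \<in> wap_functions G T. coset_invariant u}"
    using left_translate_wap[OF u(1) s] by (simp add: coset_invariant_def)
  have "right_translate G u s (n \<otimes> x) = right_translate G u s x" if nx: "n \<in> N" "x \<in> carrier G" for n x
    using u(2) s nx by (simp add: right_translate_def zero_ext_def coset_invariant_def m_assoc)
  then show "right_translate G u s \<in> {u \<in> wap_functions G T. coset_invariant u}"
    using right_translate_wap[OF u(1) s] by (simp add: coset_invariant_def)
qed

sublocale NL: operator_group "pull ` lshift ` N" 1
  by (rule operator_group_lshift[OF subgroup_axioms])

lemma NL_rel_compact: "L.rel_compact_orbit h \<Longrightarrow> NL.rel_compact_orbit h"
  by (rule L.rel_compact_orbit_subgroup[OF _ _ NL.operator_group_axioms], assumption, intro image_mono subset)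

lemma mean_lshift:
  assumes h: "NL.rel_compact_orbit h" and s: "s \<in> carrier G"
  shows "NL.mean (blinfun_apply (pull (lshift s)) h) = blinfun_apply (pull (lshift s)) (NL.mean h)"
proof (rule NL.mean_commute(1)[OF h blinfun.bounded_linear_right])
  fix U assume "U \<in> pull ` lshift ` N"
  then obtain n where n: "n \<in> N" "U = pull (lshift n)" by blast
  obtain n' where n': "n' \<in> N" "s \<otimes> n = n' \<otimes> s" by (rule conj_move[OF n(1) s])
  have 1: "lshift s (lshift n t) = lshift n' (lshift s t)" for t
    using n n' s by (auto simp: lshift_def m_assoc[symmetric])
  show "\<exists>U'\<in>pull ` lshift ` N. \<forall>z. blinfun_apply U (blinfun_apply (pull (lshift s)) z) = blinfun_apply (pull (lshift s)) (blinfun_apply U' z)"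
    using n n' by (intro bexI[of _ "pull (lshift n')"]) (auto intro!: bfun_eqI simp: 1)
  obtain n'' where n'': "n'' \<in> N" "n \<otimes> s = s \<otimes> n''" by (rule conj_move'[OF n(1) s])
  have 2: "lshift n (lshift s t) = lshift s (lshift n'' t)" for t
    using n n'' s by (auto simp: lshift_def m_assoc[symmetric])
  show "\<exists>U'\<in>pull ` lshift ` N. \<forall>z. blinfun_apply (pull (lshift s)) (blinfun_apply U z) = blinfun_apply U' (blinfun_apply (pull (lshift s)) z)"
    using n n'' by (intro bexI[of _ "pull (lshift n'')"]) (auto intro!: bfun_eqI simp: 2)
qed

text \<open>The left translates of \<open>mean u\<close> are the means of the left translates of \<open>u\<close>, by normality of \<open>N\<close>. They lie
  in the image under \<open>mean\<close> of the weak closure of the orbit of \<open>u\<close>, which is weakly compact.\<close>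

lemma mean_wap:
  assumes u: "u \<in> wap_functions G T"
  shows "val (NL.mean (to_bfun u)) \<in> wap_functions_quotient G T N"
proof -
  define m where "m = NL.mean (to_bfun u)"
  have u': "u \<in> bounded_continuous T" "L.rel_compact_orbit (to_bfun u)" using u by (auto simp: wap_functions_iff)
  have Nu: "NL.rel_compact_orbit (to_bfun u)" by (rule NL_rel_compact[OF u'(2)])
  have bc: "val m \<in> bounded_continuous T"
  proof -
    have "convex hull (pull ` lshift ` N) \<subseteq> {U. blinfun_apply U (to_bfun u) \<in> bc_bfun T}"
    proof (rule hull_minimal)
      show "pull ` lshift ` N \<subseteq> {U. blinfun_apply U (to_bfun u) \<in> bc_bfun T}"
        using pull_lshift[OF u'(1)] mem_carrier by (auto simp: val_to_bfun_bc[where S = T])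
      have "convex ((\<lambda>U. blinfun_apply U (to_bfun u)) -` bc_bfun T)"
        by (intro convex_linear_vimage linear_apply_blinfun subspace_imp_convex subspace_bc_bfun)
      then show "convex {U. blinfun_apply U (to_bfun u) \<in> bc_bfun T}" by (simp add: vimage_def)
    qed
    then have "m \<in> closure (bc_bfun T)"
      using NL.ergodic_limit_mean[OF Nu] unfolding m_def[symmetric] ergodic_limit_def closure_approachable dist_norm
      by blast
    then show ?thesis using closed_bc_bfun[of T] by (simp add: closure_closed)
  qed
  have inv: "coset_invariant (val m)"
    unfolding coset_invariant_def
  proof (intro ballI)
    fix n x assume nx: "n \<in> N" "x \<in> carrier G"
    have "blinfun_apply (pull (lshift n)) m = m"
      unfolding m_def using nx(1) by (intro NL.mean_invariant[OF Nu]) auto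
    then have "val m (lshift n x) = val m x" by (metis val_pull)
    then show "val m (n \<otimes> x) = val m x" using nx by (simp add: lshift_def)
  qed
  define K where "K = weak closure_of (L.orb (to_bfun u))"
  obtain K0 where K0: "compactin weak K0" "L.orb (to_bfun u) \<subseteq> K0" using u'(2) by (auto simp: L.rel_compact_orbit_def)
  have "K \<subseteq> K0" unfolding K_def by (intro closure_of_minimal compactin_weak_imp_closedin K0)
  then have cK: "compactin weak K" unfolding K_def by (intro closed_compactin[OF K0(1)]) auto
  have orbK: "L.orb (to_bfun u) \<subseteq> K" unfolding K_def by (intro closure_of_subset) simp
  have "L.invariant K"
    unfolding K_def using L.orb_invariant by (intro L.invariant_weak_closure) (auto simp: L.invariant_def)
  then have "NL.rel_compact_orbit w" if "w \<in> K" for w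
    using that cK mem_carrier by (auto simp: NL.rel_compact_orbit_def NL.orb_def L.invariant_def intro!: exI[of _ K])
  then have "compactin (subtopology weak {w. NL.rel_compact_orbit w}) K"
    using cK by (auto simp: compactin_subtopology)
  then have cM: "compactin weak (NL.mean ` K)" by (rule image_compactin[OF _ NL.continuous_map_mean])
  have "L.orb m \<subseteq> NL.mean ` K"
  proof
    fix h assume "h \<in> L.orb m"
    then obtain s where s: "s \<in> carrier G" "h = blinfun_apply (pull (lshift s)) m" by (auto simp: L.orb_def)
    then have "h = NL.mean (blinfun_apply (pull (lshift s)) (to_bfun u))" by (simp add: m_def mean_lshift[OF Nu])
    moreover have "blinfun_apply (pull (lshift s)) (to_bfun u) \<in> K" using orbK s(1) by (auto simp: L.orb_def)
    ultimately show "h \<in> NL.mean ` K" by blast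
  qed
  with cM have "L.rel_compact_orbit m" by (auto simp: L.rel_compact_orbit_def)
  then have "val m \<in> wap_functions G T" using bc by (simp add: wap_functions_iff to_bfun_val)
  with inv show ?thesis by (simp add: wap_functions_quotient_eq m_def)
qed

lemma mean_coset_invariant:
  assumes u: "u \<in> wap_functions_quotient G T N"
  shows "val (NL.mean (to_bfun u)) = u"
proof -
  have u': "u \<in> bounded_continuous T" "coset_invariant u" using u by (auto simp: wap_functions_quotient_eq wap_functions_iff)
  have "NL.mean (to_bfun u) = to_bfun u"
  proof (rule NL.mean_fixed)
    fix U assume "U \<in> pull ` lshift ` N"
    then obtain n where "n \<in> N" "U = pull (lshift n)" by blast
    then show "blinfun_apply U (to_bfun u) = to_bfun u"
      using u'(2) by (intro bfun_eqI) (auto simp: val_to_bfun_bc[OF u'(1)] lshift_def coset_invariant_def)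
  qed
  then show ?thesis by (simp add: val_to_bfun_bc[OF u'(1)])
qed

lemma complemented_wap_functions_quotient:
  "complemented_in (wap_functions_quotient G T N) (wap_functions G T) (sup_norm T)"
  unfolding complemented_in_def
proof (intro exI[of _ "\<lambda>u. val (NL.mean (to_bfun u))"] conjI ballI)
  let ?P = "\<lambda>u. val (NL.mean (to_bfun u))"
  let ?V = "wap_functions G T" and ?Y = "wap_functions_quotient G T N"
  show YV: "?Y \<subseteq> ?V" by (auto simp: wap_functions_quotient_eq)
  show "?P ` ?V = ?Y"
    using mean_wap mean_coset_invariant YV by (auto intro!: image_eqI[of _ ?P])
  show "?P (?P u) = ?P u" if "u \<in> ?V" for u
    by (rule mean_coset_invariant[OF mean_wap[OF that]])
  have bc: "u \<in> bounded_continuous T" and rc: "NL.rel_compact_orbit (to_bfun u)" if "u \<in> ?V" for u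
    using that NL_rel_compact by (auto simp: wap_functions_iff)
  show "bounded_clinear_on ?V (sup_norm T) (sup_norm T) ?P"
    unfolding bounded_clinear_on_def
  proof (intro conjI ballI allI exI[of _ 1])
    show "?P (u + v) = ?P u + ?P v" if "u \<in> ?V" "v \<in> ?V" for u v
      using that by (simp add: to_bfun_add[OF bc bc] NL.mean_add[OF rc rc] val_add_fun)
    show "?P (c *\<^sub>C u) = c *\<^sub>C ?P u" if u: "u \<in> ?V" for c u
    proof -
      have "NL.mean (cmult c (to_bfun u)) = cmult c (NL.mean (to_bfun u))"
      proof (rule NL.mean_commute(1)[OF rc[OF u] bounded_linear_cmult])
        fix U assume U: "U \<in> pull ` lshift ` N"
        have "blinfun_apply U (cmult c z) = cmult c (blinfun_apply U z)" for z
          using U by (auto intro!: bfun_eqI)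
        then show "\<exists>U'\<in>pull ` lshift ` N. \<forall>z. blinfun_apply U (cmult c z) = cmult c (blinfun_apply U' z)"
          "\<exists>U'\<in>pull ` lshift ` N. \<forall>z. cmult c (blinfun_apply U z) = blinfun_apply U' (cmult c z)"
          using U by metis+
      qed
      then show ?thesis
        unfolding to_bfun_scaleC_eq[OF bc[OF u]] by (simp add: fun_eq_iff scaleC_fun_def scaleC_complex_def)
    qed
    show "sup_norm T (?P u) \<le> 1 * sup_norm T u" if u: "u \<in> ?V" for u
    proof -
      have "?P u \<in> bounded_continuous T" using mean_wap[OF u] YV by (auto intro: bc)
      then have "sup_norm T (?P u) = norm (NL.mean (to_bfun u))"
        using norm_to_bfun_bc[OF _ topspace_nonempty, of "?P u"] by (simp add: to_bfun_val)
      also have "\<dots> \<le> 1 * norm (to_bfun u)" by (rule NL.norm_mean_le[OF rc[OF u]])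
      also have "norm (to_bfun u) = sup_norm T u" by (rule norm_to_bfun_bc[OF bc[OF u] topspace_nonempty])
      finally show ?thesis .
    qed
  qed
qed

end

section \<open>Weakly almost periodic representations\<close>

lemma dual_space_bounded_linear:
  fixes \<phi> :: "'x::complex_normed_vector \<Rightarrow> complex"
  assumes "\<phi> \<in> dual_space UNIV norm" shows "bounded_linear \<phi>"
proof -
  obtain K where add: "\<And>u v. \<phi> (u + v) = \<phi> u + \<phi> v" and scale: "\<And>c v. \<phi> (c *\<^sub>C v) = c * \<phi> v"
    and K: "\<And>v. cmod (\<phi> v) \<le> K * norm v"
    using assms unfolding dual_space_def bounded_clinear_on_def by (auto simp: scaleC_complex_def)
  show ?thesis
    using K by (intro bounded_linear_intro[of \<phi> K]) (auto simp: add scale scaleR_scaleC scaleC_complex_def mult.commute)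
qed

lemma real_functional_complexification:
  fixes \<psi> :: "'x::complex_normed_vector \<Rightarrow> real"
  assumes \<psi>: "bounded_linear \<psi>"
  shows "(\<lambda>x. Complex (\<psi> x) (- \<psi> (\<i> *\<^sub>C x))) \<in> dual_space UNIV norm" (is "?\<Phi> \<in> _")
proof -
  note lin = bounded_linear.linear[OF \<psi>]
  obtain K where K: "K > 0" "\<And>x. norm (\<psi> x) \<le> norm x * K"
    using bounded_linear.pos_bounded[OF \<psi>] by blast
  have \<psi>c: "\<psi> (c *\<^sub>C x) = Re c * \<psi> x + Im c * \<psi> (\<i> *\<^sub>C x)" for c x
  proof -
    have "c *\<^sub>C x = (complex_of_real (Re c) + complex_of_real (Im c) * \<i>) *\<^sub>C x"
      by (subst complex_eq[of c]) (simp add: mult.commute)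
    also have "\<dots> = Re c *\<^sub>R x + Im c *\<^sub>R (\<i> *\<^sub>C x)"
      by (simp add: scaleC_add_left scaleC_scaleC scaleR_scaleC)
    finally show ?thesis by (simp add: linear_add[OF lin] linear_scale[OF lin])
  qed
  show ?thesis
    unfolding dual_space_def bounded_clinear_on_def
  proof (intro CollectI conjI ballI allI exI[of _ "2 * K"])
    show "?\<Phi> (u + v) = ?\<Phi> u + ?\<Phi> v" for u v
      by (simp add: scaleC_add_right linear_add[OF lin] complex_eq_iff)
    show "?\<Phi> (c *\<^sub>C v) = c *\<^sub>C ?\<Phi> v" for c v
      by (simp add: scaleC_scaleC \<psi>c[of c] \<psi>c[of "\<i> * c"] complex_eq_iff scaleC_complex_def)
    show "cmod (?\<Phi> v) \<le> 2 * K * norm v" for v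
    proof -
      have "cmod (?\<Phi> v) \<le> \<bar>Re (?\<Phi> v)\<bar> + \<bar>Im (?\<Phi> v)\<bar>" by (rule cmod_le)
      also have "\<dots> \<le> norm v * K + norm v * K"
        using K(2)[of v] K(2)[of "\<i> *\<^sub>C v"] by (intro add_mono) (simp_all add: norm_scaleC)
      finally show ?thesis by (simp add: algebra_simps)
    qed
  qed
qed

text \<open>Uniform boundedness, applied to the evaluation functionals at the points of \<open>K\<close>.\<close>

lemma compactin_weak_bounded:
  fixes K :: "'a::real_normed_vector set"
  assumes K: "compactin weak K"
  obtains B where "\<And>x. x \<in> K \<Longrightarrow> norm x \<le> B"
proof -
  define ev where "ev = (\<lambda>x::'a. Blinfun (\<lambda>\<phi> :: 'a \<Rightarrow>\<^sub>L real. blinfun_apply \<phi> x))"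
  have ev: "blinfun_apply (ev x) \<phi> = blinfun_apply \<phi> x" for x \<phi>
    by (simp add: ev_def bounded_linear_Blinfun_apply blinfun.bounded_linear_left)
  obtain B where "\<And>E. E \<in> ev ` K \<Longrightarrow> norm E \<le> B"
  proof (rule uniform_boundedness[of "ev ` K"])
    fix \<phi> :: "'a \<Rightarrow>\<^sub>L real"
    have "compactin euclidean (blinfun_apply \<phi> ` K)"
      by (rule image_compactin[OF K continuous_map_weak_functional[OF blinfun.bounded_linear_right]])
    then have "bounded (blinfun_apply \<phi> ` K)" by (simp add: compact_imp_bounded)
    then show "\<exists>B. \<forall>A\<in>ev ` K. norm (blinfun_apply A \<phi>) \<le> B" by (auto simp: bounded_iff ev)
  qed (use that in blast)
  moreover have "norm x \<le> norm (ev x)" for x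
  proof -
    obtain \<phi> :: "'a \<Rightarrow> real" where \<phi>: "bounded_linear \<phi>" "\<phi> x = norm x" "\<And>y. \<bar>\<phi> y\<bar> \<le> norm y"
      by (rule norming_functional[of x]) (rule that)
    have "norm (Blinfun \<phi>) \<le> 1"
      using \<phi> by (intro norm_blinfun_bound) (auto simp: bounded_linear_Blinfun_apply)
    moreover have "norm (blinfun_apply (ev x) (Blinfun \<phi>)) \<le> norm (ev x) * norm (Blinfun \<phi>)" by (rule norm_blinfun)
    ultimately have "norm (blinfun_apply (ev x) (Blinfun \<phi>)) \<le> norm (ev x)"
      by (meson mult_left_le norm_ge_zero order_trans)
    then show ?thesis using \<phi> by (simp add: ev bounded_linear_Blinfun_apply)
  qed
  ultimately show thesis using that by (meson image_eqI order_trans)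
qed

lemma topspace_wo [simp]: "topspace weak_operator_topology = bounded_operators"
  by (simp add: weak_operator_topology_def)

lemma continuous_map_wo_coefficient:
  "\<phi> \<in> dual_space UNIV norm \<Longrightarrow>
     continuous_map weak_operator_topology euclidean (\<lambda>A. \<phi> (blinfun_apply A \<xi>))"
  unfolding weak_operator_topology_def by (rule continuous_map_from_initial_topology) blast

lemma continuous_map_wo_weak:
  "continuous_map weak_operator_topology weak (\<lambda>A. blinfun_apply A (\<xi> :: 'x::complex_banach))"
  unfolding continuous_map_into_initial_topology
proof (intro conjI ballI)
  fix \<psi> :: "'x \<Rightarrow> real" assume "\<psi> \<in> {\<psi>. bounded_linear \<psi>}"
  then have "continuous_map weak_operator_topology euclidean
      (\<lambda>A. Complex (\<psi> (blinfun_apply A \<xi>)) (- \<psi> (\<i> *\<^sub>C blinfun_apply A \<xi>)))"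
    by (intro continuous_map_wo_coefficient real_functional_complexification) simp
  moreover have "continuous_map euclidean euclidean Re" by (simp add: continuous_intros)
  ultimately have "continuous_map weak_operator_topology euclidean
      (Re \<circ> (\<lambda>A. Complex (\<psi> (blinfun_apply A \<xi>)) (- \<psi> (\<i> *\<^sub>C blinfun_apply A \<xi>))))"
    by (rule continuous_map_compose)
  then show "continuous_map weak_operator_topology euclidean (\<lambda>A. \<psi> (blinfun_apply A \<xi>))"
    by (simp add: o_def)
qed auto

locale wap_representation_normal = wap_representation G T \<pi> + topological_group_normal G T N
  for G :: "('g, 'm) monoid_scheme" (structure) and T :: "'g topology"
    and \<pi> :: "'g \<Rightarrow> ('x::complex_banach \<Rightarrow>\<^sub>L 'x)" and N :: "'g set"
begin

lemma rep_bounded_operator: "s \<in> carrier G \<Longrightarrow> \<pi> s \<in> bounded_operators"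
  using rep_continuous by (auto simp: continuous_map_def topspace_eq)

lemma rep_scaleC: "s \<in> carrier G \<Longrightarrow> blinfun_apply (\<pi> s) (c *\<^sub>C \<xi>) = c *\<^sub>C blinfun_apply (\<pi> s) \<xi>"
  using rep_bounded_operator by (auto simp: bounded_operators_def)

lemma rep_mult_apply:
  "s \<in> carrier G \<Longrightarrow> t \<in> carrier G \<Longrightarrow> blinfun_apply (\<pi> (s \<otimes> t)) \<xi> = blinfun_apply (\<pi> s) (blinfun_apply (\<pi> t) \<xi>)"
  by (simp add: rep_mult)

lemma orbit_rel_compact:
  obtains K where "compactin weak K" "\<And>s. s \<in> carrier G \<Longrightarrow> blinfun_apply (\<pi> s) \<xi> \<in> K"
proof (rule that)
  let ?S = "weak_operator_topology closure_of (\<pi> ` carrier G)"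
  show "compactin weak ((\<lambda>A. blinfun_apply A \<xi>) ` ?S)"
    by (rule image_compactin[OF wap continuous_map_wo_weak])
  have "\<pi> ` carrier G \<subseteq> ?S" using rep_bounded_operator by (intro closure_of_subset) auto
  then show "blinfun_apply (\<pi> s) \<xi> \<in> (\<lambda>A. blinfun_apply A \<xi>) ` ?S" if "s \<in> carrier G" for s
    using that by blast
qed

lemma rep_bounded:
  obtains C where "C > 0" "\<And>s. s \<in> carrier G \<Longrightarrow> norm (\<pi> s) \<le> C"
proof (rule uniform_boundedness[of "\<pi> ` carrier G"])
  fix \<xi>
  obtain K where K: "compactin weak K" "\<And>s. s \<in> carrier G \<Longrightarrow> blinfun_apply (\<pi> s) \<xi> \<in> K"
    by (rule orbit_rel_compact[of \<xi>]) (rule that)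
  obtain B where "\<And>x. x \<in> K \<Longrightarrow> norm x \<le> B" by (rule compactin_weak_bounded[OF K(1)]) (rule that)
  with K(2) show "\<exists>B. \<forall>A\<in>\<pi> ` carrier G. norm (blinfun_apply A \<xi>) \<le> B" by blast
qed (use that in blast)

lemma operator_group_rep:
  obtains C where "operator_group (\<pi> ` N) C"
proof -
  obtain C where C: "C > 0" "\<And>s. s \<in> carrier G \<Longrightarrow> norm (\<pi> s) \<le> C" by (rule rep_bounded) (rule that)
  have "operator_group (\<pi> ` N) C"
  proof
    show "id_blinfun \<in> \<pi> ` N" using rep_one one_closed by (metis imageI)
    show "U o\<^sub>L V \<in> \<pi> ` N" if "U \<in> \<pi> ` N" "V \<in> \<pi> ` N" for U V
      using that by (auto simp: rep_mult[symmetric])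
    show "\<exists>V\<in>\<pi> ` N. V o\<^sub>L U = id_blinfun \<and> U o\<^sub>L V = id_blinfun" if U: "U \<in> \<pi> ` N" for U
    proof -
      obtain n where n: "n \<in> N" "U = \<pi> n" using U by blast
      then show ?thesis
        by (intro bexI[of _ "\<pi> (inv n)"]) (auto simp: rep_mult[symmetric] rep_one)
    qed
    show "norm U \<le> C" if "U \<in> \<pi> ` N" for U using that C(2) by auto
  qed (rule C(1))
  then show thesis by (rule that)
qed

lemma coefficient_coset_invariant:
  assumes \<xi>: "\<forall>n\<in>N. blinfun_apply (\<pi> n) \<xi> = \<xi>"
  shows "coset_invariant (zero_ext (carrier G) (\<lambda>s. \<phi> (blinfun_apply (\<pi> s) \<xi>)))"
  unfolding coset_invariant_def
proof (intro ballI)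
  fix n x assume nx: "n \<in> N" "x \<in> carrier G"
  obtain n' where n': "n' \<in> N" "n \<otimes> x = x \<otimes> n'" by (rule conj_move'[OF nx])
  then have "blinfun_apply (\<pi> (n \<otimes> x)) \<xi> = blinfun_apply (\<pi> x) \<xi>"
    using nx \<xi> by (simp add: rep_mult_apply)
  then show "zero_ext (carrier G) (\<lambda>s. \<phi> (blinfun_apply (\<pi> s) \<xi>)) (n \<otimes> x) =
      zero_ext (carrier G) (\<lambda>s. \<phi> (blinfun_apply (\<pi> s) \<xi>)) x"
    using nx by (simp add: zero_ext_def)
qed

text \<open>The orbit of \<open>\<xi>\<close> controls the right translates \<open>s \<mapsto> \<phi>(\<pi>(s)\<pi>(t)\<xi>)\<close>, which depend linearly on \<open>\<pi>(t)\<xi>\<close>; weak almost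
  periodicity is about left translates, and the transposition theorem passes from one to the other.\<close>

lemma coefficient_wap:
  assumes \<phi>: "\<phi> \<in> dual_space UNIV norm"
  shows "zero_ext (carrier G) (\<lambda>s. \<phi> (blinfun_apply (\<pi> s) \<xi>)) \<in> wap_functions G T" (is "?u \<in> _")
proof -
  obtain C where C: "C > 0" "\<And>s. s \<in> carrier G \<Longrightarrow> norm (\<pi> s) \<le> C" by (rule rep_bounded) (rule that)
  have bl: "bounded_linear \<phi>" by (rule dual_space_bounded_linear[OF \<phi>])
  note lin = bounded_linear.linear[OF bl]
  obtain L where L: "L > 0" "\<And>x. cmod (\<phi> x) \<le> norm x * L" using bounded_linear.pos_bounded[OF bl] by blast
  have b: "cmod (\<phi> (blinfun_apply (\<pi> s) \<eta>)) \<le> C * L * norm \<eta>" if "s \<in> carrier G" for s \<eta>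
  proof -
    have "norm (blinfun_apply (\<pi> s) \<eta>) \<le> C * norm \<eta>"
      using norm_blinfun[of "\<pi> s" \<eta>] C(2)[OF that] by (meson mult_right_mono norm_ge_zero order_trans)
    then have "norm (blinfun_apply (\<pi> s) \<eta>) * L \<le> C * norm \<eta> * L" using L(1) by (intro mult_right_mono) auto
    then show ?thesis using L(2)[of "blinfun_apply (\<pi> s) \<eta>"] by (simp add: algebra_simps)
  qed
  have "continuous_map T euclidean ((\<lambda>A. \<phi> (blinfun_apply A \<xi>)) \<circ> \<pi>)"
    by (rule continuous_map_compose[OF rep_continuous continuous_map_wo_coefficient[OF \<phi>]])
  then have "continuous_map T euclidean ?u"
    by (rule continuous_map_eq) (simp add: zero_ext_def topspace_eq)
  moreover have "bounded (?u ` topspace T)"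
    using b by (auto simp: bounded_iff zero_ext_def topspace_eq)
  ultimately have bc: "?u \<in> bounded_continuous T"
    by (auto simp: bounded_continuous_def zero_ext_def topspace_eq)
  \<comment> \<open>Right translates of the coefficient depend weakly continuously on the orbit of \<open>\<xi>\<close>.\<close>
  define f where "f = (\<lambda>s t. if s \<in> carrier G \<and> t \<in> carrier G then \<phi> (blinfun_apply (\<pi> s) (blinfun_apply (\<pi> t) \<xi>)) else 0)"
  define \<Theta> where "\<Theta> = (\<lambda>\<eta> s. if s \<in> carrier G then \<phi> (blinfun_apply (\<pi> s) \<eta>) else 0)"
  have \<Theta>B: "norm (\<Theta> \<eta> s) \<le> C * L * norm \<eta>" for \<eta> s
    using b[of s \<eta>] C(1) L(1) by (simp add: \<Theta>_def)
  have bl\<Theta>: "bounded_linear (\<lambda>\<eta>. to_bfun (\<Theta> \<eta>))"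
    by (rule bounded_linear_bfunI[OF _ _ \<Theta>B])
      (auto simp: \<Theta>_def blinfun.add_right blinfun.scaleR_right linear_add[OF lin] linear_scale[OF lin])
  have fB: "norm (f s t) \<le> C * L * norm \<xi>" for s t
  proof (cases "s \<in> carrier G \<and> t \<in> carrier G")
    case True
    then have "f s t = \<phi> (blinfun_apply (\<pi> (s \<otimes> t)) \<xi>)" by (simp add: f_def rep_mult_apply)
    with True b[of "s \<otimes> t" \<xi>] show ?thesis by simp
  qed (use C(1) L(1) in \<open>auto simp: f_def\<close>)
  obtain K where K: "compactin weak K" "\<And>s. s \<in> carrier G \<Longrightarrow> blinfun_apply (\<pi> s) \<xi> \<in> K"
    by (rule orbit_rel_compact[of \<xi>]) (rule that)
  have cK: "compactin weak ((\<lambda>\<eta>. to_bfun (\<Theta> \<eta>)) ` K \<union> {0})"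
    by (intro compactin_Un image_compactin[OF K(1) continuous_map_weak_weak[OF bl\<Theta>]]) simp
  have mem: "to_bfun (\<lambda>s. f s t) \<in> (\<lambda>\<eta>. to_bfun (\<Theta> \<eta>)) ` K \<union> {0}" for t
  proof (cases "t \<in> carrier G")
    case True
    then have "(\<lambda>s. f s t) = \<Theta> (blinfun_apply (\<pi> t) \<xi>)" by (auto simp: f_def \<Theta>_def)
    then show ?thesis using K(2)[OF True] by auto
  next
    case False
    then have "to_bfun (\<lambda>s. f s t) = 0" by (intro bfun_eqI) (simp add: f_def val_to_bfun'[of _ 0])
    then show ?thesis by simp
  qed
  obtain K' where K': "compactin weak K'" "\<And>s. to_bfun (f s) \<in> K'"
    by (rule weakly_compact_transpose[OF cK mem fB]) (rule that)
  have "L.orb (to_bfun ?u) \<subseteq> K'"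
  proof
    fix h assume "h \<in> L.orb (to_bfun ?u)"
    then obtain s where s: "s \<in> carrier G" "h = blinfun_apply (pull (lshift s)) (to_bfun ?u)"
      by (auto simp: L.orb_def)
    have "h = to_bfun (f s)"
    proof (rule bfun_eqI)
      show "val h t = val (to_bfun (f s)) t" for t
        unfolding s(2) val_pull val_to_bfun_bc[OF bc] val_to_bfun'[OF fB]
        using s(1) by (auto simp: f_def lshift_def zero_ext_def rep_mult_apply)
    qed
    then show "h \<in> K'" using K'(2) by simp
  qed
  with K'(1) bc show ?thesis by (auto simp: wap_functions_iff L.rel_compact_orbit_def)
qed

lemma continuity_vectors_eq:
  "continuity_vectors (wap_quotient_topology G T N) \<pi> = {\<xi>. \<forall>n\<in>N. blinfun_apply (\<pi> n) \<xi> = \<xi>}"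
proof (intro equalityI subsetI)
  fix \<xi> assume "\<xi> \<in> continuity_vectors (wap_quotient_topology G T N) \<pi>"
  then have cont: "continuous_map (wap_quotient_topology G T N) (weak_topology UNIV norm) (\<lambda>s. blinfun_apply (\<pi> s) \<xi>)"
    by (simp add: continuity_vectors_def)
  have "blinfun_apply (\<pi> n) \<xi> = \<xi>" if n: "n \<in> N" for n
  proof (rule ccontr)
    assume ne: "blinfun_apply (\<pi> n) \<xi> \<noteq> \<xi>"
    have nG: "n \<in> carrier G" using n by (rule mem_carrier)
    obtain \<psi> :: "'x \<Rightarrow> real" where \<psi>: "bounded_linear \<psi>" "\<psi> (blinfun_apply (\<pi> n) \<xi> - \<xi>) = norm (blinfun_apply (\<pi> n) \<xi> - \<xi>)"
      "\<And>y. \<bar>\<psi> y\<bar> \<le> norm y"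
      by (rule norming_functional[of "blinfun_apply (\<pi> n) \<xi> - \<xi>"]) (rule that)
    define \<Phi> where "\<Phi> = (\<lambda>x. Complex (\<psi> x) (- \<psi> (\<i> *\<^sub>C x)))"
    have "\<Phi> \<in> dual_space UNIV norm" unfolding \<Phi>_def by (rule real_functional_complexification[OF \<psi>(1)])
    then have cont\<Phi>: "continuous_map (wap_quotient_topology G T N) euclidean (\<lambda>s. \<Phi> (blinfun_apply (\<pi> s) \<xi>))"
      using cont unfolding weak_topology_def continuous_map_into_initial_topology by blast
    have "\<psi> (blinfun_apply (\<pi> n) \<xi>) \<noteq> \<psi> \<xi>"
      using \<psi>(2) ne linear_diff[OF bounded_linear.linear[OF \<psi>(1)], of "blinfun_apply (\<pi> n) \<xi>" \<xi>] by auto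
    then have ne': "\<Phi> (blinfun_apply (\<pi> n) \<xi>) \<noteq> \<Phi> \<xi>" by (simp add: \<Phi>_def)
    define U where "U = {s \<in> carrier G. \<Phi> (blinfun_apply (\<pi> s) \<xi>) \<in> - {\<Phi> (blinfun_apply (\<pi> n) \<xi>)}}"
    have "openin (wap_quotient_topology G T N) U"
      using openin_continuous_map_preimage[OF cont\<Phi>, of "- {\<Phi> (blinfun_apply (\<pi> n) \<xi>)}"]
      by (simp add: U_def wap_quotient_topology_def open_Compl)
    moreover have "\<one> \<in> U" using ne' by (simp add: U_def rep_one)
    ultimately obtain F0 e where F0: "finite F0" "F0 \<subseteq> wap_functions_quotient G T N" "e > 0"
      "{y \<in> carrier G. \<forall>f\<in>F0. dist (f y) (f \<one>) < e} \<subseteq> U"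
      unfolding wap_quotient_topology_def by (rule initial_topology_basic_nbhd)
    have "dist (f n) (f \<one>) < e" if "f \<in> F0" for f
    proof -
      have "coset_invariant f" using that F0(2) by (auto simp: wap_functions_quotient_eq)
      then have "f (n \<otimes> \<one>) = f \<one>" using n unfolding coset_invariant_def by blast
      then show ?thesis using nG F0(3) by simp
    qed
    then have "n \<in> {y \<in> carrier G. \<forall>f\<in>F0. dist (f y) (f \<one>) < e}" using nG by simp
    then have "n \<in> U" using F0(4) by blast
    then show False by (simp add: U_def)
  qed
  then show "\<xi> \<in> {\<xi>. \<forall>n\<in>N. blinfun_apply (\<pi> n) \<xi> = \<xi>}" by blast
next
  fix \<xi> assume "\<xi> \<in> {\<xi>. \<forall>n\<in>N. blinfun_apply (\<pi> n) \<xi> = \<xi>}"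
  then have \<xi>: "\<forall>n\<in>N. blinfun_apply (\<pi> n) \<xi> = \<xi>" by simp
  have "continuous_map (wap_quotient_topology G T N) euclidean (\<lambda>s. \<phi> (blinfun_apply (\<pi> s) \<xi>))"
    if \<phi>: "\<phi> \<in> dual_space UNIV norm" for \<phi>
  proof -
    have "zero_ext (carrier G) (\<lambda>s. \<phi> (blinfun_apply (\<pi> s) \<xi>)) \<in> wap_functions_quotient G T N"
      using coefficient_wap[OF \<phi>] coefficient_coset_invariant[OF \<xi>] by (simp add: wap_functions_quotient_eq)
    then have "continuous_map (wap_quotient_topology G T N) euclidean (zero_ext (carrier G) (\<lambda>s. \<phi> (blinfun_apply (\<pi> s) \<xi>)))"
      unfolding wap_quotient_topology_def by (rule continuous_map_from_initial_topology)
    then show ?thesis by (rule continuous_map_eq) (simp add: zero_ext_def wap_quotient_topology_def)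
  qed
  then show "\<xi> \<in> continuity_vectors (wap_quotient_topology G T N) \<pi>"
    by (simp add: continuity_vectors_def weak_topology_def continuous_map_into_initial_topology)
qed

lemma convex_hull_bounded_operators: "convex hull (\<pi> ` carrier G) \<subseteq> bounded_operators"
proof (rule hull_minimal)
  show "\<pi> ` carrier G \<subseteq> bounded_operators" using rep_bounded_operator by blast
  show "convex (bounded_operators :: ('x \<Rightarrow>\<^sub>L 'x) set)"
    by (rule convexI)
      (simp add: bounded_operators_def blinfun.add_left blinfun.scaleR_left scaleC_add_right scaleR_scaleC scaleC_scaleC mult.commute)
qed

text \<open>The idempotent is \<open>mean\<close> for the group \<open>\<pi>(N)\<close>. It commutes with \<open>\<pi>(s)\<close> because \<open>N\<close> is normal, and with
  complex scalars because \<open>\<pi>(N)\<close> does; it lies in the weak operator closure because a basic neighbourhood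
  tests only finitely many vectors.\<close>

lemma reducing_fixed_vectors: "reducing_subspace G \<pi> {\<xi>. \<forall>n\<in>N. blinfun_apply (\<pi> n) \<xi> = \<xi>}"
proof -
  obtain C where C: "operator_group (\<pi> ` N) C" by (rule operator_group_rep) (rule that)
  interpret P: operator_group "\<pi> ` N" C by (rule C)
  have rc: "P.rel_compact_orbit \<xi>" for \<xi>
  proof -
    obtain K where "compactin weak K" "\<And>s. s \<in> carrier G \<Longrightarrow> blinfun_apply (\<pi> s) \<xi> \<in> K"
      by (rule orbit_rel_compact[of \<xi>]) (rule that)
    then show ?thesis by (auto simp: P.rel_compact_orbit_def P.orb_def)
  qed
  have "bounded_linear P.mean"
    using P.norm_mean_le[OF rc] by (intro bounded_linear_intro[of _ C]) (auto simp: P.mean_add rc P.mean_scaleR mult.commute)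
  then have M: "blinfun_apply (Blinfun P.mean) = P.mean" by (rule bounded_linear_Blinfun_apply)
  define M where "M = Blinfun P.mean"
  have Mm: "blinfun_apply M \<xi> = P.mean \<xi>" for \<xi> by (simp add: M_def M)
  have fixM: "blinfun_apply (\<pi> n) (blinfun_apply M \<xi>) = blinfun_apply M \<xi>" if "n \<in> N" for n \<xi>
    unfolding Mm using that by (intro P.mean_invariant[OF rc]) auto
  have Mfix: "blinfun_apply M \<xi> = \<xi>" if "\<forall>n\<in>N. blinfun_apply (\<pi> n) \<xi> = \<xi>" for \<xi>
    unfolding Mm using that by (intro P.mean_fixed) auto
  have idem: "M o\<^sub>L M = M"
    by (rule blinfun_eqI) (simp add: Mfix fixM)
  have range: "{\<xi>. \<forall>n\<in>N. blinfun_apply (\<pi> n) \<xi> = \<xi>} = range (blinfun_apply M)"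
    using fixM Mfix by (auto intro: range_eqI[of _ _ "_::'x", OF sym])
  have comm: "\<pi> s o\<^sub>L M = M o\<^sub>L \<pi> s" if s: "s \<in> carrier G" for s
  proof (rule blinfun_eqI)
    fix \<xi>
    have "P.mean (blinfun_apply (\<pi> s) \<xi>) = blinfun_apply (\<pi> s) (P.mean \<xi>)"
    proof (rule P.mean_commute(1)[OF rc blinfun.bounded_linear_right])
      fix U assume "U \<in> \<pi> ` N"
      then obtain n where n: "n \<in> N" "U = \<pi> n" by blast
      obtain n' where n': "n' \<in> N" "n \<otimes> s = s \<otimes> n'" by (rule conj_move'[OF n(1) s])
      have "\<forall>z. blinfun_apply (\<pi> n) (blinfun_apply (\<pi> s) z) = blinfun_apply (\<pi> s) (blinfun_apply (\<pi> n') z)"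
        using n(1) n' s by (simp add: rep_mult_apply[symmetric])
      then show "\<exists>U'\<in>\<pi> ` N. \<forall>z. blinfun_apply U (blinfun_apply (\<pi> s) z) = blinfun_apply (\<pi> s) (blinfun_apply U' z)"
        using n(2) n'(1) by blast
      obtain n'' where n'': "n'' \<in> N" "s \<otimes> n = n'' \<otimes> s" by (rule conj_move[OF n(1) s])
      have "\<forall>z. blinfun_apply (\<pi> s) (blinfun_apply (\<pi> n) z) = blinfun_apply (\<pi> n'') (blinfun_apply (\<pi> s) z)"
        using n(1) n'' s by (simp add: rep_mult_apply[symmetric])
      then show "\<exists>U'\<in>\<pi> ` N. \<forall>z. blinfun_apply (\<pi> s) (blinfun_apply U z) = blinfun_apply U' (blinfun_apply (\<pi> s) z)"
        using n(2) n''(1) by blast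
    qed
    then show "blinfun_apply (\<pi> s o\<^sub>L M) \<xi> = blinfun_apply (M o\<^sub>L \<pi> s) \<xi>" by (simp add: Mm)
  qed
  have Mbo: "M \<in> bounded_operators"
    unfolding bounded_operators_def
  proof (intro CollectI allI)
    fix c :: complex and \<xi> :: 'x
    have bl: "bounded_linear (\<lambda>x::'x. c *\<^sub>C x)"
      by (intro bounded_linear_intro[of _ "cmod c"])
        (auto simp: scaleC_add_right scaleR_scaleC scaleC_scaleC norm_scaleC mult.commute)
    have "P.mean (c *\<^sub>C \<xi>) = c *\<^sub>C P.mean \<xi>"
    proof (rule P.mean_commute(1)[OF rc bl])
      fix U assume "U \<in> \<pi> ` N"
      then have "\<forall>z. blinfun_apply U (c *\<^sub>C z) = c *\<^sub>C blinfun_apply U z" "U \<in> \<pi> ` N" using rep_scaleC by auto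
      then show "\<exists>U'\<in>\<pi> ` N. \<forall>z. blinfun_apply U (c *\<^sub>C z) = c *\<^sub>C blinfun_apply U' z"
        "\<exists>U'\<in>\<pi> ` N. \<forall>z. c *\<^sub>C blinfun_apply U z = blinfun_apply U' (c *\<^sub>C z)" by metis+
    qed
    then show "blinfun_apply M (c *\<^sub>C \<xi>) = c *\<^sub>C blinfun_apply M \<xi>" by (simp add: Mm)
  qed
  have "M \<in> Aff_wo G \<pi>"
    unfolding Aff_wo_def in_closure_of
  proof (intro conjI allI impI)
    show "M \<in> topspace weak_operator_topology" using Mbo by simp
    fix U assume U: "M \<in> U \<and> openin weak_operator_topology U"
    then have "openin (initial_topology bounded_operators
        {\<lambda>A. \<phi> (blinfun_apply A (\<xi> :: 'x)) | \<phi> \<xi>. \<phi> \<in> dual_space UNIV norm}) U" "M \<in> U"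
      by (simp_all add: weak_operator_topology_def)
    then obtain F0 e where F0: "finite F0" "F0 \<subseteq> {\<lambda>A. \<phi> (blinfun_apply A \<xi>) | \<phi> \<xi>. \<phi> \<in> dual_space UNIV norm}" "e > 0"
      "{A \<in> bounded_operators. \<forall>f\<in>F0. dist (f A) (f M) < e} \<subseteq> U"
      by (rule initial_topology_basic_nbhd)
    have "\<exists>\<phi> \<xi> K. f = (\<lambda>A. \<phi> (blinfun_apply A \<xi>)) \<and> K > 0 \<and> linear \<phi> \<and> (\<forall>x. cmod (\<phi> x) \<le> norm x * K)" if fF: "f \<in> F0" for f
    proof -
      obtain \<phi> \<xi> where f: "f = (\<lambda>A. \<phi> (blinfun_apply A \<xi>))" "\<phi> \<in> dual_space UNIV norm" using fF F0(2) by blast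
      have bl: "bounded_linear \<phi>" by (rule dual_space_bounded_linear[OF f(2)])
      then obtain K where "K > 0" "\<And>x. cmod (\<phi> x) \<le> norm x * K" using bounded_linear.pos_bounded by blast
      then show ?thesis using f(1) bounded_linear.linear[OF bl] by blast
    qed
    then obtain \<phi> \<xi> K where f: "\<And>f. f \<in> F0 \<Longrightarrow> f = (\<lambda>A. \<phi> f (blinfun_apply A (\<xi> f)))"
      "\<And>f. f \<in> F0 \<Longrightarrow> K f > 0" "\<And>f. f \<in> F0 \<Longrightarrow> linear (\<phi> f)" "\<And>f x. f \<in> F0 \<Longrightarrow> cmod (\<phi> f x) \<le> norm x * K f"
      by metis
    define \<delta> where "\<delta> = e / (1 + sum K F0)"
    have sum0: "sum K F0 \<ge> 0" using f(2) by (intro sum_nonneg) (auto intro: less_imp_le)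
    have \<delta>: "\<delta> > 0" using F0(3) sum0 by (simp add: \<delta>_def add_pos_nonneg)
    obtain A where A: "A \<in> convex hull (\<pi> ` N)" "\<forall>x\<in>\<xi> ` F0. norm (blinfun_apply A x - P.mean x) < \<delta>"
      using P.mean_simultaneous[of "\<xi> ` F0" \<delta>] F0(1) rc \<delta> by auto
    have AG: "A \<in> convex hull (\<pi> ` carrier G)"
      using A(1) hull_mono[of "\<pi> ` N" "\<pi> ` carrier G" convex] subset by blast
    have "dist (f A) (f M) < e" if fF: "f \<in> F0" for f
    proof -
      have "f A - f M = \<phi> f (blinfun_apply A (\<xi> f) - P.mean (\<xi> f))"
        using fun_cong[OF f(1)[OF fF], of A] fun_cong[OF f(1)[OF fF], of M] linear_diff[OF f(3)[OF fF]] by (simp add: Mm)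
      then have "dist (f A) (f M) \<le> norm (blinfun_apply A (\<xi> f) - P.mean (\<xi> f)) * K f"
        using f(4)[OF fF] by (simp add: dist_norm)
      also have "\<dots> \<le> \<delta> * K f" using A(2) fF f(2)[OF fF] by (intro mult_right_mono) (auto intro: less_imp_le)
      also have "\<dots> < e"
      proof -
        have "K f \<le> sum K F0" using F0(1) fF f(2) by (intro member_le_sum) (auto intro: less_imp_le)
        then have "K f < 1 + sum K F0" by simp
        then have "e * K f < e * (1 + sum K F0)" using F0(3) by (intro mult_strict_left_mono)
        then show ?thesis using sum0 by (simp add: \<delta>_def divide_less_eq add_pos_nonneg)
      qed
      finally show ?thesis .
    qed
    then have "A \<in> U" using F0(4) AG convex_hull_bounded_operators by blast
    then show "\<exists>A. A \<in> convex hull (\<pi> ` carrier G) \<and> A \<in> U" using AG by blast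
  qed
  moreover have "complex_vector.subspace {\<xi>. \<forall>n\<in>N. blinfun_apply (\<pi> n) \<xi> = \<xi>}"
    unfolding complex_vector.subspace_def by (auto simp: blinfun.add_right rep_scaleC)
  ultimately show ?thesis
    unfolding reducing_subspace_def using idem comm range by blast
qed

end

theorem corollary3p8:
  fixes G :: "('g, 'm) monoid_scheme" and T :: "'g topology" and N :: "'g set"
  assumes "weakly_almost_periodic_group G T"
    and "N \<lhd> G" and "closedin T N"
  shows
    "(\<forall>\<pi> :: 'g \<Rightarrow> ('x::complex_banach \<Rightarrow>\<^sub>L 'x). wap_representation G T \<pi> \<longrightarrow>
        continuity_vectors (wap_quotient_topology G T N) \<pi>
          = {\<xi>. \<forall>n\<in>N. blinfun_apply (\<pi> n) \<xi> = \<xi>} \<and>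
        reducing_subspace G \<pi> {\<xi>. \<forall>n\<in>N. blinfun_apply (\<pi> n) \<xi> = \<xi>}) \<and>
     complex_vector.subspace (wap_functions_quotient G T N) \<and>
     wap_functions_quotient G T N \<subseteq> wap_functions G T \<and>
     complemented_in (wap_functions_quotient G T N) (wap_functions G T) (sup_norm T) \<and>
     translation_invariant G (wap_functions_quotient G T N)"
proof -
  interpret W: weakly_almost_periodic_group G T by (rule assms(1))
  interpret normal N G by (rule assms(2))
  interpret topological_group_normal G T N by unfold_locales
  have "continuity_vectors (wap_quotient_topology G T N) \<pi> = {\<xi>. \<forall>n\<in>N. blinfun_apply (\<pi> n) \<xi> = \<xi>} \<and>
      reducing_subspace G \<pi> {\<xi>. \<forall>n\<in>N. blinfun_apply (\<pi> n) \<xi> = \<xi>}"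
    if "wap_representation G T \<pi>" for \<pi> :: "'g \<Rightarrow> ('x \<Rightarrow>\<^sub>L 'x)"
  proof -
    interpret R: wap_representation G T \<pi> by (rule that)
    interpret wap_representation_normal G T \<pi> N by unfold_locales
    show ?thesis using continuity_vectors_eq reducing_fixed_vectors by blast
  qed
  then show ?thesis
    using subspace_wap_functions_quotient complemented_wap_functions_quotient
      translation_invariant_wap_functions_quotient wap_functions_quotient_eq by auto
qed

end
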